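(* Let $L=4D_4^{\mathcal G}\oplus\mathcal{G}_{1,1}$. The $i$-reflections in the $32$ roots $\{s_v:v\in D\}$ of $L$ listed in the context generate $R(L)$. These generators obey the following Coxeter relations: for distinct $d,d'\in D$ with corresponding $i$-reflections $R=R_{s_d}$ and $R'=R_{s_{d'}}$, - if $\{d,d'\}$ is an incident pair consisting of a point and a hyperplane, then $RR'R=R'RR'$; - if $d'=t_a(d)$, then $RR'RR'=R'RR'R$; - otherwise $RR'=R'R$.
   Context: Let $\mathcal{G}=\mathbb{Z}[i]$, $p=1+i$. Hermitian forms are linear in the second variable and $v^2=\langle v|v\rangle$. $D_4^{\mathcal G}=\{(x_1,x_2)\in\mathcal{G}^2:x_1+x_2\equiv0\bmod p\}$ with form $\bar x_1x_1'+\bar x_2x_2'$; $\mathcal{G}_{1,1}=\mathcal{G}^2$ with form $\langle (m,n)|(m',n')\rangle=\bar m\bar pn'+\bar npm'$; $L=4D_4^{\mathcal G}\oplus\mathcal{G}_{1,1}$ has signature $(9,1)$. A root of $L$ is a vector of norm $2$; the $i$-reflection in a root $s$ is $R_s(x)=x-(1-i)\frac{\langle s|x\rangle}{s^2}s$, and $R(L)\subseteq\mathrm{Aut}(L)$ is the group generated by the $i$-reflections in all roots. The set $D$. Let $g_1,\dots,g_4$ be the standard basis of $\mathbb{F}_2^4$, $a=(1,1,1,1)$, $c_k=a+g_k$, $e_{jk}=a+g_j+g_k$ ($1\le j<k\le4$), $z=0$; these and the $g_k$ are the sixteen points of $\mathbb{F}_2^4$. Let $d_k=\{x\in\mathbb{F}_2^4:x_k=0\}$,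 $f_k=\{x\in\mathbb{F}_2^4:x_k=\sum_jx_j\}$, $b_k=\mathbb{F}_2^4-f_k$, $h_k=\mathbb{F}_2^4-d_k$, and $\mathcal{K}=\{d_k,f_k,b_k,h_k:1\le k\le4\}$. Put $D=\mathbb{F}_2^4\cup\mathcal{K}$ ($32$ elements). A point $u$ and a hyperplane $v\in\mathcal K$ are incident if $u\in v$. $t_a$ is the permutation of $D$ induced by the translation $x\mapsto x+a$ of $\mathbb{F}_2^4$. The roots. Elements of $L$ are written $(x_1,x_2,x_3,x_4;m,n)$ with blocks $x_j\in D_4^{\mathcal G}$, $m,n\in\mathcal{G}$. - $s_a$: all blocks $(0,0)$; $(m,n)=(-1,-1)$. - $s_{c_k}$: block $k$ is $(-1,1)$, other blocks $0$; $(m,n)=(0,0)$. - $s_{e_{jk}}$: blocks $j,k$ are $(-1,-1)$, others $0$; $(m,n)=(-i,-1)$. - $s_{g_k}$: block $k$ is $(0,-2)$, others $(-1,-1)$; $(m,n)=(-2i,-2)$. - $s_z$: all blocks $(-1,-1)$; $(m,n)=(1-2i,-1)$. - $s_{f_k}$: block $k$ is $(0,0)$, others $(0,p)$; $(m,n)=(ip,p)$. - $s_{b_k}$: block $k$ is $(0,p)$, others $0$; $(m,n)=(-1,0)$. - $s_{d_k}$: block $k$ is $(-p,0)$, others $0$; $(m,n)=(0,0)$. - $s_{h_k}$: block $k$ is $(p,p)$, others $(0,p)$; $(m,n)=(p-3,p)$. *)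

theory Defs
  imports "HOL-Analysis.Analysis" "HOL-Algebra.Bij" "HOL-Algebra.Generated_Groups" "HOL-Library.Z2"
begin

section \<open>The lattice\<close>

definition gauss :: "complex set" where
  "gauss = {z. Re z \<in> \<int> \<and> Im z \<in> \<int>}"

definition pG :: complex where
  "pG = 1 + \<i>"

definition D4G :: "(complex \<times> complex) set" where
  "D4G = {(x1, x2). x1 \<in> gauss \<and> x2 \<in> gauss \<and> (\<exists>q\<in>gauss. x1 + x2 = pG * q)}"

definition D4G_form :: "complex \<times> complex \<Rightarrow> complex \<times> complex \<Rightarrow> complex" where
  "D4G_form x y = cnj (fst x) * fst y + cnj (snd x) * snd y"

definition G11_form :: "complex \<times> complex \<Rightarrow> complex \<times> complex \<Rightarrow> complex" where
  "G11_form x y = cnj (fst x) * cnj pG * snd y + cnj (snd x) * pG * fst y"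

text \<open>
  Elements \<open>(x1, x2, x3, x4; m, n)\<close>: four blocks and a pair, inside the ambient space
  \<open>\<complex>\<^sup>1\<^sup>0\<close>. The four blocks are indexed by the type \<open>4\<close>, whose elements are \<open>1, 2, 3, 4 = 0\<close>.
\<close>

type_synonym gvec = "((complex \<times> complex)^4) \<times> complex \<times> complex"

definition L :: "gvec set" where
  "L = {(x, m, n). (\<forall>j. x $ j \<in> D4G) \<and> m \<in> gauss \<and> n \<in> gauss}"

definition hform :: "gvec \<Rightarrow> gvec \<Rightarrow> complex" where
  "hform x y = (\<Sum>j\<in>UNIV. D4G_form (fst x $ j) (fst y $ j)) + G11_form (snd x) (snd y)"

definition cscale :: "complex \<Rightarrow> gvec \<Rightarrow> gvec" where
  "cscale c x = ((\<chi> j. (c * fst (fst x $ j), c * snd (fst x $ j))),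
                 c * fst (snd x), c * snd (snd x))"

section \<open>The automorphism group and the reflection group\<close>

definition lattice_auts :: "(gvec \<Rightarrow> gvec) set" where
  "lattice_auts = {f \<in> Bij L.
     (\<forall>x\<in>L. \<forall>y\<in>L. f (x + y) = f x + f y) \<and>
     (\<forall>c\<in>gauss. \<forall>x\<in>L. f (cscale c x) = cscale c (f x)) \<and>
     (\<forall>x\<in>L. \<forall>y\<in>L. hform (f x) (f y) = hform x y)}"

definition Aut_L :: "(gvec \<Rightarrow> gvec) monoid" where
  "Aut_L = BijGroup L \<lparr>carrier := lattice_auts\<rparr>"

definition roots :: "gvec set" where
  "roots = {s \<in> L. hform s s = 2}"

definition refl_i :: "gvec \<Rightarrow> gvec \<Rightarrow> gvec" where
  "refl_i s = (\<lambda>x\<in>L. x - cscale ((1 - \<i>) * (hform s x / hform s s)) s)"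

definition R_L :: "(gvec \<Rightarrow> gvec) set" where
  "R_L = generate Aut_L (refl_i ` roots)"

section \<open>Points and hyperplanes of \<open>\<F>\<^sub>2\<^sup>4\<close>\<close>

definition pt_g :: "4 \<Rightarrow> bit^4" where
  "pt_g k = axis k 1"

definition pt_a :: "bit^4" where
  "pt_a = (\<chi> i. 1)"

definition pt_c :: "4 \<Rightarrow> bit^4" where
  "pt_c k = pt_a + pt_g k"

definition pt_e :: "4 \<Rightarrow> 4 \<Rightarrow> bit^4" where
  "pt_e j k = pt_a + pt_g j + pt_g k"

definition hyp_d :: "4 \<Rightarrow> (bit^4) set" where
  "hyp_d k = {x. x $ k = 0}"

definition hyp_f :: "4 \<Rightarrow> (bit^4) set" where
  "hyp_f k = {x. x $ k = (\<Sum>j\<in>UNIV. x $ j)}"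

definition hyp_b :: "4 \<Rightarrow> (bit^4) set" where
  "hyp_b k = UNIV - hyp_f k"

definition hyp_h :: "4 \<Rightarrow> (bit^4) set" where
  "hyp_h k = UNIV - hyp_d k"

definition hyperplanes :: "(bit^4) set set" where
  "hyperplanes = range hyp_d \<union> range hyp_f \<union> range hyp_b \<union> range hyp_h"

datatype vertex = Point "bit^4" | Hyper "(bit^4) set"

definition DD :: "vertex set" where
  "DD = range Point \<union> Hyper ` hyperplanes"

definition incident_pair :: "vertex \<Rightarrow> vertex \<Rightarrow> bool" where
  "incident_pair d d' \<longleftrightarrow> (\<exists>u v. u \<in> v \<and> {d, d'} = {Point u, Hyper v})"

fun t_a :: "vertex \<Rightarrow> vertex" where
  "t_a (Point u) = Point (u + pt_a)"
| "t_a (Hyper v) = Hyper ((\<lambda>x. x + pt_a) ` v)"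

section \<open>The 32 roots\<close>

text \<open>
  The table is stated as a relation between labels and vectors; \<open>ex1_root_table\<close> below shows that
  it is the graph of a function on \<open>DD\<close>. In \<open>e\<close> the indices are only required to be different,
  as \<open>pt_e\<close> and the vector are symmetric in \<open>j\<close> and \<open>k\<close>.
\<close>

inductive root_table :: "vertex \<Rightarrow> gvec \<Rightarrow> bool" where
  a: "root_table (Point pt_a) ((\<chi> j. (0, 0)), -1, -1)"
| c: "root_table (Point (pt_c k)) ((\<chi> j. if j = k then (-1, 1) else (0, 0)), 0, 0)"
| e: "j \<noteq> k \<Longrightarrow> root_table (Point (pt_e j k))
        ((\<chi> l. if l = j \<or> l = k then (-1, -1) else (0, 0)), - \<i>, -1)"
| g: "root_table (Point (pt_g k))
        ((\<chi> j. if j = k then (0, -2) else (-1, -1)), -2 * \<i>, -2)"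
| z: "root_table (Point 0) ((\<chi> j. (-1, -1)), 1 - 2 * \<i>, -1)"
| f: "root_table (Hyper (hyp_f k))
        ((\<chi> j. if j = k then (0, 0) else (0, pG)), \<i> * pG, pG)"
| b: "root_table (Hyper (hyp_b k)) ((\<chi> j. if j = k then (0, pG) else (0, 0)), -1, 0)"
| d: "root_table (Hyper (hyp_d k)) ((\<chi> j. if j = k then (- pG, 0) else (0, 0)), 0, 0)"
| h: "root_table (Hyper (hyp_h k))
        ((\<chi> j. if j = k then (pG, pG) else (0, pG)), pG - 3, pG)"

definition root_of :: "vertex \<Rightarrow> gvec" where
  "root_of v = (THE x. root_table v x)"

lemma pt_nth:
  "pt_a $ i = 1"
  "pt_g k $ i = (if i = k then 1 else 0)"
  "pt_c k $ i = (if i = k then 0 else 1)"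
  "j \<noteq> k \<Longrightarrow> pt_e j k $ i = (if i = j \<or> i = k then 0 else 1)"
  by (auto simp: pt_a_def pt_g_def pt_c_def pt_e_def axis_def)

lemma hyp_mem:
  "0 \<in> hyp_d k" "0 \<in> hyp_f k" "0 \<notin> hyp_b k" "0 \<notin> hyp_h k"
  "pt_g j \<in> hyp_d k \<longleftrightarrow> j \<noteq> k" "pt_g j \<in> hyp_f k \<longleftrightarrow> j = k"
  "pt_g j \<in> hyp_b k \<longleftrightarrow> j \<noteq> k" "pt_g j \<in> hyp_h k \<longleftrightarrow> j = k"
  by (auto simp: hyp_d_def hyp_f_def hyp_b_def hyp_h_def pt_nth)

lemma ex_4: "(\<exists>i::4. P i) \<longleftrightarrow> P 1 \<or> P 2 \<or> P 3 \<or> P 4"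
  using forall_4[of "\<lambda>i. \<not> P i"] by blast

lemma not_eq_compl_4: "\<exists>i::4. (i \<noteq> j) = (i \<noteq> k)"
  using exhaust_4[of j] exhaust_4[of k] by (auto simp: ex_4)

lemma hyp_eq:
  "hyp_d j = hyp_d k \<longleftrightarrow> j = k" "hyp_f j = hyp_f k \<longleftrightarrow> j = k"
  "hyp_b j = hyp_b k \<longleftrightarrow> j = k" "hyp_h j = hyp_h k \<longleftrightarrow> j = k"
  "hyp_d j \<noteq> hyp_f k" "hyp_d j \<noteq> hyp_b k" "hyp_d j \<noteq> hyp_h k"
  "hyp_f j \<noteq> hyp_b k" "hyp_f j \<noteq> hyp_h k" "hyp_b j \<noteq> hyp_h k"
  "hyp_f j \<noteq> hyp_d k" "hyp_b j \<noteq> hyp_d k" "hyp_h j \<noteq> hyp_d k"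
  "hyp_b j \<noteq> hyp_f k" "hyp_h j \<noteq> hyp_f k" "hyp_h j \<noteq> hyp_b k"
  using not_eq_compl_4[of j k] hyp_mem by metis+

lemma pt_eq:
  "pt_c j = pt_c k \<longleftrightarrow> j = k" "pt_g j = pt_g k \<longleftrightarrow> j = k"
  by (auto simp: vec_eq_iff pt_nth split: if_splits)

lemma pt_e_eq:
  assumes "j \<noteq> k" "j' \<noteq> k'" "pt_e j k = pt_e j' k'"
  shows "j = j' \<and> k = k' \<or> j = k' \<and> k = j'"
proof -
  have "{i. pt_e j k $ i = 0} = {j, k}" "{i. pt_e j' k' $ i = 0} = {j', k'}"
    using assms(1,2) by (auto simp: pt_nth split: if_splits)
  then show ?thesis
    using assms(3) by (auto simp: doubleton_eq_iff)
qed

lemma pt_neq: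
  "pt_a \<noteq> pt_c k" "pt_a \<noteq> pt_g k" "pt_a \<noteq> 0" "pt_c j \<noteq> pt_g k" "pt_c k \<noteq> 0" "pt_g k \<noteq> 0"
  using exhaust_4[of j] exhaust_4[of k] by (auto simp: vec_eq_iff forall_4 pt_nth)

lemma pt_e_neq:
  assumes "j \<noteq> k"
  shows "pt_e j k \<noteq> pt_a" "pt_e j k \<noteq> pt_c l" "pt_e j k \<noteq> pt_g l" "pt_e j k \<noteq> 0"
  using assms exhaust_4[of j] exhaust_4[of k] exhaust_4[of l]
  by (auto simp: vec_eq_iff forall_4 pt_nth)

lemma root_table_functional:
  assumes "root_table v x" "root_table v y" shows "x = y"
  using assms
proof (cases rule: root_table.cases)
  case (e j k)
  from assms(2) e(1) show ?thesis
  proof (cases rule: root_table.cases)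
    case (e j' k')
    then show ?thesis using \<open>v = Point (pt_e j k)\<close> \<open>x = _\<close> \<open>j \<noteq> k\<close> pt_e_eq[of j k j' k']
      by (auto simp: vec_eq_iff)
  qed (use e in \<open>auto simp: pt_e_neq pt_e_neq[symmetric]\<close>)
qed (erule root_table.cases;
     simp add: pt_eq pt_neq pt_neq[symmetric] pt_e_neq pt_e_neq[symmetric] hyp_eq)+

lemma root_of_eq: "root_table v x \<Longrightarrow> root_of v = x"
  unfolding root_of_def using root_table_functional by blast

lemma points_cases:
  obtains "u = pt_a" | k where "u = pt_c k" | j k where "j \<noteq> k" "u = pt_e j k"
  | k where "u = pt_g k" | "u = 0"
proof -
  have "(\<forall>i. u $ i = 1) \<or> (\<exists>k. \<forall>i. u $ i = (if i = k then 0 else 1)) \<or>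
    (\<exists>j k. j \<noteq> k \<and> (\<forall>i. u $ i = (if i = j \<or> i = k then 0 else 1))) \<or>
    (\<exists>k. \<forall>i. u $ i = (if i = k then 1 else 0)) \<or> (\<forall>i. u $ i = 0)"
    by (cases "u $ 1"; cases "u $ 2"; cases "u $ 3"; cases "u $ 4")
       (simp_all add: forall_4 ex_4)
  then consider "\<forall>i. u $ i = 1" | k where "\<forall>i. u $ i = (if i = k then 0 else 1)"
    | j k where "j \<noteq> k" "\<forall>i. u $ i = (if i = j \<or> i = k then 0 else 1)"
    | k where "\<forall>i. u $ i = (if i = k then 1 else 0)" | "\<forall>i. u $ i = 0"
    by (elim disjE exE conjE) (erule (1) that | erule that)+
  then show ?thesis
  proof cases
    case 1
    then show ?thesis by (intro that(1)) (simp add: vec_eq_iff pt_nth)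
  next
    case (2 k)
    then show ?thesis by (intro that(2)[of k]) (simp add: vec_eq_iff pt_nth)
  next
    case (3 j k)
    then show ?thesis by (intro that(3)[of j k]) (simp_all add: vec_eq_iff pt_nth)
  next
    case (4 k)
    then show ?thesis by (intro that(4)[of k]) (simp add: vec_eq_iff pt_nth)
  next
    case 5
    then show ?thesis by (intro that(5)) (simp add: vec_eq_iff)
  qed
qed

lemma ex1_root_table:
  assumes "v \<in> DD" shows "\<exists>!x. root_table v x"
proof -
  have "\<exists>x. root_table (Point u) x" for u
    by (cases u rule: points_cases) (blast intro: root_table.intros)+
  then have "\<exists>x. root_table v x"
    using assms by (auto simp: DD_def hyperplanes_def intro: root_table.intros)
  then show ?thesis
    using root_table_functional by blast
qed

end

theory Submission imports Defs
begin

text \<open>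
  The sum \<open>\<nu>\<close> of the roots of a point and its translate by \<open>a\<close> is a null vector not depending on the
  point. In coordinates \<open>(z; m, n)\<close> adapted to \<open>\<nu>\<close>, where \<open>\<langle>\<nu>|s\<rangle> = p m\<close>, every root with \<open>|m|\<^sup>2 \<le> 1\<close> is
  carried to a unit multiple of one of the 32 by the group \<open>\<Gamma>\<close> they generate, because \<open>\<Gamma>\<close> contains enough translations.
  For a root \<open>s\<close> with \<open>|m|\<^sup>2 \<ge> 2\<close> one finds a null vector \<open>\<nu>'\<close> in the \<open>\<Gamma>\<close>-orbit of \<open>\<nu>\<close> with
  \<open>|\<langle>\<nu>'|s\<rangle>| < |\<langle>\<nu>|s\<rangle>|\<close>; moving \<open>\<nu>'\<close> to \<open>\<nu>\<close> lowers \<open>|m|\<^sup>2\<close>, and induction shows that the reflection in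
  \<open>s\<close> lies in \<open>\<Gamma>\<close>. The vectors \<open>\<nu>' = (\<lambda>; q, n')\<close> with \<open>q = 1, 2\<close> that are needed correspond to the
  covering of \<open>\<complex>\<^sup>8\<close> by balls of radius \<open>\<surd>2\<close> and \<open>1\<close> around centres \<open>\<lambda>/q\<close>. Up to isometries fixing \<open>\<nu>\<close>
  and normalizing \<open>\<Gamma>\<close>, there are only eight \<open>\<nu>'\<close> with \<open>q = 2\<close>.
\<close>

text \<open>Balls of radius sqrt 2 around \<open>Alat\<close> alone do not cover: the point with all
  coordinates \<open>pG / 2\<close> lies at distance 2 from it. Hence the centres with
  \<open>q = 2\<close>. There the inner product with \<open>s\<close> carries an additional factor
  \<open>q\<close>, so the admissible squared distance is \<open>2 / q\<close>, which explains the
  two radii. A null vector with \<open>q = 2\<close> is not visibly in the orbit of \<nu>. The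
  translations built from pairs of point reflections change each coordinate of \<open>z\<close> only
  by multiples of \<open>pG * m\<close>, so they reduce such a vector only modulo
  \<open>2 * pG\<close>. Translations by all of \<open>Alat\<close> and affine permutations of
  \<open>J\<close> serve as isometries that respect the orbits, and explicit chains of reflections
  settle the rest. Self-duality of the Hamming code is what ties \<open>Alat\<close> to
  \<open>L\<close>: all inner products on \<open>L\<close> are divisible by \<open>pG\<close>, and
  this forces the coordinates \<open>z\<close> of its elements into \<open>Alat\<close>.\<close>

section \<open>The extended Hamming code\<close>

text \<open>
  \<open>J\<close> indexes the points \<open>x\<close> of \<open>\<F>\<^sub>2\<^sup>4\<close> with \<open>x\<^sub>1 = 0\<close>. The traces on them of the elements of \<open>\<K>\<close>
  are the affine functions on \<open>J\<close>, that is, the words of the extended Hamming code \<open>ham\<close>.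
\<close>

datatype J = JJ (j1: bool) (j2: bool) (j3: bool)

abbreviation "o0 \<equiv> JJ False False False"
abbreviation "o1 \<equiv> JJ True False False"
abbreviation "o2 \<equiv> JJ False True False"
abbreviation "o3 \<equiv> JJ False False True"
abbreviation "o12 \<equiv> JJ True True False"
abbreviation "o13 \<equiv> JJ True False True"
abbreviation "o23 \<equiv> JJ False True True"
abbreviation "o123 \<equiv> JJ True True True"

lemma UNIV_J: "(UNIV :: J set) = {o0,o1,o2,o3,
  o12,o13,o23,o123}"
proof -
  have "j \<in> {JJ p q r | p q r. True}" for j by (cases j) auto
  then show ?thesis by (auto, metis (full_types) J.exhaust)
qed

instance J :: finite
  by standard (simp add: UNIV_J)

lemma all_J: "(\<forall>j::J. P j) \<longleftrightarrow> P o0 \<and> P o1 \<and> P o2 \<and> P o3 \<and>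
  P o12 \<and> P o13 \<and> P o23 \<and> P o123"
  by (metis (full_types) J.exhaust)

lemma ex_J: "(\<exists>j::J. P j) \<longleftrightarrow> P o0 \<or> P o1 \<or> P o2 \<or> P o3 \<or>
  P o12 \<or> P o13 \<or> P o23 \<or> P o123"
  using all_J[of "\<lambda>j. \<not> P j"] by blast

lemma sum_J: "(\<Sum>j\<in>UNIV. f j) = f o0 + f o1 + f o2 + f o3 +
  f o12 + f o13 + f o23 + f o123"
  for f :: "J \<Rightarrow> 'a::comm_monoid_add"
  by (simp add: UNIV_J add_ac)

lemma card_UNIV_J [simp]: "card (UNIV :: J set) = 8"
  by (simp add: UNIV_J)

lemma ex_outside: "card A \<noteq> 8 \<Longrightarrow> \<exists>j :: J. j \<notin> A"
  using UNIV_eq_I[of A] card_UNIV_J by metis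

text \<open>The values at \<open>o0\<close>, \<open>o1\<close>, \<open>o2\<close>, \<open>o3\<close>
  are free; each check expresses the affine function at a further point as a sum of three of
  them.\<close>

definition ham :: "J set set" where
  "ham = {w. (o12 \<in> w \<longleftrightarrow> ((o0 \<in> w) \<noteq> ((o1 \<in> w) \<noteq> (o2 \<in> w)))) \<and>
    (o13 \<in> w \<longleftrightarrow> ((o0 \<in> w) \<noteq> ((o1 \<in> w) \<noteq> (o3 \<in> w)))) \<and>
    (o23 \<in> w \<longleftrightarrow> ((o0 \<in> w) \<noteq> ((o2 \<in> w) \<noteq> (o3 \<in> w)))) \<and>
    (o123 \<in> w \<longleftrightarrow> ((o1 \<in> w) \<noteq> ((o2 \<in> w) \<noteq> (o3 \<in> w))))}"

definition sdiff :: "'a set \<Rightarrow> 'a set \<Rightarrow> 'a set" where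
  "sdiff A B = (A - B) \<union> (B - A)"

lemma sdiff_iff [simp]: "j \<in> sdiff A B \<longleftrightarrow> (j \<in> A) \<noteq> (j \<in> B)"
  by (auto simp: sdiff_def)

lemma ham_sdiff: "A \<in> ham \<Longrightarrow> B \<in> ham \<Longrightarrow> sdiff A B \<in> ham"
  unfolding ham_def mem_Collect_eq sdiff_iff by argo

lemma ham_compl: "A \<in> ham \<Longrightarrow> - A \<in> ham"
  unfolding ham_def mem_Collect_eq Compl_iff by argo

text \<open>The locus where the affine function with linear part \<open>l\<close> and constant term
  \<open>s\<close> is 1; the empty set and \<open>UNIV\<close> occur for
  \<open>l = o0\<close>.\<close>

definition plane :: "J \<Rightarrow> bool \<Rightarrow> J set" where
  "plane l s = {j. ((j1 l \<and> j1 j) \<noteq> (j2 l \<and> j2 j)) \<noteq> ((j3 l \<and> j3 j) \<noteq> s)}"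

lemma card_J: "card (H :: J set) = (\<Sum>j\<in>UNIV. of_bool (j \<in> H))"
  by (simp add: sum.If_cases of_bool_def)

lemma card_compl_J: "card (- Q) = 8 - card Q" for Q :: "J set"
  by (simp add: Compl_eq_Diff_UNIV card_Diff_subset)

text \<open>Addition in the vector space of dimension 3 over the field with two elements.\<close>

definition xorJ :: "J \<Rightarrow> J \<Rightarrow> J" where
  "xorJ j k = JJ (j1 j \<noteq> j1 k) (j2 j \<noteq> j2 k) (j3 j \<noteq> j3 k)"

lemma xorJ_invol: "xorJ (xorJ k t) t = k"
  by (cases k; cases t) (auto simp: xorJ_def)

text \<open>Two parallel lines fill an affine plane, or cancel if they coincide.\<close>

lemma parallel_ham: "t \<noteq> o0 \<Longrightarrow> sdiff {o0, t} {k, xorJ k t} \<in> ham"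
proof -
  have "\<forall>t k. t \<noteq> o0 \<longrightarrow> sdiff {o0, t} {k, xorJ k t} \<in> ham"
    unfolding all_J ham_def xorJ_def by simp
  then show "t \<noteq> o0 \<Longrightarrow> ?thesis" by blast
qed

lemma parallel_ham2:
  assumes "a \<noteq> b" shows "sdiff {a, b} {k, xorJ k (xorJ a b)} \<in> ham"
proof -
  let ?t = "xorJ a b"
  have t: "?t \<noteq> o0" "xorJ a ?t = b" using assms by (cases a; cases b; auto simp: xorJ_def)+
  have "sdiff {a, b} {k, xorJ k ?t} = sdiff (sdiff {o0, ?t} {a, xorJ a ?t}) (sdiff {o0, ?t} {k, xorJ k ?t})"
    unfolding t(2) by (intro Set.set_eqI) auto
  then show ?thesis using ham_sdiff[OF parallel_ham[OF t(1)] parallel_ham[OF t(1)]] by simp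
qed

lemma tetrad_through:
  assumes "a \<noteq> b" "k \<notin> {a, b}"
  shows "{a, b, k, xorJ k (xorJ a b)} \<in> ham \<and> card {a, b, k, xorJ k (xorJ a b)} = 4"
proof -
  have "xorJ k (xorJ a b) \<notin> {a, b, k}" using assms by (cases a; cases b; cases k) (auto simp: xorJ_def)
  then have "sdiff {a, b} {k, xorJ k (xorJ a b)} = {a, b, k, xorJ k (xorJ a b)}" "card {a, b, k, xorJ k (xorJ a b)} = 4"
    using assms by (auto simp: sdiff_def)
  then show ?thesis using parallel_ham2[OF assms(1), of k] by simp
qed

text \<open>Take the tetrad consisting of the line through two points of \<open>H\<close> and a
  parallel line missing the other two points. At most six choices of \<open>k\<close> are
  excluded.\<close>

lemma split4:
  assumes "card H = 4" obtains Q where "Q \<in> ham" "card Q = 4" "card (Q \<inter> H) = 2"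
proof -
  obtain a b c d where H: "H = {a, b, c, d}" "a \<noteq> b"
    using assms by (auto simp: card_Suc_eq numeral_eq_Suc)
  let ?t = "xorJ a b"
  have "card {a, b, c, d, xorJ c ?t, xorJ d ?t} \<le> 6"
    using card_length[of "[a, b, c, d, xorJ c ?t, xorJ d ?t]"] by simp
  then have "\<exists>k. k \<notin> {a, b, c, d, xorJ c ?t, xorJ d ?t}" by (intro ex_outside) linarith
  then obtain k where k: "k \<notin> {a, b, c, d, xorJ c ?t, xorJ d ?t}" by blast
  then have "k \<noteq> xorJ c ?t" "k \<noteq> xorJ d ?t" by blast+
  then have "xorJ k ?t \<noteq> c" "xorJ k ?t \<noteq> d" using xorJ_invol by metis+
  then have e: "{a, b, k, xorJ k ?t} \<inter> H = {a, b}" using H(1) k by blast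
  have "card ({a, b, k, xorJ k ?t} \<inter> H) = 2" unfolding e using H(2) by simp
  then show ?thesis using that[of "{a, b, k, xorJ k ?t}"] tetrad_through[OF H(2), of k] k by blast
qed

lemma ham_card:
  assumes "w \<in> ham" "w \<noteq> {}" "w \<noteq> UNIV" shows "card w = 4"
proof -
  have "\<exists>j. j \<in> w" "\<exists>j. j \<notin> w" using assms by auto
  then show ?thesis
    using assms(1) unfolding ham_def mem_Collect_eq card_J sum_J ex_J
    by (cases "o0 \<in> w"; cases "o1 \<in> w"; cases "o2 \<in> w";
      cases "o3 \<in> w"; simp)
qed

lemma even_card_sdiff:
  assumes fin: "finite A" "finite B"
  shows "even (card (sdiff A B)) \<longleftrightarrow> even (card A + card B)"
proof -
  have "card (sdiff A B) = card (A - B) + card (B - A)"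
    unfolding sdiff_def using fin by (intro card_Un_disjoint) auto
  moreover have "card A = card (A - B) + card (A \<inter> B)" "card B = card (B - A) + card (A \<inter> B)"
    using fin by (metis Int_commute Int_Diff_Un add.commute card_Un_disjoint finite_Diff finite_Int Int_Diff_disjoint)+
  then have "card A + card B = card (A - B) + card (B - A) + 2 * card (A \<inter> B)" by simp
  ultimately show ?thesis by (metis dvd_triv_left even_add)
qed

text \<open>The complements of the three tetrads through \<open>a\<close>, \<open>b\<close> add up
  to zero modulo 2, so they cannot all meet \<open>w\<close> in an odd number of points.\<close>

lemma even_compl_tetrad:
  assumes "a \<noteq> b"
  obtains Q where "Q \<in> ham" "card Q = 4" "a \<in> Q" "b \<in> Q" "even (card (- Q \<inter> w))"
proof -
  define T where "T = {Q \<in> ham. card Q = 4 \<and> a \<in> Q \<and> b \<in> Q}"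
  obtain k where k: "k \<notin> {a, b}" using ex_outside[of "{a, b}"] assms by auto
  obtain l where l: "l \<notin> {a, b, k, xorJ k (xorJ a b)}"
    using ex_outside[of "{a, b, k, xorJ k (xorJ a b)}"] tetrad_through[OF assms k] by auto
  define Q1 Q2 where "Q1 = {a, b, k, xorJ k (xorJ a b)}" and "Q2 = {a, b, l, xorJ l (xorJ a b)}"
  have Q: "Q1 \<in> T" "Q2 \<in> T" "Q1 \<noteq> Q2"
    using tetrad_through[OF assms k] tetrad_through[OF assms, of l] l by (auto simp: T_def Q1_def Q2_def)
  define Q3 where "Q3 = - sdiff (- Q1) (- Q2)"
  have "Q3 \<in> T"
  proof -
    have h: "sdiff (- Q1) (- Q2) \<in> ham" using Q by (auto simp: T_def intro!: ham_sdiff ham_compl)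
    moreover have "sdiff (- Q1) (- Q2) \<noteq> {}" using Q(3) by (auto simp: sdiff_def)
    moreover have "a \<notin> sdiff (- Q1) (- Q2)" "b \<notin> sdiff (- Q1) (- Q2)" using Q by (auto simp: T_def)
    moreover from this have "sdiff (- Q1) (- Q2) \<noteq> UNIV" by blast
    ultimately show ?thesis using ham_card[of "sdiff (- Q1) (- Q2)"] ham_compl[OF h]
      by (simp add: T_def Q3_def card_compl_J)
  qed
  moreover have "even (card (- Q3 \<inter> w)) \<longleftrightarrow> even (card (- Q1 \<inter> w) + card (- Q2 \<inter> w))"
  proof -
    have "- Q3 \<inter> w = sdiff (- Q1 \<inter> w) (- Q2 \<inter> w)" by (auto simp: Q3_def sdiff_def)
    then show ?thesis by (simp add: even_card_sdiff)
  qed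
  ultimately have "\<exists>Q\<in>T. even (card (- Q \<inter> w))" using Q(1,2) by auto
  then show ?thesis using that by (auto simp: T_def)
qed

lemma parity8:
  "odd (of_bool a + of_bool b + of_bool c + of_bool d + of_bool e + of_bool f + of_bool g + of_bool h :: nat) \<longleftrightarrow>
   ((e \<noteq> (a \<noteq> (b \<noteq> c))) \<noteq> (f \<noteq> (a \<noteq> (b \<noteq> d)))) \<noteq> ((g \<noteq> (a \<noteq> (c \<noteq> d))) \<noteq> (h \<noteq> (b \<noteq> (c \<noteq> d))))"
  by (cases a; cases b; cases c; cases d; cases e; cases f; cases g; cases h; simp)

text \<open>Syndrome decoding: the four checks add up to the parity of the word, so an odd word has
  a syndrome of odd weight, and the eight such syndromes belong to the eight single points.\<close>

lemma ham_flip_odd: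
  assumes "odd (card w)" obtains j where "sdiff w {j} \<in> ham"
proof -
  let ?e = "o12 \<in> w \<longleftrightarrow> ((o0 \<in> w) \<noteq> ((o1 \<in> w) \<noteq> (o2 \<in> w)))"
  let ?f = "o13 \<in> w \<longleftrightarrow> ((o0 \<in> w) \<noteq> ((o1 \<in> w) \<noteq> (o3 \<in> w)))"
  let ?g = "o23 \<in> w \<longleftrightarrow> ((o0 \<in> w) \<noteq> ((o2 \<in> w) \<noteq> (o3 \<in> w)))"
  let ?h = "o123 \<in> w \<longleftrightarrow> ((o1 \<in> w) \<noteq> ((o2 \<in> w) \<noteq> (o3 \<in> w)))"
  have c: "sdiff w {j} \<in> ham \<longleftrightarrow>
    (?e \<noteq> (j \<in> {o0,o1,o2,o12})) \<and>
    (?f \<noteq> (j \<in> {o0,o1,o3,o13})) \<and>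
    (?g \<noteq> (j \<in> {o0,o2,o3,o23})) \<and>
    (?h \<noteq> (j \<in> {o1,o2,o3,o123}))" for j
    unfolding ham_def mem_Collect_eq sdiff_iff
    by (cases j; rename_tac p q r; case_tac p; case_tac q; case_tac r; simp; argo)
  have "((?e \<noteq> ?f) \<noteq> (?g \<noteq> ?h))"
    using assms unfolding card_J sum_J parity8 by argo
  then have "\<exists>j. sdiff w {j} \<in> ham"
    unfolding c ex_J by (cases ?e; cases ?f; cases ?g; cases ?h; simp)
  then show ?thesis using that by blast
qed

text \<open>An even word outside the code is corrected by any one of four parallel pairs;
  \<open>t\<close> is their common direction. The freedom in \<open>k\<close> permits averaging
  later.\<close>

lemma ham_flip_even:
  assumes "even (card w)" "w \<notin> ham"
  obtains t where "t \<noteq> o0" "\<And>k. sdiff w {k, xorJ k t} \<in> ham"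
proof -
  have "card (sdiff w {o0}) = (if o0 \<in> w then card w - 1 else card w + 1)"
    by (auto simp: sdiff_def)
  moreover have "o0 \<in> w \<Longrightarrow> card w > 0" by (auto simp: card_gt_0_iff)
  ultimately have "odd (card (sdiff w {o0}))" using assms(1) by (auto split: if_splits)
  then obtain t where t: "sdiff (sdiff w {o0}) {t} \<in> ham" by (rule ham_flip_odd)
  have "t \<noteq> o0"
  proof
    assume "t = o0" then have "sdiff (sdiff w {o0}) {t} = w" by auto
    with t assms(2) show False by simp
  qed
  moreover have "sdiff w {k, xorJ k t} \<in> ham" for k
  proof -
    have "sdiff w {k, xorJ k t} = sdiff (sdiff (sdiff w {o0}) {t}) (sdiff {o0, t} {k, xorJ k t})"
      using \<open>t \<noteq> o0\<close> by (intro Set.set_eqI) auto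
    then show ?thesis using ham_sdiff[OF t parallel_ham[OF \<open>t \<noteq> o0\<close>]] by simp
  qed
  ultimately show ?thesis by (rule that)
qed

lemma no_pair_ham: "j \<noteq> k \<Longrightarrow> {j, k} \<notin> ham"
proof -
  have "\<forall>j k. j \<noteq> k \<longrightarrow> {j, k} \<notin> ham"
    unfolding all_J ham_def by simp
  then show "j \<noteq> k \<Longrightarrow> {j, k} \<notin> ham" by blast
qed

section \<open>A covering inequality\<close>

text \<open>\<open>N\<close> and \<open>m\<close> stand for the larger and the smaller of
  \<open>x j\<close>, \<open>y j\<close>. The price \<open>N - m\<close> of switching to the smaller
  one, capped at \<open>c\<close>, is paid by the slack \<open>N - (N\<^sup>2 + m\<^sup>2)\<close>
  and a share \<open>c * N\<close>. Both cases rest on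
  \<open>m * (1 - N - m) \<ge> 0\<close>.\<close>

lemma coord_ineq:
  fixes N m :: real
  assumes "0 \<le> m" "m \<le> N" "N + m \<le> 1" "0 \<le> c"
  shows "min (N - m) c \<le> (N - (N\<^sup>2 + m\<^sup>2)) + c * N"
proof -
  have nm: "0 \<le> m * (1 - N - m)" using assms by simp
  show ?thesis
  proof (cases "N - m \<le> c")
    case True
    have "(N - m) * N \<le> c * N" using True assms by (intro mult_right_mono) auto
    then show ?thesis using nm True by (simp add: power2_eq_square algebra_simps)
  next
    case False
    have "c * (1 - N) \<le> (N - m) * (1 - N)" using False assms by (intro mult_right_mono) auto
    then show ?thesis using nm False by (simp add: power2_eq_square algebra_simps)
  qed
qed

lemma coord_ineq2:
  fixes N m :: real
  assumes "0 \<le> m" "m \<le> N" "N + m \<le> 1" "c \<le> N - m"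
  shows "c * (1 - N) \<le> N - (N\<^sup>2 + m\<^sup>2)"
proof -
  have nm: "0 \<le> m * (1 - N - m)" using assms by simp
  have "c * (1 - N) \<le> (N - m) * (1 - N)" using assms by (intro mult_right_mono) auto
  then show ?thesis using nm by (simp add: power2_eq_square algebra_simps)
qed

lemma smallest_subset:
  fixes f :: "'a \<Rightarrow> real"
  assumes "finite H" "k \<le> card H" "\<And>j. j \<in> H \<Longrightarrow> 0 \<le> f j" "\<And>j. j \<in> H \<Longrightarrow> f j \<le> 1"
  shows "\<exists>F c. F \<subseteq> H \<and> card F = k \<and> 0 \<le> c \<and> c \<le> 1 \<and> (\<forall>j\<in>F. f j \<le> c) \<and> (\<forall>j\<in>H-F. c \<le> f j)"
  using assms(2)
proof (induction k)
  case 0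
  then show ?case using assms by (intro exI[of _ "{}"] exI[of _ 0]) auto
next
  case (Suc k)
  then obtain F c where F: "F \<subseteq> H" "card F = k" "0 \<le> c" "c \<le> 1" "\<forall>j\<in>F. f j \<le> c" "\<forall>j\<in>H-F. c \<le> f j" by auto
  have fin: "finite F" using F(1) assms(1) by (rule finite_subset)
  have "H - F \<noteq> {}" using F(1,2) Suc.prems fin
    by (metis Diff_eq_empty_iff card_mono not_less_eq_eq)
  then obtain j where j: "j \<in> H - F" "\<forall>i\<in>H-F. f j \<le> f i"
    using assms(1) by (metis arg_min_if_finite(1) arg_min_least finite_Diff)
  show ?case
    using F j assms fin
    by (intro exI[of _ "insert j F"] exI[of _ "f j"]) (auto intro: order_trans)
qed

text \<open>The gain in coordinate \<open>j\<close> when the centre uses the hole on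
  \<open>B\<close> and \<open>2g\<close> off \<open>B\<close>.\<close>

definition coord_pick :: "(J \<Rightarrow> real) \<Rightarrow> (J \<Rightarrow> real) \<Rightarrow> J set \<Rightarrow> J \<Rightarrow> real" where
  "coord_pick x y B j = (if j \<in> B then x j else y j)"

text \<open>
  With \<open>o\<close> the odd Gaussian integer nearest to \<open>2z\<close>, the numbers \<open>x\<close>, \<open>y\<close> are the absolute values of
  the two components of \<open>2z - o\<close>, in the directions of the nearest element of the form \<open>p \<sqdot> odd\<close> (a
  hole) and of the nearest element \<open>2g\<close>, and \<open>w\<close> is the set of coordinates where \<open>g\<close> is odd. The
  three alternatives state that a centre \<open>\<lambda>/q\<close> with \<open>q = 1\<close>, with \<open>q = 2\<close> and odd entries off \<open>Q\<close>, or
  with \<open>q = 2\<close> and hole set \<open>B\<close> is close enough.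
\<close>
definition covered :: "(J \<Rightarrow> real) \<Rightarrow> (J \<Rightarrow> real) \<Rightarrow> J set \<Rightarrow> bool" where
  "covered x y w \<longleftrightarrow> (let W = (\<Sum>j\<in>UNIV. (x j)\<^sup>2 + (y j)\<^sup>2) in
    (\<exists>u\<in>ham. W / 2 \<le> (\<Sum>j\<in>UNIV. if j \<in> sdiff u w then - y j else y j)) \<or>
    (\<exists>Q\<in>ham. card Q = 4 \<and> (\<exists>B. (card (Q \<inter> B) = 2 \<or> Q \<inter> B = {} \<and> even (card (Q \<inter> w))) \<and> W / 2 \<le> (\<Sum>j\<in>Q. coord_pick x y B j))) \<or>
    (\<exists>B. (card B = 6 \<or> card B = 4 \<and> B \<notin> ham) \<and> 2 + W / 2 \<le> (\<Sum>j\<in>UNIV. coord_pick x y B j)))"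

context
  fixes x y :: "J \<Rightarrow> real" and w :: "J set"
  assumes x0: "\<And>j. 0 \<le> x j" and y0: "\<And>j. 0 \<le> y j" and xy1: "\<And>j. x j + y j \<le> 1"
begin

private definition W where "W = (\<Sum>j\<in>UNIV. (x j)\<^sup>2 + (y j)\<^sup>2)"
text \<open>Taking the larger component everywhere amounts to the hole set \<open>H\<close>;
  \<open>ep j\<close> is the price of deviating from it at \<open>j\<close>, and \<open>ee j\<close>
  the slack of \<open>N j\<close> over the contribution to \<open>W\<close>.\<close>

private definition N where "N j = max (x j) (y j)"
private definition H where "H = {j. y j < x j}"
private definition ep where "ep j = \<bar>x j - y j\<bar>"
private definition nn where "nn = (sum N UNIV)"
private definition ee where "ee j = N j - ((x j)\<^sup>2 + (y j)\<^sup>2)"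

private lemma W_eq: "W = nn - (sum ee UNIV)"
  by (simp add: W_def nn_def ee_def sum_subtractf)

private lemma ep_le: "0 \<le> ep j" "ep j \<le> N j" "N j \<le> 1"
  using x0[of j] y0[of j] xy1[of j] by (auto simp: ep_def N_def)

private lemma ineq1: "0 \<le> c \<Longrightarrow> min (ep j) c \<le> ee j + c * N j"
  using coord_ineq[of "y j" "x j" c] coord_ineq[of "x j" "y j" c] x0[of j] y0[of j] xy1[of j]
  by (cases "y j < x j") (auto simp: ep_def ee_def N_def max_def add.commute)

private lemma ineq2: "c \<le> ep j \<Longrightarrow> c * (1 - N j) \<le> ee j"
  using coord_ineq2[of "y j" "x j" c] coord_ineq2[of "x j" "y j" c] x0[of j] y0[of j] xy1[of j]
  by (cases "y j < x j") (auto simp: ep_def ee_def N_def max_def add.commute)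

private lemma ee0: "0 \<le> ee j"
  using ineq2[of 0 j] ep_le(1)[of j] by simp

private lemma coord_pick_sum: "(\<Sum>j\<in>UNIV. coord_pick x y B j) = nn - (sum ep (sdiff B H))"
proof -
  have "(sum ep (sdiff B H)) = (\<Sum>j\<in>UNIV. if j \<in> sdiff B H then ep j else 0)"
    by (subst sum.inter_restrict[symmetric]) simp_all
  then have "nn - (sum ep (sdiff B H)) = nn - (\<Sum>j\<in>UNIV. if j \<in> sdiff B H then ep j else 0)"
    by (rule arg_cong)
  also have "\<dots> = (\<Sum>j\<in>UNIV. coord_pick x y B j)"
    unfolding nn_def sum_subtractf[symmetric]
    by (intro sum.cong refl) (auto simp: coord_pick_def N_def H_def ep_def)
  finally show ?thesis by simp
qed

private lemma sub_sdiff: "F \<subseteq> H \<Longrightarrow> sdiff (H - F) H = F"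
  and add_sdiff: "F \<inter> H = {} \<Longrightarrow> sdiff (H \<union> F) H = F"
  by (auto simp: sdiff_def)

private lemma covered_mid:
  assumes "Q \<in> ham" "card Q = 4" "card (Q \<inter> B) = 2 \<or> Q \<inter> B = {} \<and> even (card (Q \<inter> w))"
    "W / 2 \<le> (\<Sum>j\<in>Q. coord_pick x y B j)"
  shows "covered x y w"
  using assms unfolding covered_def Let_def W_def[symmetric] by blast

text \<open>A tetrad splits \<open>B\<close> into two and two, so it and its complement are both
  admissible. Their sums add up to at least \<open>W\<close>, hence one reaches
  \<open>W / 2\<close>.\<close>

private lemma covered_card4:
  assumes "card B = 4" "(sum ep (sdiff B H)) \<le> (sum ee UNIV)"
  shows "covered x y w"
proof -
  obtain Q where Q: "Q \<in> ham" "card Q = 4" "card (Q \<inter> B) = 2" using split4[OF assms(1)] by blast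
  have "card (- Q \<inter> B) = 2"
  proof -
    have "card ((Q \<inter> B) \<union> (- Q \<inter> B)) = card (Q \<inter> B) + card (- Q \<inter> B)" by (intro card_Un_disjoint) auto
    moreover have "(Q \<inter> B) \<union> (- Q \<inter> B) = B" by auto
    ultimately have "card B = card (Q \<inter> B) + card (- Q \<inter> B)" by simp
    then show ?thesis using Q(3) assms(1) by simp
  qed
  moreover have "W \<le> (\<Sum>j\<in>Q. coord_pick x y B j) + (\<Sum>j\<in>-Q. coord_pick x y B j)"
    using assms(2) coord_pick_sum[of B] W_eq sum.union_disjoint[of Q "- Q" "coord_pick x y B"] by simp
  then have "W / 2 \<le> (\<Sum>j\<in>Q. coord_pick x y B j) \<or> W / 2 \<le> (\<Sum>j\<in>-Q. coord_pick x y B j)" by linarith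
  ultimately show ?thesis
    using covered_mid[of Q B] covered_mid[of "- Q" B] Q ham_compl[OF Q(1)] card_compl_J[of Q] by auto
qed

text \<open>As for four holes, but with a tetrad containing \<open>B\<close>: it is admissible
  through its two holes, and its complement through the parity of \<open>w\<close> there.\<close>

private lemma covered_card2:
  assumes "card B = 2" "(sum ep (sdiff B H)) \<le> (sum ee UNIV)"
  shows "covered x y w"
proof -
  obtain a b where ab: "B = {a, b}" "a \<noteq> b" using assms(1) by (auto simp: card_2_iff)
  obtain Q where Q: "Q \<in> ham" "card Q = 4" "a \<in> Q" "b \<in> Q" "even (card (- Q \<inter> w))"
    using even_compl_tetrad[OF ab(2)] by blast
  have QB: "Q \<inter> B = B" "- Q \<inter> B = {}" using Q ab by auto
  moreover have "W \<le> (\<Sum>j\<in>Q. coord_pick x y B j) + (\<Sum>j\<in>-Q. coord_pick x y B j)"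
    using assms(2) coord_pick_sum[of B] W_eq sum.union_disjoint[of Q "- Q" "coord_pick x y B"] by simp
  then have "W / 2 \<le> (\<Sum>j\<in>Q. coord_pick x y B j) \<or> W / 2 \<le> (\<Sum>j\<in>-Q. coord_pick x y B j)" by linarith
  ultimately show ?thesis
    using covered_mid[of Q B] covered_mid[of "- Q" B] Q(1,2,5) ham_compl[OF Q(1)] card_compl_J[of Q] assms(1) by auto
qed

private lemma covered_hole:
  assumes "card B = 6 \<or> card B = 4 \<and> B \<notin> ham" "2 * (sum ep (sdiff B H)) \<le> nn - 4 + (sum ee UNIV)"
  shows "covered x y w"
proof -
  have "2 + W / 2 \<le> (\<Sum>j\<in>UNIV. coord_pick x y B j)" using assms(2) coord_pick_sum[of B] W_eq by linarith
  then show ?thesis using assms(1) unfolding covered_def Let_def W_def[symmetric] by blast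
qed

private lemma covered_aff:
  assumes "u \<in> ham" "W / 2 \<le> (\<Sum>j\<in>UNIV. if j \<in> sdiff u w then - y j else y j)"
  shows "covered x y w"
  using assms unfolding covered_def Let_def W_def[symmetric] by blast

text \<open>Sum \<open>ineq1\<close> over \<open>K\<close>, with \<open>c\<close> separating the
  \<open>k\<close> cheapest prices from the others; each of the others counts as \<open>c\<close> on
  the left.\<close>

private lemma flips:
  assumes "k \<le> card K"
  shows "\<exists>F c. F \<subseteq> K \<and> card F = k \<and> 0 \<le> c \<and> c \<le> 1 \<and> (\<forall>j\<in>F. ep j \<le> c) \<and> (\<forall>j\<in>K-F. c \<le> ep j) \<and>
    (sum ep F) \<le> (sum ee UNIV) + c * ((sum N K) - (real (card K) - real k))"
proof -
  have e1: "ep j \<le> 1" for j using ep_le(2,3)[of j] by linarith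
  obtain F c where F: "F \<subseteq> K" "card F = k" "0 \<le> c" "c \<le> 1" "\<forall>j\<in>F. ep j \<le> c" "\<forall>j\<in>K-F. c \<le> ep j"
    using smallest_subset[of K k ep] assms ep_le(1) e1 by auto
  have "(sum ep F) + c * (real (card K) - real k) = (\<Sum>j\<in>F. min (ep j) c) + (\<Sum>j\<in>K-F. min (ep j) c)"
    using F assms by (simp add: card_Diff_subset min_absorb1 min_absorb2 of_nat_diff)
  also have "\<dots> = (\<Sum>j\<in>K. min (ep j) c)" using F(1) by (subst add.commute) (simp add: sum.subset_diff[symmetric])
  also have "\<dots> \<le> (\<Sum>j\<in>K. ee j + c * N j)" by (intro sum_mono ineq1 F)
  also have "\<dots> = (sum ee K) + c * (sum N K)" by (simp add: sum.distrib sum_distrib_left)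
  also have "(sum ee K) \<le> (sum ee UNIV)" by (intro sum_mono2) (auto simp: ee0)
  finally show ?thesis using F by (intro exI[of _ F] exI[of _ c]) (auto simp: algebra_simps)
qed

private lemma sumN_le: "(sum N K) \<le> nn"
  unfolding nn_def using ep_le(1,2) by (intro sum_mono2) (auto intro: order_trans)

private lemma sum_ee0: "0 \<le> (sum ee UNIV)"
  by (intro sum_nonneg ee0)

text \<open>If every single deviation in \<open>K\<close> costs more than the whole slack,
  \<open>ineq2\<close> leaves no room for the \<open>N j\<close> to fall below 1 by a total of
  1.\<close>

private lemma heavy:
  assumes "\<And>j. j \<in> K \<Longrightarrow> c \<le> ep j" "(sum ee UNIV) < c"
  shows "real (card K) - 1 < (sum N K)"
proof -
  have c: "0 < c" using assms(2) sum_ee0 by linarith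
  have "c * (real (card K) - (sum N K)) = (\<Sum>j\<in>K. c * (1 - N j))"
    by (simp add: sum_subtractf right_diff_distrib sum_distrib_left)
  also have "\<dots> \<le> (sum ee K)" by (intro sum_mono ineq2 assms)
  also have "\<dots> \<le> (sum ee UNIV)" by (intro sum_mono2) (auto simp: ee0)
  finally have "c * (real (card K) - (sum N K)) < c * 1" using assms(2) by simp
  then show ?thesis using c by (simp only: mult_less_cancel_left_pos)
qed

text \<open>Deleting the cheapest points of \<open>H\<close> down to four is affordable if
  \<open>sum N H \<le> 4\<close>. Otherwise the excess of \<open>nn\<close> over 4 pays for six
  holes: from 8 or 7 only a cheap part of \<open>F\<close> is deleted, 6 needs no change, and at 5
  one point is added.\<close>

private lemma case_ge5:
  assumes "card H \<ge> 5" shows "covered x y w"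
proof -
  have H8: "card H \<le> 8" using card_mono[of UNIV H] by simp
  obtain F c where F: "F \<subseteq> H" "card F = card H - 4" "0 \<le> c" "c \<le> 1"
    "(sum ep F) \<le> (sum ee UNIV) + c * ((sum N H) - (real (card H) - real (card H - 4)))"
    using flips[of "card H - 4" H] diff_le_self by blast
  have r4: "real (card H) - real (card H - 4) = 4" using assms by (simp add: of_nat_diff)
  show ?thesis
  proof (cases "(sum N H) \<le> 4")
    case True
    then have "c * ((sum N H) - 4) \<le> 0" using F(3) by (simp add: mult_nonneg_nonpos)
    then show ?thesis
      using F assms r4 by (intro covered_card4[of "H - F"]) (auto simp: sub_sdiff card_Diff_subset)
  next
    case False
    then have "c * ((sum N H) - 4) \<le> 1 * ((sum N H) - 4)" using F(4) by (intro mult_right_mono) auto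
    then have Fs: "(sum ep F) \<le> (sum ee UNIV) + (nn - 4)" using F(5) r4 sumN_le[of H] by simp
    consider "card H = 8" | "card H = 7" | "card H = 6" | "card H = 5" using assms H8 by linarith
    then show ?thesis
    proof cases
      case 1
      obtain G d where G: "G \<subseteq> F" "card G = 2" "\<And>j. j \<in> G \<Longrightarrow> ep j \<le> d" "\<And>j. j \<in> F - G \<Longrightarrow> d \<le> ep j"
        using flips[of 2 F, unfolded F(2)] 1 by force
      have "(sum ep G) \<le> 2 * d" using sum_bounded_above[of G ep d] G by simp
      moreover have "2 * d \<le> (sum ep (F-G))" using sum_bounded_below[of "F - G" d ep] G F(2) 1 by (simp add: card_Diff_subset)
      moreover have "(sum ep F) = (sum ep (F-G)) + (sum ep G)" using G(1) by (simp add: sum.subset_diff)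
      ultimately show ?thesis
        using Fs G(1,2) F(1) 1 by (intro covered_hole[of "H - G"]) (auto simp: sub_sdiff card_Diff_subset)
    next
      case 2
      obtain G d where G: "G \<subseteq> F" "card G = 1" "\<And>j. j \<in> G \<Longrightarrow> ep j \<le> d" "\<And>j. j \<in> F - G \<Longrightarrow> d \<le> ep j"
        using flips[of 1 F, unfolded F(2)] 2 by force
      have "(sum ep G) \<le> d" using sum_bounded_above[of G ep d] G by simp
      moreover have "2 * d \<le> (sum ep (F-G))" using sum_bounded_below[of "F - G" d ep] G F(2) 2 by (simp add: card_Diff_subset)
      moreover have "(sum ep F) = (sum ep (F-G)) + (sum ep G)" using G(1) by (simp add: sum.subset_diff)
      moreover have "0 \<le> (sum ep G)" by (intro sum_nonneg ep_le)
      ultimately show ?thesis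
        using Fs G(1,2) F(1) 2 by (intro covered_hole[of "H - G"]) (auto simp: sub_sdiff card_Diff_subset)
    next
      case 3
      have "sdiff H H = {}" by (auto simp: sdiff_def)
      moreover have "0 \<le> (sum ep F)" by (intro sum_nonneg ep_le)
      ultimately show ?thesis using Fs 3 by (intro covered_hole[of H]) auto
    next
      case 4
      then have c3: "card (- H) = 3" by (simp add: card_compl_J)
      \<comment> \<open>The cheapest of the three outer points costs at most half of what the other
        two cost together, and these cost at most \<open>sum N (- H) < nn - 4\<close>.\<close>
      obtain G d where G: "G \<subseteq> - H" "card G = 1" "0 \<le> d" "\<And>j. j \<in> G \<Longrightarrow> ep j \<le> d" "\<And>j. j \<in> - H - G \<Longrightarrow> d \<le> ep j"
        using flips[of 1 "- H", unfolded c3] by force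
      have "(sum ep G) \<le> d" using sum_bounded_above[of G ep d] G by simp
      moreover have "2 * d \<le> (sum ep (- H - G))" using sum_bounded_below[of "- H - G" d ep] G c3 by (simp add: card_Diff_subset)
      moreover have "\<dots> \<le> (sum ep (- H))" by (intro sum_mono2) (auto simp: ep_le)
      moreover have "\<dots> \<le> (sum N (- H))" by (intro sum_mono ep_le)
      moreover have "nn = (sum N (- H)) + (sum N H)" unfolding nn_def by (subst sum.subset_diff[of H]) (auto simp: Compl_eq_Diff_UNIV)
      ultimately have "2 * (sum ep G) \<le> nn - 4 + (sum ee UNIV)" using False sum_ee0 by linarith
      moreover have "card (H \<union> G) = 6" using G(1,2) 4 by (subst card_Un_disjoint) auto
      moreover have "sdiff (H \<union> G) H = G" using G(1) by (intro add_sdiff) auto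
      ultimately show ?thesis by (intro covered_hole[of "H \<union> G"]) auto
    qed
  qed
qed

text \<open>Deviating at the cheapest coordinate of all leaves two or four holes. If the slack does
  not pay for this, \<open>heavy\<close> gives \<open>nn > 7\<close>, enough for a fourth hole at
  price at most 1. Two completions of \<open>H\<close> to code words would differ by a pair, so some
  completion is no word.\<close>

private lemma case_3:
  assumes "card H = 3" shows "covered x y w"
proof -
  obtain F c where F: "card F = 1" "\<And>j. j \<in> F \<Longrightarrow> ep j \<le> c" "\<And>j. j \<in> UNIV - F \<Longrightarrow> c \<le> ep j"
    using flips[of 1 UNIV] by force
  then obtain f where f: "F = {f}" by (auto simp: card_1_singleton_iff)
  have min: "ep f \<le> ep j" for j using F(2)[of f] F(3)[of j] f by (cases "j = f") auto
  show ?thesis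
  proof (cases "ep f \<le> (sum ee UNIV)")
    case True
    show ?thesis
    proof (cases "f \<in> H")
      case f': True
      then show ?thesis using True assms by (intro covered_card2[of "H - {f}"]) (auto simp: sub_sdiff)
    next
      case False
      then have "sdiff (H \<union> {f}) H = {f}" by (intro add_sdiff) auto
      then show ?thesis using True assms False by (intro covered_card4[of "H \<union> {f}"]) auto
    qed
  next
    case False
    then have n7: "7 < nn" using heavy[of UNIV "ep f"] min by (simp add: nn_def)
    have "\<exists>v. v \<notin> H \<and> insert v H \<notin> ham"
    proof (rule ccontr)
      assume *: "\<not> ?thesis"
      have "card (- H) = 5" using assms by (simp add: card_compl_J)
      then obtain v v' where v: "v \<in> - H" "v' \<in> - H" "v \<noteq> v'"
        using card_le_Suc0_iff_eq[of "- H"] by force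
      have "sdiff (insert v H) (insert v' H) = {v, v'}" using v by (auto simp: sdiff_def)
      moreover have "sdiff (insert v H) (insert v' H) \<in> ham" using * v by (intro ham_sdiff) auto
      ultimately show False using no_pair_ham[OF v(3)] by simp
    qed
    then obtain v where v: "v \<notin> H" "insert v H \<notin> ham" by blast
    have "sdiff (insert v H) H = {v}" using v by (auto simp: sdiff_def)
    moreover have "ep v \<le> 1" using ep_le[of v] by linarith
    ultimately show ?thesis using n7 v assms sum_ee0 by (intro covered_hole[of "insert v H"]) auto
  qed
qed

private lemma W_le: "W \<le> nn"
  using W_eq sum_ee0 by simp

text \<open>A second hole is added if the slack pays for it. Otherwise the coordinates off
  \<open>a\<close> are so large that a lattice centre (\<open>q = 1\<close>) is close enough even
  after two sign changes.\<close>

private lemma case_1: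
  assumes "card H = 1" shows "covered x y w"
proof -
  obtain a where a: "H = {a}" using assms by (auto simp: card_1_singleton_iff)
  have c7: "card (- H) = 7" using assms by (simp add: card_compl_J)
  obtain F c where F: "F \<subseteq> - H" "card F = 1" "\<And>j. j \<in> F \<Longrightarrow> ep j \<le> c" "\<And>j. j \<in> - H - F \<Longrightarrow> c \<le> ep j"
    using flips[of 1 "- H", unfolded c7] by force
  then obtain f where f: "F = {f}" by (auto simp: card_1_singleton_iff)
  have min: "ep f \<le> ep j" if "j \<in> - H" for j using F(3)[of f] F(4)[of j] f that by (cases "j = f") auto
  have fH: "f \<notin> H" using F(1) f by auto
  show ?thesis
  proof (cases "ep f \<le> (sum ee UNIV)")
    case True
    have "sdiff (H \<union> {f}) H = {f}" using fH by (intro add_sdiff) auto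
    then show ?thesis using True assms fH by (intro covered_card2[of "H \<union> {f}"]) auto
  next
    case False
    then have n6: "6 < (sum N (- H))" using heavy[of "- H" "ep f"] min c7 by simp
    \<comment> \<open>Parity is adjusted at \<open>a\<close>, where \<open>y a < 1 / 2\<close> makes
      the sign change cheap; one more change then reaches a code word.\<close>
    define w' where "w' = (if even (card w) then sdiff w {a} else w)"
    have "odd (card w')" using even_card_sdiff[of w "{a}"] by (simp add: w'_def)
    then obtain i where i: "sdiff w' {i} \<in> ham" by (rule ham_flip_odd)
    define u where "u = sdiff w' {i}"
    have uw: "sdiff u w \<subseteq> {a, i}" by (auto simp: u_def w'_def split: if_splits)
    have yN: "y j = N j" if "j \<noteq> a" for j
    proof -
      have "j \<notin> H" using that a by simp
      then show ?thesis by (simp add: N_def H_def)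
    qed
    have "a \<in> H" using a by simp
    then have ya: "y a < x a" by (simp add: H_def)
    have Ha: "- H = UNIV - {a}" using a by auto
    have Na: "N a = x a" using ya by (simp add: N_def)
    have nx: "nn = x a + (sum N (- H))"
      unfolding nn_def Ha Na[symmetric] by (rule sum.remove) auto
    have "(\<Sum>j\<in>UNIV. if j \<in> sdiff u w then - y j else y j) \<ge> (\<Sum>j\<in>UNIV. (if j = a then - y a else N j) - (if j = i then 2 * N i else 0))"
    proof (intro sum_mono)
      fix j show "(if j = a then - y a else N j) - (if j = i then 2 * N i else 0) \<le> (if j \<in> sdiff u w then - y j else y j)"
        using uw yN[of j] y0[of j] ep_le[of j] ep_le[of i] by auto
    qed
    moreover have "(\<Sum>j\<in>UNIV. (if j = a then - y a else N j) - (if j = i then 2 * N i else 0)) = - y a + (sum N (- H)) - 2 * N i"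
    proof -
      have "(\<Sum>j\<in>UNIV. if j = a then - y a else N j) = - y a + (\<Sum>j\<in>UNIV - {a}. if j = a then - y a else N j)"
        by (subst sum.remove[of UNIV a]) auto
      also have "(\<Sum>j\<in>UNIV - {a}. if j = a then - y a else N j) = (sum N (- H))"
        unfolding Ha by (intro sum.cong) auto
      finally have "(\<Sum>j\<in>UNIV. if j = a then - y a else N j) = - y a + (sum N (- H))" .
      then show ?thesis by (simp add: sum_subtractf)
    qed
    moreover have "N i \<le> 1" using ep_le by simp
    ultimately have "W / 2 \<le> (\<Sum>j\<in>UNIV. if j \<in> sdiff u w then - y j else y j)"
      using W_le nx n6 xy1[of a] ya y0[of a] by linarith
    then show ?thesis using i by (intro covered_aff[of u]) (auto simp: u_def)
  qed
qed

private lemma sum_signed: "(\<Sum>j\<in>UNIV. if j \<in> D then - f j else f j) = (\<Sum>j\<in>UNIV. f j) - 2 * (\<Sum>j\<in>D. f j)"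
  for f :: "J \<Rightarrow> real"
proof -
  have "(\<Sum>j\<in>UNIV. if j \<in> D then - f j else f j) = (\<Sum>j\<in>UNIV. f j - (if j \<in> D then 2 * f j else 0))"
    by (intro sum.cong) auto
  then show ?thesis by (simp add: sum_subtractf sum.If_cases sum_distrib_left)
qed

text \<open>No holes are preferred, so a lattice centre is tried. For even \<open>w\<close> outside
  the code, some correcting pair carries at most the average \<open>nn / 4\<close>. For odd
  \<open>w\<close> one sign change costs at most 2, which is affordable for \<open>nn > 4\<close>;
  for smaller \<open>nn\<close> four holes are free.\<close>

private lemma case_0:
  assumes "H = {}" shows "covered x y w"
proof -
  have yN: "y j = N j" for j
  proof -
    have "j \<notin> H" using assms by simp
    then show ?thesis by (simp add: N_def H_def)
  qed
  have ny: "(\<Sum>j\<in>UNIV. y j) = nn" unfolding nn_def by (intro sum.cong refl yN)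
  have N0: "0 \<le> y j" "y j \<le> 1" for j using ep_le(3)[of j] yN[of j] y0[of j] by simp_all
  have nn0: "0 \<le> nn" unfolding ny[symmetric] by (intro sum_nonneg N0)
  have sgn: "(\<Sum>j\<in>UNIV. if j \<in> sdiff u w then - y j else y j) = nn - 2 * (\<Sum>j\<in>sdiff u w. y j)" for u
    using sum_signed[of "sdiff u w" y] ny by simp
  show ?thesis
  proof (cases "even (card w)")
    case ev: True
    show ?thesis
    proof (cases "w \<in> ham")
      case True
      have "sdiff w w = {}" by (auto simp: sdiff_def)
      then show ?thesis using True sgn[of w] W_le nn0 by (intro covered_aff[of w]) auto
    next
      case False
      then obtain t where t: "t \<noteq> o0" "\<And>k. sdiff w {k, xorJ k t} \<in> ham" using ham_flip_even[OF ev] by blast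
      have bij: "bij (\<lambda>k. xorJ k t)" by (rule involuntory_imp_bij) (simp add: xorJ_invol)
      have "\<exists>k. y k + y (xorJ k t) \<le> nn / 4"
      proof (rule ccontr)
        assume "\<not> ?thesis"
        then have lt: "nn / 4 < y k + y (xorJ k t)" for k by (simp add: not_le)
        have "(\<Sum>k\<in>(UNIV :: J set). nn / 4) < (\<Sum>k\<in>UNIV. y k + y (xorJ k t))"
          by (rule sum_strict_mono) (simp, simp, rule lt)
        moreover have "(\<Sum>k\<in>UNIV. y (xorJ k t)) = nn" using sum.reindex_bij_betw[OF bij, of y] ny by simp
        ultimately show False using ny by (simp add: sum.distrib)
      qed
      then obtain k where k: "y k + y (xorJ k t) \<le> nn / 4" by blast
      have "xorJ k t \<noteq> k" using t(1) by (cases k; cases t) (auto simp: xorJ_def)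
      moreover have "sdiff (sdiff w {k, xorJ k t}) w = {k, xorJ k t}" by auto
      ultimately show ?thesis using k sgn[of "sdiff w {k, xorJ k t}"] W_le t(2)[of k] by (intro covered_aff[OF t(2)[of k]]) auto
    qed
  next
    case False
    show ?thesis
    proof (cases "nn \<le> 4")
      case True
      obtain F c where F: "card F = 4" "0 \<le> c" "(sum ep F) \<le> (sum ee UNIV) + c * ((sum N UNIV) - (real (card (UNIV :: J set)) - real 4))"
        using flips[of 4 UNIV] by force
      have "c * (nn - 4) \<le> 0" using True F(2) by (simp add: mult_nonneg_nonpos)
      moreover have "sdiff F H = F" using assms by (auto simp: sdiff_def)
      ultimately show ?thesis using F by (intro covered_card4[of F]) (auto simp: nn_def)
    next
      case n4: False
      obtain j where j: "sdiff w {j} \<in> ham" using ham_flip_odd[OF False] by blast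
      have "sdiff (sdiff w {j}) w = {j}" by auto
      then show ?thesis using n4 sgn[of "sdiff w {j}"] W_le N0[of j] by (intro covered_aff[OF j]) auto
    qed
  qed
qed

lemma covering: "covered x y w"
proof -
  have "sdiff H H = {}" by (auto simp: sdiff_def)
  \<comment> \<open>With two or four preferred holes, \<open>B = H\<close> needs no
    deviation.\<close>
  then have H4: "card H = 4 \<Longrightarrow> ?thesis" and H2: "card H = 2 \<Longrightarrow> ?thesis"
    using covered_card4[of H] covered_card2[of H] sum_ee0 by auto
  consider "card H = 0" | "card H = 1" | "card H = 2" | "card H = 3" | "card H = 4" | "card H \<ge> 5" by linarith
  then show ?thesis using H4 H2 case_0 case_1 case_3 case_ge5 by cases auto
qed

end

section \<open>Reflections and orbits\<close>

declare split_paired_All [simp del] split_paired_Ex [simp del]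

lemma pG_simps: "pG * cnj pG = 2" "cnj pG * pG = 2" "pG \<noteq> 0" "Re pG = 1" "Im pG = 1"
  by (simp_all add: pG_def complex_eq_iff)

lemma hform_add_right: "hform x (y + z) = hform x y + hform x z"
  by (simp add: hform_def D4G_form_def G11_form_def sum_4 algebra_simps)

lemma hform_scale_right: "hform x (cscale c y) = c * hform x y"
  by (simp add: hform_def D4G_form_def G11_form_def sum_4 cscale_def algebra_simps)

lemma hform_sym: "hform y x = cnj (hform x y)"
  by (simp add: hform_def D4G_form_def G11_form_def sum_4 algebra_simps)

lemma hform_add_left: "hform (x + y) z = hform x z + hform y z"
  by (subst (1 2 3) hform_sym) (simp add: hform_add_right)

lemma hform_scale_left: "hform (cscale c x) y = cnj c * hform x y"
  by (subst (1 2) hform_sym) (simp add: hform_scale_right)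

lemma cscale_minus: "cscale (- c) x = - cscale c x"
  by (simp add: cscale_def prod_eq_iff vec_eq_iff)

lemma cscale_1 [simp]: "cscale 1 x = x"
  by (simp add: cscale_def prod_eq_iff vec_eq_iff)

lemma cscale_0 [simp]: "cscale 0 x = 0"
  by (simp add: cscale_def prod_eq_iff vec_eq_iff)

lemma cscale_add_left: "cscale (a + b) x = cscale a x + cscale b x"
  by (simp add: cscale_def prod_eq_iff vec_eq_iff algebra_simps)

lemma cscale_add_right: "cscale a (x + y) = cscale a x + cscale a y"
  by (simp add: cscale_def prod_eq_iff vec_eq_iff algebra_simps)

lemma cscale_cscale [simp]: "cscale a (cscale b x) = cscale (a * b) x"
  by (simp add: cscale_def prod_eq_iff vec_eq_iff algebra_simps)

lemma hform_minus_right: "hform x (- y) = - hform x y"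
  using hform_scale_right[of x "-1" y] by (simp add: cscale_minus)

lemma hform_diff_right: "hform x (y - z) = hform x y - hform x z"
  using hform_add_right[of x y "- z"] by (simp add: hform_minus_right)

lemma hform_minus_left: "hform (- x) y = - hform x y"
  using hform_scale_left[of "-1" x y] by (simp add: cscale_minus)

lemma hform_diff_left: "hform (x - y) z = hform x z - hform y z"
  using hform_add_left[of x "- y" z] by (simp add: hform_minus_left)

lemma cscale_diff_left: "cscale (a - b) x = cscale a x - cscale b x"
  using cscale_add_left[of a "- b" x] by (simp add: cscale_minus)

lemma cscale_minus_right: "cscale c (- x) = - cscale c x"
  using cscale_cscale[of c "-1" x] by (simp add: cscale_minus)

lemma cscale_diff_right: "cscale c (x - y) = cscale c x - cscale c y"
  using cscale_add_right[of c x "- y"] by (simp add: cscale_minus_right)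

lemmas hform_simps = hform_add_right hform_scale_right hform_add_left hform_scale_left
  hform_minus_right hform_diff_right hform_minus_left hform_diff_left
lemmas cscale_simps = cscale_minus cscale_add_left cscale_add_right cscale_diff_left cscale_diff_right cscale_minus_right

definition isom :: "(gvec \<Rightarrow> gvec) \<Rightarrow> bool" where
  "isom g \<longleftrightarrow> (\<forall>x y. g (x + y) = g x + g y) \<and> (\<forall>c x. g (cscale c x) = cscale c (g x)) \<and>
     (\<forall>x y. hform (g x) (g y) = hform x y)"

lemma isom_comp: "isom f \<Longrightarrow> isom g \<Longrightarrow> isom (f \<circ> g)"
  by (simp add: isom_def)

lemma isom_id: "isom id"
  by (simp add: isom_def)

lemma isomD: "isom g \<Longrightarrow> g (x + y) = g x + g y" "isom g \<Longrightarrow> g (cscale c x) = cscale c (g x)"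
  "isom g \<Longrightarrow> hform (g x) (g y) = hform x y"
  by (auto simp: isom_def)

lemma isom_diff: "isom g \<Longrightarrow> g (x - y) = g x - g y"
  unfolding isom_def by (metis add_diff_cancel diff_add_cancel)

text \<open>Unlike \<open>refl_i\<close>, this acts on the whole ambient space with the norm fixed
  at 2, so that composition and conjugation need no membership in \<open>L\<close>.\<close>

definition rf :: "gvec \<Rightarrow> gvec \<Rightarrow> gvec" where
  "rf s x = x - cscale ((1 - \<i>) * (hform s x / 2)) s"

lemma rf_isom:
  assumes "hform s s = 2" shows "isom (rf s)"
  unfolding isom_def
proof (intro conjI allI)
  fix x y c
  show "rf s (x + y) = rf s x + rf s y"
    by (simp add: rf_def hform_simps cscale_simps algebra_simps add_divide_distrib)
  show "rf s (cscale c x) = cscale c (rf s x)"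
    by (simp add: rf_def hform_simps cscale_simps algebra_simps)
  show "hform (rf s x) (rf s y) = hform x y"
    using assms hform_sym[of s x]
    by (simp add: rf_def hform_simps algebra_simps complex_eq_iff)
qed

lemma rf_conj:
  assumes "isom g" shows "rf (g s) (g x) = g (rf s x)"
  by (simp add: rf_def isom_diff[OF assms] isomD[OF assms])

text \<open>The reflection multiplies \<open>s\<close> by \<open>\<i>\<close>, so four applications
  change \<open>x\<close> by a multiple of \<open>1 + \<i> + \<i>^2 + \<i>^3 = 0\<close>.\<close>

lemma rf_pow4:
  assumes "hform s s = 2" shows "rf s (rf s (rf s (rf s x))) = x"
proof -
  have r: "rf s (x - cscale c s) = x - cscale ((1 - \<i>) * (hform s x / 2) + \<i> * c) s" for c
    using assms by (simp add: rf_def hform_simps cscale_simps algebra_simps add_divide_distrib diff_divide_distrib)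
  define a where "a = (1 - \<i>) * (hform s x / 2)"
  have "rf s x = x - cscale a s" by (simp add: rf_def a_def)
  moreover have "a + \<i> * (a + \<i> * (a + \<i> * a)) = 0" by (simp add: algebra_simps)
  ultimately show ?thesis using r[folded a_def] by simp
qed

definition gunit :: "complex \<Rightarrow> bool" where
  "gunit u \<longleftrightarrow> u = 1 \<or> u = -1 \<or> u = \<i> \<or> u = - \<i>"

lemma gunit_simps: "gunit u \<Longrightarrow> u * cnj u = 1" "gunit u \<Longrightarrow> cnj u * u = 1" "gunit u \<Longrightarrow> gunit v \<Longrightarrow> gunit (u * v)"
   "gunit u \<Longrightarrow> gunit (cnj u)" "gunit 1" "gunit (-1)" "gunit \<i>" "gunit (- \<i>)"
  by (auto simp: gunit_def)

lemma rf_unit: "gunit u \<Longrightarrow> rf (cscale u s) x = rf s x"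
  by (auto simp: gunit_def rf_def hform_simps algebra_simps cscale_minus)

text \<open>Products without inverses suffice: for vectors of norm 2 the reflections have finite
  order, so the monoid is a group (\<open>rgrp_inv\<close>).\<close>

inductive_set rgrp :: "gvec set \<Rightarrow> (gvec \<Rightarrow> gvec) set" for R where
  rgrp_id: "id \<in> rgrp R"
| rgrp_step: "g \<in> rgrp R \<Longrightarrow> r \<in> R \<Longrightarrow> rf r \<circ> g \<in> rgrp R"

locale root_set =
  fixes R :: "gvec set"
  assumes norm2: "r \<in> R \<Longrightarrow> hform r r = 2"
begin

lemma rgrp_comp: "f \<in> rgrp R \<Longrightarrow> g \<in> rgrp R \<Longrightarrow> f \<circ> g \<in> rgrp R"
  by (induction f rule: rgrp.induct) (auto intro: rgrp.intros simp: o_assoc[symmetric])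

lemma rgrp_gen: "r \<in> R \<Longrightarrow> rf r \<in> rgrp R"
  using rgrp_step[OF rgrp_id, of r] by simp

lemma rgrp_isom: "g \<in> rgrp R \<Longrightarrow> isom g"
  by (induction rule: rgrp.induct) (simp_all only: isom_id isom_comp rf_isom norm2)

lemma rgrp_inv: "g \<in> rgrp R \<Longrightarrow> \<exists>h\<in>rgrp R. h \<circ> g = id \<and> g \<circ> h = id"
proof (induction rule: rgrp.induct)
  case rgrp_id
  then show ?case using rgrp.rgrp_id by (intro bexI[of _ id]) auto
next
  case (rgrp_step g r)
  then obtain h where h: "h \<in> rgrp R" "h \<circ> g = id" "g \<circ> h = id" by blast
  have "rf r \<circ> rf r \<circ> rf r \<in> rgrp R" by (intro rgrp_comp rgrp_gen rgrp_step(2))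
  then have "h \<circ> (rf r \<circ> rf r \<circ> rf r) \<in> rgrp R" by (rule rgrp_comp[OF h(1)])
  moreover have "h (rf r (rf r (rf r (rf r (g x))))) = x" "rf r (g (h (rf r (rf r (rf r x))))) = x" for x
    using h(2,3) rf_pow4[OF norm2[OF rgrp_step(2)]] by (simp_all add: fun_eq_iff)
  ultimately show ?case by (intro bexI[of _ "h \<circ> (rf r \<circ> rf r \<circ> rf r)"]) (auto simp: fun_eq_iff)
qed

definition orb :: "gvec \<Rightarrow> gvec \<Rightarrow> bool" where
  "orb x y \<longleftrightarrow> (\<exists>g\<in>rgrp R. \<exists>u. gunit u \<and> y = cscale u (g x))"

lemma orb_refl [simp, intro]: "orb x x"
  unfolding orb_def by (intro bexI[of _ id] exI[of _ 1]) (auto simp: gunit_simps rgrp_id)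

lemma orb_trans [trans]: "orb x y \<Longrightarrow> orb y z \<Longrightarrow> orb x z"
  unfolding orb_def
proof (elim bexE exE conjE)
  fix g h u v assume g: "g \<in> rgrp R" "h \<in> rgrp R" "gunit u" "gunit v" "y = cscale u (g x)" "z = cscale v (h y)"
  then have "z = cscale (v * u) ((h \<circ> g) x)" using isomD(2)[OF rgrp_isom[of h]] by simp
  then show "\<exists>g\<in>rgrp R. \<exists>u. gunit u \<and> z = cscale u (g x)"
    using g rgrp_comp[of h g] gunit_simps(3)[of v u] by blast
qed

lemma orb_sym: "orb x y \<Longrightarrow> orb y x"
  unfolding orb_def
proof (elim bexE exE conjE)
  fix g u assume g: "g \<in> rgrp R" "gunit u" "y = cscale u (g x)"
  obtain h where h: "h \<in> rgrp R" "h \<circ> g = id" using rgrp_inv[OF g(1)] by blast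
  have "cscale (cnj u) (h y) = x"
    using g h(2) isomD(2)[OF rgrp_isom[OF h(1)]] gunit_simps(2)[OF g(2)] by (simp add: fun_eq_iff)
  then show "\<exists>g\<in>rgrp R. \<exists>u. gunit u \<and> x = cscale u (g y)"
    using h(1) gunit_simps(4)[OF g(2)] by metis
qed

lemma orb_unit: "gunit u \<Longrightarrow> orb x (cscale u x)"
  unfolding orb_def by (intro bexI[of _ id] exI[of _ u]) (auto simp: rgrp_id)

lemma orb_app: "g \<in> rgrp R \<Longrightarrow> orb x (g x)"
  unfolding orb_def by (intro bexI[of _ g] exI[of _ 1]) (auto simp: gunit_simps)

lemma orb_norm: "orb x y \<Longrightarrow> hform y y = hform x x"
  unfolding orb_def using rgrp_isom gunit_simps(1,2) by (auto simp: hform_simps isomD mult.assoc[symmetric])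

definition refl_roots :: "gvec set" where "refl_roots = {s. hform s s = 2 \<and> rf s \<in> rgrp R}"

lemma refl_roots_gen: "r \<in> R \<Longrightarrow> r \<in> refl_roots"
  by (simp add: refl_roots_def norm2 rgrp_gen)

text \<open>Conjugation by \<open>g\<close>: the reflection in \<open>g r\<close> is
  \<open>g \<circ> rf r\<close> followed on the right by the inverse of \<open>g\<close>. Membership
  of reflections thus becomes a question about orbits.\<close>

lemma refl_roots_orb:
  assumes "orb r s" "r \<in> refl_roots" shows "s \<in> refl_roots"
proof -
  obtain g u where g: "g \<in> rgrp R" "gunit u" "s = cscale u (g r)" using assms(1) by (auto simp: orb_def)
  obtain h where h: "h \<in> rgrp R" "h \<circ> g = id" "g \<circ> h = id" using rgrp_inv[OF g(1)] by blast
  have "rf s x = (g \<circ> rf r \<circ> h) x" for x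
    using rf_conj[OF rgrp_isom[OF g(1)], of r "h x"] h(3) g by (simp add: rf_unit fun_eq_iff)
  then have "rf s = g \<circ> rf r \<circ> h" by (rule ext)
  moreover have "g \<circ> rf r \<circ> h \<in> rgrp R" using assms(2) g h by (intro rgrp_comp) (auto simp: refl_roots_def)
  ultimately show ?thesis using orb_norm[OF assms(1)] assms(2) by (simp add: refl_roots_def)
qed

lemma orb_rf: "s \<in> refl_roots \<Longrightarrow> orb x (rf s x)"
  by (auto simp: refl_roots_def intro: orb_app)

text \<open>An isometry carrying generators to reflection vectors of the group normalizes the group.\<close>
lemma orb_isom:
  assumes "isom t" "bij t" "\<And>r. r \<in> R \<Longrightarrow> t r \<in> refl_roots" "orb x y"
  shows "orb (t x) (t y)"
proof -
  have "\<exists>h\<in>rgrp R. \<forall>x. t (g x) = h (t x)" if "g \<in> rgrp R" for g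
    using that
  proof induction
    case rgrp_id
    then show ?case using rgrp.rgrp_id by (intro bexI[of _ id]) auto
  next
    case (rgrp_step g r)
    then obtain h where h: "h \<in> rgrp R" "\<forall>x. t (g x) = h (t x)" by blast
    have "rf (t r) \<circ> h \<in> rgrp R" using assms(3)[OF rgrp_step(2)] h(1) by (intro rgrp_comp) (auto simp: refl_roots_def)
    moreover have "t ((rf r \<circ> g) x) = (rf (t r) \<circ> h) (t x)" for x
      using h(2) rf_conj[OF assms(1), symmetric] by simp
    ultimately show ?case by blast
  qed
  then show ?thesis using assms(4) isomD(2)[OF assms(1)] unfolding orb_def by metis
qed

end

section \<open>Coordinates adapted to a null vector\<close>

definition vec4 :: "'a \<Rightarrow> 'a \<Rightarrow> 'a \<Rightarrow> 'a \<Rightarrow> 'a^4" where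
  "vec4 a b c d = (\<chi> j. if j = 1 then a else if j = 2 then b else if j = 3 then c else d)"

lemma vec4_nth [simp]: "vec4 a b c d $ 1 = a" "vec4 a b c d $ 2 = b" "vec4 a b c d $ 3 = c" "vec4 a b c d $ 4 = d"
  by (simp_all add: vec4_def)

text \<open>
  The roots \<open>frame_root j\<close> are those of the points with \<open>x\<^sub>1 = 0\<close>. The sum \<open>null_vec\<close> of the roots of \<open>x\<close> and
  \<open>x + a\<close> is the same null vector for all points \<open>x\<close>, and \<open>null_dual\<close> is \<open>s\<^bsub>h\<^sub>1\<^esub> - null_vec\<close>.
\<close>
fun frame_root :: "J \<Rightarrow> gvec" where
  "frame_root o0 = (vec4 (-1,-1) (-1,-1) (-1,-1) (-1,-1), 1 - 2 * \<i>, -1)"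
| "frame_root o1 = (vec4 (-1,-1) (0,-2) (-1,-1) (-1,-1), - 2 * \<i>, -2)"
| "frame_root o2 = (vec4 (-1,-1) (-1,-1) (0,-2) (-1,-1), - 2 * \<i>, -2)"
| "frame_root o3 = (vec4 (-1,-1) (-1,-1) (-1,-1) (0,-2), - 2 * \<i>, -2)"
| "frame_root o12 = (vec4 (-1,-1) (0,0) (0,0) (-1,-1), - \<i>, -1)"
| "frame_root o13 = (vec4 (-1,-1) (0,0) (-1,-1) (0,0), - \<i>, -1)"
| "frame_root o23 = (vec4 (-1,-1) (-1,-1) (0,0) (0,0), - \<i>, -1)"
| "frame_root o123 = (vec4 (-1,1) (0,0) (0,0) (0,0), 0, 0)"

definition null_vec :: gvec where
  "null_vec = (vec4 (-1,-1) (-1,-1) (-1,-1) (-1,-1), - 2 * \<i>, -2)"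

definition null_dual :: gvec where
  "null_dual = (vec4 (pG+1,pG+1) (1,pG+1) (1,pG+1) (1,pG+1), -3 + 2 * \<i> + pG, pG + 2)"

lemmas hform_expand = hform_def D4G_form_def G11_form_def sum_4

lemma frame_root_gram: "hform (frame_root j) (frame_root k) = (if j = k then 2 else 0)"
proof -
  have "\<forall>j k. hform (frame_root j) (frame_root k) = (if j = k then 2 else 0)"
    unfolding all_J by (simp add: hform_expand pG_def complex_eq_iff)
  then show ?thesis by blast
qed

lemma frame_root_nu: "hform (frame_root j) null_vec = 0" "hform (frame_root j) null_dual = 0" "hform null_vec (frame_root j) = 0" "hform null_dual (frame_root j) = 0"
proof -
  have *: "\<forall>j. hform (frame_root j) null_vec = 0 \<and> hform (frame_root j) null_dual = 0"
    unfolding all_J by (simp add: hform_expand pG_def complex_eq_iff null_vec_def null_dual_def)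
  then show "hform (frame_root j) null_vec = 0" "hform (frame_root j) null_dual = 0" by auto
  then show "hform null_vec (frame_root j) = 0" "hform null_dual (frame_root j) = 0" using hform_sym[of null_vec] hform_sym[of null_dual] by simp_all
qed

lemma nu_gram: "hform null_vec null_vec = 0" "hform null_dual null_dual = 0" "hform null_vec null_dual = pG" "hform null_dual null_vec = cnj pG"
  by (simp_all add: hform_expand pG_def complex_eq_iff null_vec_def null_dual_def)

text \<open>The factor \<open>cnj pG / 2\<close> makes the form on \<open>z\<close> the standard
  one, as frame roots have norm 2; a frame root becomes \<open>pG\<close> times a unit
  vector.\<close>

definition psi :: "(J \<Rightarrow> complex) \<Rightarrow> complex \<Rightarrow> complex \<Rightarrow> gvec" where
  "psi z m n = (\<Sum>j\<in>UNIV. cscale (z j * (cnj pG / 2)) (frame_root j)) + cscale m null_dual + cscale n null_vec"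

lemma hform_0: "hform x 0 = 0" "hform 0 x = 0"
  using hform_scale_right[of x 0 0] hform_scale_left[of 0 0 x] by simp_all

lemma cscale_0_right: "cscale c 0 = 0"
  using cscale_cscale[of c 0 0] by simp

lemma hform_sum_right: "finite A \<Longrightarrow> hform x (\<Sum>j\<in>A. f j) = (\<Sum>j\<in>A. hform x (f j))"
  by (induction A rule: finite_induct) (auto simp: hform_add_right hform_0)

lemma hform_sum_left: "finite A \<Longrightarrow> hform (\<Sum>j\<in>A. f j) x = (\<Sum>j\<in>A. hform (f j) x)"
  by (induction A rule: finite_induct) (auto simp: hform_add_left hform_0)

definition ip :: "(J \<Rightarrow> complex) \<Rightarrow> (J \<Rightarrow> complex) \<Rightarrow> complex" where
  "ip z w = (\<Sum>j\<in>UNIV. cnj (z j) * w j)"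

lemma hform_psi: "hform (psi z m n) (psi z' m' n') = ip z z' + cnj m * cnj pG * n' + cnj n * pG * m'"
proof -
  define c where "c = cnj pG / 2"
  have c: "cnj c * c * 2 = 1" using pG_simps(1) by (simp add: c_def)
  have "hform (psi z m n) (psi z' m' n') = (\<Sum>k\<in>UNIV. \<Sum>j\<in>UNIV. z' k * c * (cnj (z j * c) * (if j = k then 2 else 0)))
      + cnj m * cnj pG * n' + cnj n * pG * m'"
    unfolding psi_def c_def[symmetric]
    by (simp add: hform_simps hform_sum_left hform_sum_right frame_root_gram frame_root_nu nu_gram sum_distrib_left)
  also have "(\<Sum>k\<in>UNIV. \<Sum>j\<in>UNIV. z' k * c * (cnj (z j * c) * (if j = k then 2 else 0))) = ip z z'"
    unfolding ip_def
  proof (intro sum.cong refl)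
    fix k :: J
    have "(\<Sum>j\<in>UNIV. z' k * c * (cnj (z j * c) * (if j = k then 2 else 0))) = (\<Sum>j\<in>UNIV. if j = k then z' k * c * (cnj (z k * c) * 2) else 0)"
      by (intro sum.cong) auto
    also have "\<dots> = cnj (z k) * z' k * (cnj c * c * 2)" by (simp add: mult_ac)
    finally show "(\<Sum>j\<in>UNIV. z' k * c * (cnj (z j * c) * (if j = k then 2 else 0))) = cnj (z k) * z' k"
      unfolding c by simp
  qed
  finally show ?thesis .
qed

lemma cscale_sum: "finite A \<Longrightarrow> cscale c (\<Sum>j\<in>A. f j) = (\<Sum>j\<in>A. cscale c (f j))"
  by (induction A rule: finite_induct) (auto simp: cscale_add_right cscale_0_right)

lemma psi_add: "psi z m n + psi z' m' n' = psi (\<lambda>j. z j + z' j) (m + m') (n + n')"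
  unfolding psi_def distrib_right cscale_add_left sum.distrib by (simp only: add_ac)

lemma psi_scale: "cscale c (psi z m n) = psi (\<lambda>j. c * z j) (c * m) (c * n)"
  by (simp add: psi_def cscale_add_right cscale_sum mult.assoc)

lemma psi_diff: "psi z m n - psi z' m' n' = psi (\<lambda>j. z j - z' j) (m - m') (n - n')"
  unfolding psi_def left_diff_distrib cscale_diff_left sum_subtractf by simp

definition single :: "J \<Rightarrow> complex \<Rightarrow> J \<Rightarrow> complex" where "single j c k = (if k = j then c else 0)"

lemma single_simps [simp]: "single j c j = c" "(single j c)(j := d) = single j d"
  by (auto simp: single_def)

lemma ip_single: "ip (single j c) z = cnj c * z j"
  by (simp add: ip_def single_def if_distrib[of cnj] if_distrib[of "\<lambda>x. x * _"] cong: if_cong)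

lemma frame_root_psi: "psi (single j pG) 0 0 = frame_root j"
proof -
  have "(\<Sum>k\<in>UNIV. cscale (single j pG k * (cnj pG / 2)) (frame_root k)) = (\<Sum>k\<in>UNIV. if k = j then frame_root j else 0)"
    by (intro sum.cong) (auto simp: single_def pG_simps(1))
  then show ?thesis by (simp add: psi_def)
qed

definition Zc :: "gvec \<Rightarrow> J \<Rightarrow> complex" where "Zc s j = hform (frame_root j) s * (pG / 2)"
definition Mc :: "gvec \<Rightarrow> complex" where "Mc s = hform null_vec s * (cnj pG / 2)"
definition Nc :: "gvec \<Rightarrow> complex" where "Nc s = hform null_dual s * (pG / 2)"

lemma psi_coords: "psi (Zc s) (Mc s) (Nc s) = s"
proof -
  obtain v m n where s: "s = (v, m, n)" by (cases s)
  have r: "cscale (a * (pG / 2) * (cnj pG / 2)) x = cscale (a / 2) x" for a x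
  proof -
    have "a * (pG / 2) * (cnj pG / 2) = a * (pG * cnj pG) / 4" by simp
    also have "\<dots> = a / 2" unfolding pG_simps(1) by simp
    finally show ?thesis by (simp only:)
  qed
  show ?thesis
    unfolding psi_def Zc_def Mc_def Nc_def r sum_J s
    by (simp add: cscale_def prod_eq_iff vec_eq_iff forall_4 hform_expand null_vec_def null_dual_def pG_def complex_eq_iff field_simps)
qed

lemma psi_coord_inv: "Zc (psi z m n) = z" "Mc (psi z m n) = m" "Nc (psi z m n) = n"
proof -
  have "psi (\<lambda>k. 0) 1 0 = null_dual" "psi (\<lambda>k. 0) 0 1 = null_vec" by (simp_all add: psi_def)
  then have b: "hform null_vec (psi z m n) = pG * m" "hform null_dual (psi z m n) = cnj pG * n"
    using hform_psi[of "\<lambda>k. 0" 1 0 z m n] hform_psi[of "\<lambda>k. 0" 0 1 z m n] by (simp_all add: ip_def)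
  have "hform (frame_root j) (psi z m n) = cnj pG * z j" for j
    using hform_psi[of "single j pG" 0 0 z m n] unfolding frame_root_psi ip_single by simp
  then show "Zc (psi z m n) = z" "Mc (psi z m n) = m" "Nc (psi z m n) = n"
    using pG_simps(1,2) by (auto simp: Zc_def Mc_def Nc_def b fun_eq_iff mult_ac)
qed

lemma psi_inj: "psi z m n = psi z' m' n' \<longleftrightarrow> z = z' \<and> m = m' \<and> n = n'"
  using psi_coord_inv by metis

lemma rf_psi: "rf (psi a k l) (psi z m n) =
  (let c = (1 - \<i>) / 2 * (ip a z + cnj k * cnj pG * n + cnj l * pG * m) in psi (\<lambda>j. z j - c * a j) (m - c * k) (n - c * l))"
  by (simp add: rf_def hform_psi psi_scale psi_diff Let_def)

section \<open>The group generated by the 32 reflections\<close>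

lemma gauss_intros [simp, intro]:
  "0 \<in> gauss" "1 \<in> gauss" "\<i> \<in> gauss" "numeral k \<in> gauss" "of_int i \<in> gauss" "pG \<in> gauss"
  "x \<in> gauss \<Longrightarrow> - x \<in> gauss" "x \<in> gauss \<Longrightarrow> cnj x \<in> gauss"
  "x \<in> gauss \<Longrightarrow> y \<in> gauss \<Longrightarrow> x + y \<in> gauss" "x \<in> gauss \<Longrightarrow> y \<in> gauss \<Longrightarrow> x - y \<in> gauss"
  "x \<in> gauss \<Longrightarrow> y \<in> gauss \<Longrightarrow> x * y \<in> gauss"
  by (auto simp: gauss_def pG_def)

lemma gauss_iff: "x \<in> gauss \<longleftrightarrow> (\<exists>a b :: int. x = of_int a + \<i> * of_int b)"
  by (auto simp: gauss_def complex_eq_iff Ints_def)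

lemma gunit_gauss [simp]: "gunit u \<Longrightarrow> u \<in> gauss"
  by (auto simp: gunit_def)

lemma gauss_induct [consumes 1, case_names zero add]:
  assumes "g \<in> gauss" and z: "P 0" and s: "\<And>h u. h \<in> gauss \<Longrightarrow> P h \<Longrightarrow> gunit u \<Longrightarrow> P (h + u)"
  shows "P g"
proof -
  have 1: "P (of_int a)" for a
  proof (induction a rule: int_induct[of _ 0])
    case (step1 i) then show ?case using s[of "of_int i" 1] by (simp add: gunit_simps)
  next
    case (step2 i) then show ?case using s[of "of_int i" "-1"] by (simp add: gunit_simps)
  qed (use z in simp)
  have 2: "P (of_int a + \<i> * of_int b)" for a b
  proof (induction b rule: int_induct[of _ 0])
    case (step1 i) then show ?case using s[of "of_int a + \<i> * of_int i" \<i>] by (simp add: gunit_simps algebra_simps)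
  next
    case (step2 i) then show ?case using s[of "of_int a + \<i> * of_int i" "- \<i>"] by (simp add: gunit_simps algebra_simps)
  qed (use 1 in simp)
  then show ?thesis using assms(1) by (auto simp: gauss_iff)
qed

definition divp :: "complex \<Rightarrow> bool" where "divp x \<longleftrightarrow> (\<exists>q\<in>gauss. x = pG * q)"

lemma divp_iff: "divp (of_int a + \<i> * of_int b) \<longleftrightarrow> even (a + b)"
proof
  assume "divp (of_int a + \<i> * of_int b)"
  then obtain q where q: "q \<in> gauss" "of_int a + \<i> * of_int b = pG * q" unfolding divp_def by blast
  then obtain c d where "q = of_int c + \<i> * of_int d" unfolding gauss_iff by blast
  with q(2) have "of_int a + \<i> * of_int b = pG * (of_int c + \<i> * of_int d)" by simp
  then have "a = c - d" "b = c + d" by (auto simp: pG_def complex_eq_iff)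
  then show "even (a + b)" by simp
next
  assume "even (a + b)"
  then obtain k where "a + b = 2 * k" by blast
  then have "of_int a + \<i> * of_int b = pG * (of_int k + \<i> * of_int (k - a))"
    by (simp add: pG_def complex_eq_iff)
  then show "divp (of_int a + \<i> * of_int b)" unfolding divp_def gauss_iff by blast
qed

lemma divp_gauss: "divp x \<Longrightarrow> x \<in> gauss"
  by (auto simp: divp_def)

lemma divp_add: "x \<in> gauss \<Longrightarrow> y \<in> gauss \<Longrightarrow> divp (x + y) \<longleftrightarrow> (divp x \<longleftrightarrow> divp y)"
proof -
  assume "x \<in> gauss" "y \<in> gauss"
  then obtain a b c d where "x = of_int a + \<i> * of_int b" "y = of_int c + \<i> * of_int d" by (auto simp: gauss_iff)
  moreover from this have "x + y = of_int (a + c) + \<i> * of_int (b + d)" by (simp add: algebra_simps)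
  ultimately show ?thesis by (simp only: divp_iff) auto
qed

lemma divp_minus [simp]: "divp (- x) \<longleftrightarrow> divp x"
  unfolding divp_def by (metis gauss_intros(7) minus_minus mult_minus_right)

lemma divp_diff: "x \<in> gauss \<Longrightarrow> y \<in> gauss \<Longrightarrow> divp (x - y) \<longleftrightarrow> (divp x \<longleftrightarrow> divp y)"
  using divp_add[of x "- y"] by simp

lemma divp_mult: "x \<in> gauss \<Longrightarrow> y \<in> gauss \<Longrightarrow> divp (x * y) \<longleftrightarrow> divp x \<or> divp y"
proof -
  assume "x \<in> gauss" "y \<in> gauss"
  then obtain a b c d where "x = of_int a + \<i> * of_int b" "y = of_int c + \<i> * of_int d" by (auto simp: gauss_iff)
  moreover from this have "x * y = of_int (a * c - b * d) + \<i> * of_int (a * d + b * c)"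
    by (simp add: algebra_simps)
  ultimately show ?thesis by (simp only: divp_iff) auto
qed

lemma divp_simps [simp]: "divp 0" "\<not> divp 1" "\<not> divp \<i>" "divp pG" "divp 2" "divp (cnj pG)"
  using divp_iff[of 0 0] divp_iff[of 1 0] divp_iff[of 0 1] divp_iff[of 1 1] divp_iff[of 2 0] divp_iff[of 1 "-1"]
  by (auto simp: pG_def)

lemma divp_cnj: "x \<in> gauss \<Longrightarrow> divp (cnj x) \<longleftrightarrow> divp x"
proof -
  assume "x \<in> gauss"
  then obtain p q where "x = of_int p + \<i> * of_int q" unfolding gauss_iff by blast
  then show ?thesis using divp_iff[of p q] divp_iff[of p "- q"] by simp
qed

definition wvec :: "J set \<Rightarrow> J \<Rightarrow> complex" where "wvec w j = (if j \<in> w then \<i> else 0)"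

text \<open>Norm 2 requires \<open>cnj pG * nw w\<close> to have real part
  \<open>1 - card w / 2\<close>; the imaginary part is that of the listed roots.\<close>

definition nw :: "J set \<Rightarrow> complex" where
  "nw w = (if w = {} then 1 else if w = UNIV then -1 - 2 * \<i> else - \<i>)"

text \<open>Frame roots, their antipodes \<open>null_vec - frame_root j\<close>, and one root for
  each code word; \<open>root_of_DD\<close> identifies them with the 32 listed roots.\<close>

definition gens :: "gvec set" where
  "gens = (\<Union>j. {psi (single j pG) 0 0, psi (single j (- pG)) 0 1}) \<union> (\<lambda>w. psi (wvec w) 1 (nw w)) ` ham"

lemma ip_wvec: "ip (wvec w) (wvec w') = of_nat (card (w \<inter> w'))"
proof -
  have "ip (wvec w) (wvec w') = (\<Sum>j\<in>UNIV. if j \<in> w \<inter> w' then 1 else 0)"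
    unfolding ip_def by (intro sum.cong) (auto simp: wvec_def)
  then show ?thesis by (simp add: sum.If_cases Int_def)
qed

interpretation root_set gens
proof
  fix r assume "r \<in> gens"
  then consider j where "r = psi (single j pG) 0 0" | j where "r = psi (single j (- pG)) 0 1"
    | w where "w \<in> ham" "r = psi (wvec w) 1 (nw w)" by (auto simp: gens_def)
  then show "hform r r = 2"
  proof cases
    case (3 w)
    then have "w = {} \<or> w = UNIV \<or> w \<noteq> {} \<and> w \<noteq> UNIV \<and> card w = 4" using ham_card by blast
    then show ?thesis using 3 by (auto simp: hform_psi ip_wvec nw_def pG_def complex_eq_iff)
  qed (simp_all add: hform_psi ip_single single_def pG_simps)
qed

lemma half_pG: "(1 - \<i>) / 2 * (cnj pG * x) = - \<i> * x" "(1 - \<i>) / 2 * (pG * x) = x"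
  by (simp_all add: pG_def complex_eq_iff field_simps)

lemma orb_R0: "orb (psi z m n) (psi (z(j := \<i> * z j)) m n)"
proof -
  have "rf (psi (single j pG) 0 0) (psi z m n) = psi (z(j := \<i> * z j)) m n"
    unfolding rf_psi Let_def ip_single psi_inj
    by (auto simp: fun_eq_iff single_def half_pG pG_def algebra_simps)
  moreover have "psi (single j pG) 0 0 \<in> refl_roots" by (intro refl_roots_gen) (auto simp: gens_def)
  ultimately show ?thesis using orb_rf by metis
qed

lemma orb_R1: "orb (psi z m n) (psi (z(j := \<i> * z j + pG * m)) m (n - \<i> * z j - m))"
proof -
  have c: "(1 - \<i>) / 2 * (cnj (- pG) * z j + pG * m) = \<i> * z j + m"
    by (simp add: pG_def complex_eq_iff field_simps)
  have "rf (psi (single j (- pG)) 0 1) (psi z m n) = psi (z(j := \<i> * z j + pG * m)) m (n - \<i> * z j - m)"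
    unfolding rf_psi Let_def ip_single psi_inj
    using c by (auto simp: fun_eq_iff single_def pG_def algebra_simps)
  moreover have "psi (single j (- pG)) 0 1 \<in> refl_roots" by (intro refl_roots_gen) (auto simp: gens_def)
  ultimately show ?thesis using orb_rf by metis
qed

lemma orb_unit_coord: "gunit u \<Longrightarrow> orb (psi z m n) (psi (z(j := u * z j)) m n)"
proof -
  have 1: "orb (psi z m n) (psi (z(j := \<i> * z j)) m n)" for z by (rule orb_R0)
  have 2: "orb (psi z m n) (psi (z(j := - 1 * z j)) m n)"
    using orb_trans[OF 1[of z] 1[of "z(j := \<i> * z j)"]] by (simp flip: mult.assoc)
  have 3: "orb (psi z m n) (psi (z(j := - \<i> * z j)) m n)"
    using orb_trans[OF 2 1] by (simp flip: mult.assoc)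
  assume "gunit u"
  then show ?thesis using 1 2 3 by (auto simp: gunit_def)
qed

text \<open>Both reflections of an antipodal pair multiply \<open>z j\<close> by
  \<open>\<i>\<close>; cancelling this factor leaves a pure translation.\<close>

lemma orb_transl1: "orb (psi z m n) (psi (z(j := z j + pG * m)) m (n - z j - m))"
  using orb_trans[OF orb_unit_coord[of "- \<i>" z m n j] orb_R1[of "z(j := - \<i> * z j)" m n j]]
  by (simp add: gunit_simps flip: mult.assoc)

lemma orb_transl_unit:
  assumes "gunit u"
  shows "orb (psi z m n) (psi (z(j := z j + u * pG * m)) m (n - cnj u * z j - m))"
proof -
  have "orb (psi z m n) (psi (z(j := cnj u * z j)) m n)" using assms by (intro orb_unit_coord gunit_simps)
  also have "orb \<dots> (psi (z(j := cnj u * z j + pG * m)) m (n - cnj u * z j - m))"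
    using orb_transl1[of "z(j := cnj u * z j)" m n j] by simp
  also have "orb \<dots> (psi (z(j := u * (cnj u * z j + pG * m))) m (n - cnj u * z j - m))"
    using orb_unit_coord[OF assms, of "z(j := cnj u * z j + pG * m)" m _ j] by simp
  finally show ?thesis using gunit_simps(1)[OF assms] by (simp add: distrib_left flip: mult.assoc)
qed

lemma orb_transl:
  assumes "g \<in> gauss" "z j \<in> gauss" "m \<in> gauss" "n \<in> gauss"
  shows "\<exists>n'\<in>gauss. orb (psi z m n) (psi (z(j := z j + pG * g * m)) m n')"
  using assms(1)
proof (induction rule: gauss_induct)
  case zero
  then show ?case using assms by (intro bexI[of _ n]) auto
next
  case (add h u)
  then obtain n' where n': "n' \<in> gauss" "orb (psi z m n) (psi (z(j := z j + pG * h * m)) m n')" by blast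
  have "orb (psi z m n) (psi (z(j := z j + pG * (h + u) * m)) m (n' - cnj u * (z j + pG * h * m) - m))"
    using orb_trans[OF n'(2) orb_transl_unit[OF add(2), of "z(j := z j + pG * h * m)" m n' j]]
    by (simp add: algebra_simps)
  moreover have "n' - cnj u * (z j + pG * h * m) - m \<in> gauss" using n'(1) assms add(1,2) by auto
  ultimately show ?case by blast
qed

lemma orb_coord:
  assumes "gunit u" "g \<in> gauss" "z j = u * c + pG * g * m" "z j \<in> gauss" "m \<in> gauss" "n \<in> gauss"
  shows "\<exists>n'\<in>gauss. orb (psi z m n) (psi (z(j := c)) m n')"
proof -
  obtain n' where n': "n' \<in> gauss" "orb (psi z m n) (psi (z(j := u * c)) m n')"
    using orb_transl[of "- g" z j m n] assms(2-6) by auto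
  have "orb (psi (z(j := u * c)) m n') (psi (z(j := c)) m n')"
    using orb_unit_coord[OF gunit_simps(4)[OF assms(1)], of "z(j := u * c)" m n' j] gunit_simps(2)[OF assms(1)]
    by (simp flip: mult.assoc)
  then show ?thesis using n' orb_trans by blast
qed

text \<open>Each coordinate of \<open>z\<close> can be adjusted on its own, up to units and modulo
  \<open>pG * m\<close>. The change of \<open>n\<close> is not tracked; it is recovered from the
  norm afterwards.\<close>

lemma orb_coords:
  assumes "\<And>j. \<exists>u g. gunit u \<and> g \<in> gauss \<and> z j = u * c j + pG * g * m" "\<And>j. z j \<in> gauss" "m \<in> gauss" "n \<in> gauss"
  shows "\<exists>n'\<in>gauss. orb (psi z m n) (psi c m n')"
proof -
  have "\<exists>n'\<in>gauss. orb (psi z m n) (psi (\<lambda>j. if j \<in> A then c j else z j) m n')" if "finite A" for A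
    using that
  proof induction
    case empty
    then show ?case using assms(4) by (intro bexI[of _ n]) auto
  next
    case (insert j A)
    then obtain n' where n': "n' \<in> gauss" "orb (psi z m n) (psi (\<lambda>j. if j \<in> A then c j else z j) m n')" by blast
    let ?z = "\<lambda>j. if j \<in> A then c j else z j"
    obtain u g where ug: "gunit u" "g \<in> gauss" "z j = u * c j + pG * g * m" using assms(1) by blast
    have e: "?z(j := c j) = (\<lambda>k. if k \<in> insert j A then c k else z k)" by auto
    have "\<exists>n''\<in>gauss. orb (psi ?z m n') (psi (?z(j := c j)) m n'')"
    proof (rule orb_coord[OF ug(1,2)])
      show "?z j = u * c j + pG * g * m" "?z j \<in> gauss" using ug(3) insert.hyps assms(2)[of j] by simp_all
    qed (use assms(3,4) n' in auto)
    then show ?case unfolding e using orb_trans[OF n'(2)] by blast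
  qed
  from this[of UNIV] show ?thesis by simp
qed

text \<open>The square of the product of the reflections of an antipodal pair: \<open>z j\<close>
  returns to itself and \<open>n\<close> moves by \<open>(pG - 2) * m\<close>.\<close>

lemma orb_central1: "orb (psi z m n) (psi z m (n + \<i> * pG * m))"
proof -
  obtain j :: J where True by simp
  have s: "orb (psi z m n) (psi (z(j := - z j + \<i> * pG * m)) m (n - \<i> * z j - m))" for z n
    using orb_trans[OF orb_R1[of z m n j] orb_R0[of "z(j := \<i> * z j + pG * m)" m _ j]]
    by (simp add: algebra_simps)
  from orb_trans[OF s[of z n] s[of "z(j := - z j + \<i> * pG * m)"]] show ?thesis
    by (simp add: algebra_simps pG_def)
qed

lemma orb_central: "orb (psi z m n) (psi z m (n + of_int k * \<i> * pG * m))"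
proof (induction k rule: int_induct[of _ 0])
  case (step1 i)
  then show ?case using orb_trans[OF _ orb_central1[of z m "n + of_int i * \<i> * pG * m"]] by (simp add: algebra_simps)
next
  case (step2 i)
  then show ?case using orb_trans[OF _ orb_sym[OF orb_central1[of z m "n + of_int (i - 1) * \<i> * pG * m"]]]
    by (simp add: algebra_simps)
qed simp

text \<open>Applied to the difference of two values of \<open>n\<close> that give the same norm. For
  \<open>m = 1\<close> every such difference is a central translation, for \<open>m = 2\<close> only
  those with even \<open>k\<close>.\<close>

lemma central_diff:
  assumes "d \<in> gauss" "cnj pG * d + cnj d * pG = 0"
  obtains k :: int where "d = of_int k * \<i> * pG"
proof -
  obtain a b where ab: "d = of_int a + \<i> * of_int b" using assms(1) by (auto simp: gauss_iff)
  then have "a = - b" using assms(2) by (simp add: pG_def complex_eq_iff)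
  then have "d = of_int b * \<i> * pG" using ab by (simp add: pG_def complex_eq_iff)
  then show ?thesis by (rule that)
qed

text \<open>Construction A over the Gaussian integers for the Hamming code.\<close>

definition Alat :: "(J \<Rightarrow> complex) set" where
  "Alat = {a. (\<forall>j. a j \<in> gauss) \<and> {j. \<not> divp (a j)} \<in> ham}"

text \<open>Up to the group only the class of \<open>k\<close> modulo \<open>pG\<close> matters: the
  two reflections of an antipodal pair, compared after multiplication by units, shift
  \<open>k\<close> by \<open>pG\<close> and rotate it. The classes of 0 and -1 come from a frame
  root and the negative of its antipode.\<close>

lemma Z0_refl_roots:
  assumes "k \<in> gauss" shows "psi (single j pG) 0 k \<in> refl_roots"
proof -
  define F where "F k = psi (single j pG) 0 k" for k
  have uF: "cscale u (psi (single j (v * pG)) 0 k) = psi (single j (u * v * pG)) 0 (u * k)" for u v k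
    unfolding psi_scale psi_inj by (auto simp: single_def)
  have a: "orb (F k) (F (- \<i> * k))" for k
  proof -
    have "orb (F k) (psi (single j (\<i> * pG)) 0 k)"
      using orb_R0[of "single j pG" 0 k j] unfolding F_def by simp
    also have "orb \<dots> (cscale (- \<i>) (psi (single j (\<i> * pG)) 0 k))" by (intro orb_unit gunit_simps)
    finally show ?thesis unfolding uF by (simp add: F_def)
  qed
  have b: "orb (F k) (F (- \<i> * k - pG))" for k
  proof -
    have "orb (F k) (psi (single j (\<i> * pG)) 0 (k - \<i> * pG))"
      using orb_R1[of "single j pG" 0 k j] unfolding F_def by simp
    also have "orb \<dots> (cscale (- \<i>) (psi (single j (\<i> * pG)) 0 (k - \<i> * pG)))" by (intro orb_unit gunit_simps)
    finally show ?thesis unfolding uF by (simp add: F_def algebra_simps)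
  qed
  have c: "orb (F k) (F (u * k))" if "gunit u" for u k
  proof -
    have 2: "orb (F k) (F (- 1 * k))" using orb_trans[OF a[of k] a] by (simp flip: mult.assoc)
    have 3: "orb (F k) (F (\<i> * k))" using orb_trans[OF 2 a] by (simp flip: mult.assoc)
    show ?thesis using that a[of k] 2 3 by (auto simp: gunit_def)
  qed
  have d: "orb (F k) (F (k - pG))" for k
    using orb_trans[OF c[of \<i> k] b[of "\<i> * k"]] by (simp add: gunit_simps flip: mult.assoc)
  have e: "orb (F k) (F (k + u * pG))" if "gunit u" for u k
  proof -
    have "orb (F k) (F (- cnj u * k))" using c[of "- cnj u" k] that by (auto simp: gunit_def)
    also have "orb \<dots> (F (- cnj u * k - pG))" by (rule d)
    also have "orb \<dots> (F (- u * (- cnj u * k - pG)))" using c[of "- u"] that by (auto simp: gunit_def)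
    finally show ?thesis using gunit_simps(1)[OF that] by (simp add: algebra_simps flip: mult.assoc)
  qed
  have f: "orb (F k) (F (k + pG * g))" if "g \<in> gauss" for g k
    using that
  proof (induction rule: gauss_induct)
    case (add h u)
    then show ?case using orb_trans[OF add(3) e[OF add(2)]] by (simp add: algebra_simps)
  qed simp
  have F0: "F 0 \<in> refl_roots" unfolding F_def by (intro refl_roots_gen) (auto simp: gens_def)
  have "psi (single j (- pG)) 0 1 \<in> refl_roots" by (intro refl_roots_gen) (auto simp: gens_def)
  then have "cscale (-1) (psi (single j (-1 * pG)) 0 1) \<in> refl_roots"
    using refl_roots_orb[OF orb_unit] by (simp add: gunit_simps)
  then have "F (-1) \<in> refl_roots" unfolding uF by (simp add: F_def)
  show ?thesis
  proof (cases "divp k")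
    case True
    then obtain g where "g \<in> gauss" "k = pG * g" by (auto simp: divp_def)
    then show ?thesis using refl_roots_orb[OF f[of g 0] F0] by (simp add: F_def)
  next
    case False
    then have "divp (k + 1)" using assms by (simp add: divp_add)
    then obtain g where "g \<in> gauss" "k + 1 = pG * g" by (auto simp: divp_def)
    then have "k = -1 + pG * g" by (metis add.commute add_diff_cancel_right' diff_conv_add_uminus)
    then show ?thesis using refl_roots_orb[OF f[of g "-1"] \<open>F (-1) \<in> refl_roots\<close>] \<open>g \<in> gauss\<close> by (simp add: F_def)
  qed
qed

text \<open>Translations carry \<open>wvec w\<close> to every vector with odd positions
  \<open>w\<close>; the norm then determines \<open>n\<close> up to central translations.\<close>

lemma Z1_refl_roots:
  assumes "a \<in> Alat" "n \<in> gauss" "hform (psi a 1 n) (psi a 1 n) = 2"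
  shows "psi a 1 n \<in> refl_roots"
proof -
  define w where "w = {j. \<not> divp (a j)}"
  have w: "w \<in> ham" "\<And>j. a j \<in> gauss" using assms(1) by (auto simp: Alat_def w_def)
  have g: "psi (wvec w) 1 (nw w) \<in> refl_roots" using w by (intro refl_roots_gen) (auto simp: gens_def)
  have "\<exists>n'\<in>gauss. orb (psi (wvec w) 1 (nw w)) (psi a 1 n')"
  proof (rule orb_coords)
    fix j
    have "divp (wvec w j - a j)" using w(2)[of j] by (subst divp_diff) (auto simp: wvec_def w_def)
    then obtain q where "q \<in> gauss" "wvec w j - a j = pG * q" by (auto simp: divp_def)
    then have "gunit 1 \<and> q \<in> gauss \<and> wvec w j = 1 * a j + pG * q * 1"
      by (simp add: gunit_simps diff_eq_eq add.commute)
    then show "\<exists>u g. gunit u \<and> g \<in> gauss \<and> wvec w j = u * a j + pG * g * 1" by blast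
  qed (auto simp: wvec_def nw_def)
  then obtain n' where n': "n' \<in> gauss" "orb (psi (wvec w) 1 (nw w)) (psi a 1 n')" by blast
  have "hform (psi a 1 n') (psi a 1 n') = 2" using orb_norm[OF n'(2)] norm2[of "psi (wvec w) 1 (nw w)"] w by (auto simp: gens_def)
  then have "cnj pG * (n - n') + cnj (n - n') * pG = 0"
    using assms(3) unfolding hform_psi by (simp add: algebra_simps) (smt (verit) add_left_cancel mult.commute)
  then obtain k where "n - n' = of_int k * \<i> * pG" using central_diff[of "n - n'"] assms(2) n'(1) by blast
  then have "n = n' + of_int k * \<i> * pG * 1" by (simp add: diff_eq_eq add.commute)
  then show ?thesis using refl_roots_orb[OF orb_trans[OF n'(2) orb_central[of a 1 n' k]] g] by simp
qed

lemma null_vec_psi: "null_vec = psi (\<lambda>_. 0) 0 1"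
  by (simp add: psi_def)

text \<open>Adding \<open>null_vec\<close> gives a root whose reflection sends the null vector to
  \<open>- null_vec\<close>, because \<open>(1 - \<i>) / 2 * pG = 1\<close>.\<close>

lemma family_A:
  assumes "a \<in> Alat" "n \<in> gauss" "hform (psi a 1 n) (psi a 1 n) = 0"
  shows "orb (psi a 1 n) null_vec"
proof -
  have "hform (psi a 1 (n + 1)) (psi a 1 (n + 1)) = 2"
    using assms(3) by (simp add: hform_psi algebra_simps pG_def)
  then have r: "psi a 1 (n + 1) \<in> refl_roots" using assms by (intro Z1_refl_roots) auto
  have c: "ip a a + cnj 1 * cnj pG * n + cnj (n + 1) * pG * 1 = pG"
    using assms(3) by (simp add: hform_psi algebra_simps)
  have "rf (psi a 1 (n + 1)) (psi a 1 n) = psi (\<lambda>_. 0) 0 (-1)"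
    unfolding rf_psi Let_def c psi_inj using half_pG(2)[of 1] by (simp add: fun_eq_iff)
  then have "orb (psi a 1 n) (psi (\<lambda>_. 0) 0 (-1))" using orb_rf[OF r] by metis
  also have "orb \<dots> (cscale (-1) (psi (\<lambda>_. 0) 0 (-1)))" by (intro orb_unit gunit_simps)
  finally show ?thesis unfolding psi_scale null_vec_psi by simp
qed

section \<open>Isometries fixing the null vector\<close>

definition xor3 :: "J \<Rightarrow> J \<Rightarrow> J \<Rightarrow> J" where "xor3 a b c = xorJ c (xorJ a b)"

lemma ham_plane: assumes "w \<in> ham" shows "\<exists>l s. w = plane l s"
proof -
  define l where "l = JJ ((o1 \<in> w) \<noteq> (o0 \<in> w)) ((o2 \<in> w) \<noteq> (o0 \<in> w)) ((o3 \<in> w) \<noteq> (o0 \<in> w))"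
  have "\<forall>j. j \<in> w \<longleftrightarrow> j \<in> plane l (o0 \<in> w)"
    using assms unfolding all_J ham_def plane_def l_def mem_Collect_eq J.sel by argo
  then show ?thesis by blast
qed

lemma ham_affine: assumes "w \<in> ham" shows "xor3 a b c \<in> w \<longleftrightarrow> ((a \<in> w) \<noteq> ((b \<in> w) \<noteq> (c \<in> w)))"
proof -
  obtain l s where w: "w = plane l s" using ham_plane[OF assms] by blast
  show ?thesis unfolding w plane_def xor3_def xorJ_def mem_Collect_eq J.sel by argo
qed

text \<open>Self-orthogonality of the code; it makes inner products on \<open>Alat\<close> divisible
  by \<open>pG\<close>.\<close>

lemma ham_even_Int: assumes "w \<in> ham" "w' \<in> ham" shows "even (card (w \<inter> w'))"
proof -
  have "\<not> odd (card (w \<inter> w'))"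
    using assms unfolding card_J sum_J parity8 ham_def mem_Collect_eq Int_iff
    by (cases "o0 \<in> w"; cases "o1 \<in> w"; cases "o2 \<in> w";
      cases "o3 \<in> w"; simp) ((argo+)?)
  then show ?thesis by simp
qed

text \<open>The affine map with prescribed values on the affine basis \<open>o0\<close>,
  \<open>o1\<close>, \<open>o2\<close>, \<open>o3\<close>; it is bijective when these values are
  affinely independent (\<open>indep\<close>).\<close>

fun aff :: "J \<Rightarrow> J \<Rightarrow> J \<Rightarrow> J \<Rightarrow> J \<Rightarrow> J" where
  "aff v0 v1 v2 v3 o0 = v0"
| "aff v0 v1 v2 v3 o1 = v1"
| "aff v0 v1 v2 v3 o2 = v2"
| "aff v0 v1 v2 v3 o3 = v3"
| "aff v0 v1 v2 v3 o12 = xor3 v0 v1 v2"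
| "aff v0 v1 v2 v3 o13 = xor3 v0 v1 v3"
| "aff v0 v1 v2 v3 o23 = xor3 v0 v2 v3"
| "aff v0 v1 v2 v3 o123 = xor3 v1 v2 v3"

definition indep :: "J \<Rightarrow> J \<Rightarrow> J \<Rightarrow> J \<Rightarrow> bool" where
  "indep v0 v1 v2 v3 \<longleftrightarrow> v0 \<noteq> v1 \<and> v0 \<noteq> v2 \<and> v1 \<noteq> v2 \<and> v3 \<notin> {v0, v1, v2, xor3 v0 v1 v2}"

lemma J_eq: "a = b \<longleftrightarrow> j1 a = j1 b \<and> j2 a = j2 b \<and> j3 a = j3 b"
  by (cases a; cases b) simp

lemma xor3_simps:
  "xor3 a b c = xor3 a b d \<longleftrightarrow> c = d" "xor3 a b c = xor3 a c d \<longleftrightarrow> b = d" "xor3 a b c = xor3 b c d \<longleftrightarrow> a = d"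
  "xor3 a b d = xor3 a c d \<longleftrightarrow> b = c" "xor3 a b d = xor3 b c d \<longleftrightarrow> a = c" "xor3 a c d = xor3 b c d \<longleftrightarrow> a = b"
  "xor3 a b c = a \<longleftrightarrow> b = c" "xor3 a b c = b \<longleftrightarrow> a = c" "xor3 a b c = c \<longleftrightarrow> a = b"
  unfolding xor3_def xorJ_def J_eq J.sel by argo+

lemma aff_bij: assumes "indep v0 v1 v2 v3" shows "bij (aff v0 v1 v2 v3)"
proof -
  have t: "xor3 v0 v1 v3 \<noteq> v2" "xor3 v0 v2 v3 \<noteq> v1" "xor3 v1 v2 v3 \<noteq> v0"
    "xor3 v0 v1 v2 \<noteq> v3" "v0 \<noteq> v1" "v0 \<noteq> v2" "v1 \<noteq> v2" "v3 \<noteq> v0" "v3 \<noteq> v1" "v3 \<noteq> v2"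
    using assms unfolding indep_def insert_iff empty_iff xor3_def xorJ_def J_eq J.sel by argo+
  have "\<forall>j k. aff v0 v1 v2 v3 j = aff v0 v1 v2 v3 k \<longrightarrow> j = k"
    unfolding all_J aff.simps using t t[symmetric]
    by (simp add: xor3_simps xor3_simps[THEN eq_commute[THEN trans]])
  then have "inj (aff v0 v1 v2 v3)" unfolding inj_def by blast
  then show ?thesis using finite_UNIV_inj_surj[of "aff v0 v1 v2 v3"] by (simp add: bij_def)
qed

lemma aff_ham: assumes "w \<in> ham" shows "aff v0 v1 v2 v3 -` w \<in> ham"
  unfolding ham_def mem_Collect_eq vimage_eq aff.simps ham_affine[OF assms] by argo

definition perm :: "(J \<Rightarrow> J) \<Rightarrow> gvec \<Rightarrow> gvec" where
  "perm f s = psi (\<lambda>j. Zc s (f j)) (Mc s) (Nc s)"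

lemma perm_psi: "perm f (psi z m n) = psi (\<lambda>j. z (f j)) m n"
  by (simp add: perm_def psi_coord_inv)

lemma psi_exhaust: obtains z m n where "s = psi z m n"
  using psi_coords[of s] by metis

lemma perm_isom: assumes "bij f" shows "isom (perm f)"
  unfolding isom_def
proof (intro conjI allI)
  fix x y c
  obtain z m n where x: "x = psi z m n" by (rule psi_exhaust)
  obtain z' m' n' where y: "y = psi z' m' n'" by (rule psi_exhaust)
  show "perm f (x + y) = perm f x + perm f y" unfolding x y psi_add perm_psi ..
  show "perm f (cscale c x) = cscale c (perm f x)" unfolding x psi_scale perm_psi ..
  have "ip (\<lambda>j. z (f j)) (\<lambda>j. z' (f j)) = ip z z'"
    unfolding ip_def using sum.reindex_bij_betw[of f UNIV UNIV "\<lambda>j. cnj (z j) * z' j"] assms by simp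
  then show "hform (perm f x) (perm f y) = hform x y" unfolding x y perm_psi hform_psi by simp
qed

lemma perm_bij: assumes "bij f" shows "bij (perm f)"
proof (rule o_bij)
  have "perm (inv_into UNIV f) (perm f s) = s \<and> perm f (perm (inv_into UNIV f) s) = s" for s
  proof -
    obtain z m n where "s = psi z m n" by (rule psi_exhaust)
    then show ?thesis using assms by (simp add: perm_psi bij_is_inj bij_is_surj surj_f_inv_f)
  qed
  then show "perm (inv_into UNIV f) \<circ> perm f = id" "perm f \<circ> perm (inv_into UNIV f) = id" by (auto simp: fun_eq_iff)
qed

lemma Z0_refl_roots_unit: assumes "k \<in> gauss" "gunit u" shows "psi (single j (u * pG)) 0 k \<in> refl_roots"
proof -
  have "psi (single j pG) 0 (cnj u * k) \<in> refl_roots" using assms by (intro Z0_refl_roots) auto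
  moreover have "orb (psi (single j pG) 0 (cnj u * k)) (psi (single j (u * pG)) 0 k)"
    using orb_unit[OF assms(2), of "psi (single j pG) 0 (cnj u * k)"] gunit_simps(1)[OF assms(2)]
    unfolding psi_scale by (simp add: single_def[abs_def] if_distrib flip: mult.assoc cong: if_cong)
  ultimately show ?thesis using refl_roots_orb by blast
qed

lemma gens_cases:
  assumes "r \<in> gens"
  obtains u j k where "gunit u" "k \<in> gauss" "r = psi (single j (u * pG)) 0 k"
  | w where "w \<in> ham" "r = psi (wvec w) 1 (nw w)"
proof -
  have "r = psi (single j pG) 0 0 \<Longrightarrow> ?thesis" "r = psi (single j (- pG)) 0 1 \<Longrightarrow> ?thesis" for j
    using that(1)[of 1 0 j] that(1)[of "-1" 1 j] by (auto simp: gunit_simps)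
  then show ?thesis using assms that(2) unfolding gens_def by blast
qed

lemma nw_gauss [simp]: "nw w \<in> gauss" by (auto simp: nw_def)

lemma wvec_Alat: "w \<in> ham \<Longrightarrow> wvec w \<in> Alat"
  by (auto simp: Alat_def wvec_def if_distrib[of divp] cong: if_cong)

lemma orb_perm:
  assumes "bij f" "\<And>w. w \<in> ham \<Longrightarrow> f -` w \<in> ham" "orb x y"
  shows "orb (perm f x) (perm f y)"
proof (rule orb_isom[OF perm_isom[OF assms(1)] perm_bij[OF assms(1)] _ assms(3)])
  fix r assume r: "r \<in> gens"
  then show "perm f r \<in> refl_roots"
  proof (cases rule: gens_cases)
    case (1 u j k)
    have "(\<lambda>i. single j (u * pG) (f i)) = single (inv_into UNIV f j) (u * pG)"
      using assms(1) by (auto simp: single_def fun_eq_iff bij_is_surj surj_f_inv_f bij_is_inj inv_f_eq)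
    then show ?thesis using 1 Z0_refl_roots_unit unfolding 1 perm_psi by simp
  next
    case (2 w)
    have "(\<lambda>i. wvec w (f i)) = wvec (f -` w)" by (auto simp: wvec_def)
    then have e: "perm f r = psi (wvec (f -` w)) 1 (nw w)" unfolding 2 perm_psi by simp
    have "hform (perm f r) (perm f r) = 2" using norm2[OF r] isomD(3)[OF perm_isom[OF assms(1)]] by simp
    then show ?thesis unfolding e using assms(2)[OF 2(1)] by (intro Z1_refl_roots wvec_Alat) auto
  qed
qed

text \<open>The Eichler transvection fixing \<open>null_vec\<close>. It is an isometry when
  \<open>k\<close> has real part half the norm of \<open>a\<close>; the imaginary part of
  \<open>k\<close> acts as a central translation.\<close>

definition eichler :: "(J \<Rightarrow> complex) \<Rightarrow> complex \<Rightarrow> gvec \<Rightarrow> gvec" where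
  "eichler a k s = psi (\<lambda>j. Zc s j + Mc s * a j) (Mc s) (Nc s - (ip a (Zc s) + Mc s * k) / cnj pG)"

lemma eichler_psi: "eichler a k (psi z m n) = psi (\<lambda>j. z j + m * a j) m (n - (ip a z + m * k) / cnj pG)"
  by (simp add: eichler_def psi_coord_inv)

lemma ip_simps:
  "ip a (\<lambda>j. z j + w j) = ip a z + ip a w" "ip a (\<lambda>j. c * z j) = c * ip a z"
  "ip (\<lambda>j. z j + w j) a = ip z a + ip w a" "ip (\<lambda>j. c * z j) a = cnj c * ip z a"
  "ip (\<lambda>j. - z j) a = - ip z a" "ip a (\<lambda>j. - z j) = - ip a z"
  by (simp_all add: ip_def sum.distrib sum_distrib_left algebra_simps sum_negf)

lemma ip_sym: "ip z a = cnj (ip a z)"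
  by (simp add: ip_def mult.commute)

lemma eichler_isom: assumes "ip a a = k + cnj k" shows "isom (eichler a k)"
  unfolding isom_def
proof (intro conjI allI)
  fix x y c
  obtain z m n where x: "x = psi z m n" by (rule psi_exhaust)
  obtain z' m' n' where y: "y = psi z' m' n'" by (rule psi_exhaust)
  show "eichler a k (x + y) = eichler a k x + eichler a k y" unfolding x y psi_add eichler_psi psi_inj ip_simps
    by (auto simp: algebra_simps add_divide_distrib)
  show "eichler a k (cscale c x) = cscale c (eichler a k x)" unfolding x psi_scale eichler_psi psi_inj ip_simps
    by (auto simp: algebra_simps add_divide_distrib)
  have "cnj pG \<noteq> 0" using pG_simps(3) by simp
  then have c: "cnj m * cnj pG * (n' - A / cnj pG) = cnj m * cnj pG * n' - cnj m * A"
     "cnj (n - A / cnj pG) * pG * m' = cnj n * pG * m' - cnj A * m'" for A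
    using pG_simps(3) by (simp_all add: algebra_simps)
  show "hform (eichler a k x) (eichler a k y) = hform x y" unfolding x y eichler_psi hform_psi c ip_simps assms
    using ip_sym[of z a] by (simp add: algebra_simps)
qed

lemma eichler_inv: assumes "ip a a = k + cnj k" shows "eichler (\<lambda>j. - a j) (cnj k) (eichler a k s) = s"
proof -
  obtain z m n where s: "s = psi z m n" by (rule psi_exhaust)
  show ?thesis unfolding s eichler_psi psi_inj ip_simps assms
    by (auto simp: algebra_simps add_divide_distrib diff_divide_distrib)
qed

lemma eichler_bij: assumes "ip a a = k + cnj k" shows "bij (eichler a k)"
proof (rule o_bij)
  show "eichler (\<lambda>j. - a j) (cnj k) \<circ> eichler a k = id" using eichler_inv[OF assms] by auto
  have "ip (\<lambda>j. - a j) (\<lambda>j. - a j) = cnj k + cnj (cnj k)" using assms by (simp add: ip_simps)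
  from eichler_inv[OF this] show "eichler a k \<circ> eichler (\<lambda>j. - a j) (cnj k) = id" by auto
qed

lemma ip_gauss: "(\<And>j. a j \<in> gauss) \<Longrightarrow> (\<And>j. b j \<in> gauss) \<Longrightarrow> ip a b \<in> gauss"
  unfolding ip_def sum_J by simp

lemma divp_ip:
  assumes "\<And>j. a j \<in> gauss" "\<And>j. b j \<in> gauss"
  shows "divp (ip a b) \<longleftrightarrow> even (card ({j. \<not> divp (a j)} \<inter> {j. \<not> divp (b j)}))"
proof -
  have "divp (\<Sum>j\<in>A. cnj (a j) * b j) \<longleftrightarrow> even (card (A \<inter> ({j. \<not> divp (a j)} \<inter> {j. \<not> divp (b j)})))" if "finite A" for A
    using that
  proof induction
    case (insert j A)
    have g: "(\<Sum>j\<in>A. cnj (a j) * b j) \<in> gauss" using insert(1) by induction (auto simp: assms)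
    show ?case
      using insert assms divp_cnj[of "a j"] g
      by (cases "j \<in> {j. \<not> divp (a j)} \<inter> {j. \<not> divp (b j)}") (auto simp add: divp_add divp_mult Int_insert_left)
  qed simp
  from this[of UNIV] show ?thesis by (simp add: ip_def)
qed

lemma Alat_add: assumes "a \<in> Alat" "b \<in> Alat" shows "(\<lambda>j. a j + b j) \<in> Alat"
proof -
  have "{j. \<not> divp (a j + b j)} = sdiff {j. \<not> divp (a j)} {j. \<not> divp (b j)}"
    using assms by (intro Set.set_eqI) (auto simp: Alat_def divp_add)
  then show ?thesis using assms ham_sdiff by (auto simp: Alat_def)
qed

lemma Alat_scale: assumes "a \<in> Alat" "c \<in> gauss" shows "(\<lambda>j. c * a j) \<in> Alat"
proof (cases "divp c")
  case True
  then show ?thesis using assms by (auto simp: Alat_def divp_mult ham_def)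
next
  case False
  then show ?thesis using assms by (auto simp: Alat_def divp_mult)
qed

lemma Alat_divp_ip: "a \<in> Alat \<Longrightarrow> b \<in> Alat \<Longrightarrow> divp (ip a b)"
  using ham_even_Int by (subst divp_ip) (auto simp: Alat_def)

lemma divp_div: "divp x \<Longrightarrow> x / cnj pG \<in> gauss"
proof -
  assume "divp x"
  then obtain q where q: "q \<in> gauss" "x = pG * q" unfolding divp_def by blast
  have "pG = \<i> * cnj pG" by (simp add: pG_def complex_eq_iff)
  then have "x = cnj pG * (\<i> * q)" using q(2) by (metis mult.assoc mult.commute)
  then have "x / cnj pG = \<i> * q" using pG_simps(3) by simp
  then show ?thesis using q(1) by simp
qed

text \<open>Divisibility by \<open>pG\<close> keeps the last coordinate Gaussian, so each generator
  goes to a root with \<open>m = 0\<close> or \<open>m = 1\<close> of a kind already known to lie in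
  \<open>refl_roots\<close>.\<close>

lemma orb_eichler:
  assumes "a \<in> Alat" "ip a a = k + cnj k" "divp k" "orb x y"
  shows "orb (eichler a k x) (eichler a k y)"
proof (rule orb_isom[OF eichler_isom[OF assms(2)] eichler_bij[OF assms(2)] _ assms(4)])
  have a: "\<And>j. a j \<in> gauss" using assms(1) by (auto simp: Alat_def)
  fix r assume r: "r \<in> gens"
  then show "eichler a k r \<in> refl_roots"
  proof (cases rule: gens_cases)
    case (1 u j l)
    have "divp (ip a (single j (u * pG)))"
      unfolding ip_sym[of a] ip_single using a[of j] 1(1) gunit_gauss[of u] by (simp add: divp_mult)
    then show ?thesis unfolding 1 eichler_psi using 1 by (simp add: Z0_refl_roots_unit divp_div)
  next
    case (2 w)
    note w = wvec_Alat[OF 2(1)]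
    have e: "eichler a k r = psi (\<lambda>j. wvec w j + a j) 1 (nw w - (ip a (wvec w) + k) / cnj pG)" unfolding 2 eichler_psi by simp
    have "divp (ip a (wvec w) + k)" using Alat_divp_ip[OF assms(1) w] assms(3) by (simp add: divp_add divp_gauss)
    moreover have "hform (eichler a k r) (eichler a k r) = 2" using norm2[OF r] isomD(3)[OF eichler_isom[OF assms(2)]] by simp
    ultimately show ?thesis unfolding e by (intro Z1_refl_roots Alat_add w assms(1)) (auto simp: divp_div)
  qed
qed

section \<open>Null vectors in the orbit\<close>

fun vec8 :: "'a \<Rightarrow> 'a \<Rightarrow> 'a \<Rightarrow> 'a \<Rightarrow> 'a \<Rightarrow> 'a \<Rightarrow> 'a \<Rightarrow> 'a \<Rightarrow> J \<Rightarrow> 'a" where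
  "vec8 a b c d e f g h o0 = a"
| "vec8 a b c d e f g h o1 = b"
| "vec8 a b c d e f g h o2 = c"
| "vec8 a b c d e f g h o3 = d"
| "vec8 a b c d e f g h o12 = e"
| "vec8 a b c d e f g h o13 = f"
| "vec8 a b c d e f g h o23 = g"
| "vec8 a b c d e f g h o123 = h"

lemma divp_floor: "z \<in> gauss \<Longrightarrow> divp z \<longleftrightarrow> even (\<lfloor>Re z\<rfloor> + \<lfloor>Im z\<rfloor>)"
  using divp_iff by (auto simp: gauss_iff)

lemma vec8_Alat: "vec8 a b c d e f g h \<in> Alat \<longleftrightarrow>
  a \<in> gauss \<and> b \<in> gauss \<and> c \<in> gauss \<and> d \<in> gauss \<and> e \<in> gauss \<and> f \<in> gauss \<and> g \<in> gauss \<and> h \<in> gauss \<and>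
  (divp a \<longleftrightarrow> (divp b \<longleftrightarrow> (divp c \<longleftrightarrow> divp e))) \<and> (divp a \<longleftrightarrow> (divp b \<longleftrightarrow> (divp d \<longleftrightarrow> divp f))) \<and>
  (divp a \<longleftrightarrow> (divp c \<longleftrightarrow> (divp d \<longleftrightarrow> divp g))) \<and> (divp b \<longleftrightarrow> (divp c \<longleftrightarrow> (divp d \<longleftrightarrow> divp h)))"
  unfolding Alat_def ham_def mem_Collect_eq all_J vec8.simps by argo

lemma ip_vec8: "ip (vec8 a b c d e f g h) (vec8 a' b' c' d' e' f' g' h') =
  cnj a * a' + cnj b * b' + cnj c * c' + cnj d * d' + cnj e * e' + cnj f * f' + cnj g * g' + cnj h * h'"
  unfolding ip_def sum_J vec8.simps ..

text \<open>One reflection in a root with second coordinate 1, so that the reflection coefficient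
  equals the drop \<open>m - m'\<close>. The conditions avoid division and can be checked by
  evaluation.\<close>

lemma step_vec8:
  assumes "r \<in> Alat" "k \<in> gauss" "ip r r + cnj pG * k + cnj k * pG = 2"
    "(1 - \<i>) * (ip r z + cnj pG * n + cnj k * pG * m) = 2 * (m - m')"
    "\<forall>j. z' j = z j - (m - m') * r j" "n' = n - (m - m') * k"
  shows "orb (psi z m n) (psi z' m' n')"
proof -
  have r: "psi r 1 k \<in> refl_roots" using assms(1-3) by (intro Z1_refl_roots) (simp_all add: hform_psi)
  have c: "(1 - \<i>) / 2 * (ip r z + cnj 1 * cnj pG * n + cnj k * pG * m) = m - m'"
    using assms(4) by simp
  have "rf (psi r 1 k) (psi z m n) = psi z' m' n'"
    unfolding rf_psi c Let_def psi_inj using assms(5,6) by (auto simp: fun_eq_iff)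
  then show ?thesis using orb_rf[OF r] by metis
qed

lemma end_vec8:
  assumes "a \<in> Alat" "n \<in> gauss" "ip a a + cnj u * cnj pG * n + cnj n * pG * u = 0" "gunit u"
  shows "orb (psi a u n) null_vec"
proof -
  have o: "orb (psi a u n) (cscale (cnj u) (psi a u n))" using assms(4) by (intro orb_unit gunit_simps)
  have e: "cscale (cnj u) (psi a u n) = psi (\<lambda>j. cnj u * a j) 1 (cnj u * n)"
    using gunit_simps(2)[OF assms(4)] by (simp add: psi_scale)
  have "hform (psi (\<lambda>j. cnj u * a j) 1 (cnj u * n)) (psi (\<lambda>j. cnj u * a j) 1 (cnj u * n)) = 0"
    using orb_norm[OF o] assms(3) unfolding e by (simp add: hform_psi)
  then have "orb (psi (\<lambda>j. cnj u * a j) 1 (cnj u * n)) null_vec"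
    using assms gunit_gauss[OF assms(4)] by (intro family_A Alat_scale) auto
  then show ?thesis using orb_trans[OF o] unfolding e by blast
qed

lemma floor_neg_1: "\<lfloor>- 1 :: real\<rfloor> = - 1"
  using floor_of_int[of "- 1"] by simp

lemmas cert_simps = floor_neg_1 vec8_Alat ip_vec8 divp_floor all_J gunit_def pG_def complex_eq_iff

text \<open>
  The chains of reflections in the \<open>cert\<close> lemmas come from a computer search; each lowers the
  coordinate \<open>m\<close> to a unit.
\<close>
lemma cert_P4N_a: "orb (psi (vec8 pG pG pG pG 0 0 0 0) 2 (- 2 * \<i>)) null_vec" (is "orb ?s _")
proof -
  have "orb ?s (psi (vec8 pG pG pG (1 - \<i>) 0 0 0 0) (1 - \<i>) (- 2 - 2 * \<i>))"
    by (intro step_vec8[of "vec8 0 0 0 pG 0 0 0 0" "1 - \<i>"]) (simp_all add: cert_simps)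
  also have "orb \<dots> (psi (vec8 1 1 1 (1 - \<i>) 1 0 0 0) (- \<i>) (- 3))"
    by (intro step_vec8[of "vec8 \<i> \<i> \<i> 0 (- 1) 0 0 0" "1 - 2 * \<i>"]) (simp_all add: cert_simps)
  also have "orb \<dots> null_vec"
    by (intro end_vec8) (simp_all add: cert_simps)
  finally show ?thesis .
qed

lemma cert_P4N_b: "orb (psi (vec8 pG pG pG pG 0 0 0 0) 2 (- 1 - \<i>)) null_vec" (is "orb ?s _")
proof -
  have "orb ?s (psi (vec8 pG pG pG pG 0 0 0 0) (1 - \<i>) (- 2 - 2 * \<i>))"
    by (intro step_vec8[of "vec8 0 0 0 0 0 0 0 0" "1"]) (simp_all add: cert_simps)
  also have "orb \<dots> (psi (vec8 1 1 1 2 1 0 0 0) (- \<i>) (- 3 + \<i>))"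
    by (intro step_vec8[of "vec8 \<i> \<i> \<i> (- 1 + \<i>) (- 1) 0 0 0" "1 - 3 * \<i>"]) (simp_all add: cert_simps)
  also have "orb \<dots> null_vec"
    by (intro end_vec8) (simp_all add: cert_simps)
  finally show ?thesis .
qed

lemma cert_P6_a: "orb (psi (vec8 0 0 pG pG pG pG pG pG) 2 (- 3 * \<i>)) null_vec" (is "orb ?s _")
proof -
  have "orb ?s (psi (vec8 0 0 pG (2 + \<i>) pG (2 + \<i>) (2 + \<i>) 1) (2 - \<i>) (- 2 - 4 * \<i>))"
    by (intro step_vec8[of "vec8 0 0 0 \<i> 0 \<i> \<i> 1" "1 - 2 * \<i>"]) (simp_all add: cert_simps)
  also have "orb \<dots> (psi (vec8 0 0 1 1 1 1 2 0) (1 - \<i>) (- 2 - \<i>))"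
    by (intro step_vec8[of "vec8 0 0 \<i> pG \<i> pG \<i> 1" "- 3 * \<i>"]) (simp_all add: cert_simps)
  also have "orb \<dots> (psi (vec8 0 0 1 1 1 1 (1 - \<i>) 0) (- \<i>) (- 3))"
    by (intro step_vec8[of "vec8 0 0 0 0 0 0 pG 0" "1 - \<i>"]) (simp_all add: cert_simps)
  also have "orb \<dots> null_vec"
    by (intro end_vec8) (simp_all add: cert_simps)
  finally show ?thesis .
qed

lemma cert_P6_b: "orb (psi (vec8 0 0 pG pG pG pG pG pG) 2 (- 1 - 2 * \<i>)) null_vec" (is "orb ?s _")
proof -
  have "orb ?s (psi (vec8 0 0 pG 3 pG 3 3 (- \<i>)) (1 - 2 * \<i>) (- 6 - 2 * \<i>))"
    by (intro step_vec8[of "vec8 0 0 0 \<i> 0 \<i> \<i> 1" "1 - 2 * \<i>"]) (simp_all add: cert_simps)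
  also have "orb \<dots> (psi (vec8 0 0 (- \<i>) (- \<i>) (- \<i>) (- \<i>) (2 - 2 * \<i>) (- 2)) (- 1 - \<i>) (- 3 + 4 * \<i>))"
    by (intro step_vec8[of "vec8 0 0 \<i> pG \<i> pG \<i> 1" "- 3 * \<i>"]) (simp_all add: cert_simps)
  also have "orb \<dots> (psi (vec8 0 0 (- \<i>) (- \<i>) (- \<i>) (- \<i>) (- 2 * \<i>) (- 1 + \<i>)) (- 1) (5 * \<i>))"
    by (intro step_vec8[of "vec8 0 0 0 0 0 0 (2 * \<i>) (1 - \<i>)" "1 - 3 * \<i>"]) (simp_all add: cert_simps)
  also have "orb \<dots> null_vec"
    by (intro end_vec8) (simp_all add: cert_simps)
  finally show ?thesis .
qed

lemma cert_M2_a: "orb (psi (vec8 pG pG 0 1 0 1 1 1) 2 (- 2 * \<i>)) null_vec" (is "orb ?s _")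
proof -
  have "orb ?s (psi (vec8 2 2 0 1 0 1 (- \<i>) (- \<i>)) (1 - \<i>) (- 3 - \<i>))"
    by (intro step_vec8[of "vec8 \<i> \<i> 0 0 0 0 1 1" "1 - 2 * \<i>"]) (simp_all add: cert_simps)
  also have "orb \<dots> (psi (vec8 (1 - \<i>) (1 - \<i>) 0 1 0 1 (- \<i>) (- 1)) (- \<i>) (- 3 + \<i>))"
    by (intro step_vec8[of "vec8 pG pG 0 0 0 0 0 (1 - \<i>)" "- 2 * \<i>"]) (simp_all add: cert_simps)
  also have "orb \<dots> null_vec"
    by (intro end_vec8) (simp_all add: cert_simps)
  finally show ?thesis .
qed

lemma cert_M2_b: "orb (psi (vec8 pG pG 0 1 0 1 1 1) 2 (- 1 - \<i>)) null_vec" (is "orb ?s _")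
proof -
  have "orb ?s (psi (vec8 2 0 0 1 0 1 (- \<i>) (- \<i>)) (1 - \<i>) (- 2))"
    by (intro step_vec8[of "vec8 \<i> 1 0 0 0 0 1 1" "- \<i>"]) (simp_all add: cert_simps)
  also have "orb \<dots> (psi (vec8 (1 - \<i>) 0 0 1 0 1 (- \<i>) (- 1)) (- \<i>) (- 2 + \<i>))"
    by (intro step_vec8[of "vec8 pG 0 0 0 0 0 0 (1 - \<i>)" "- \<i>"]) (simp_all add: cert_simps)
  also have "orb \<dots> null_vec"
    by (intro end_vec8) (simp_all add: cert_simps)
  finally show ?thesis .
qed

lemma cert_M0_a: "orb (psi (vec8 0 0 0 1 0 1 1 1) 2 (- \<i>)) null_vec" (is "orb ?s _")
proof -
  have "orb ?s (psi (vec8 0 0 0 0 0 0 0 0) 1 0)"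
    by (intro step_vec8[of "vec8 0 0 0 1 0 1 1 1" "- \<i>"]) (simp_all add: cert_simps)
  also have "orb \<dots> null_vec"
    by (intro end_vec8) (simp_all add: cert_simps)
  finally show ?thesis .
qed

lemma cert_M0_b: "orb (psi (vec8 0 0 0 1 0 1 1 1) 2 (- 1)) null_vec" (is "orb ?s _")
proof -
  have "orb ?s (psi (vec8 0 0 0 (- 1 - \<i>) 0 (- 1 - \<i>) (- 1 - \<i>) (- 1 - \<i>)) (- \<i>) (- 2 + 2 * \<i>))"
    by (intro step_vec8[of "vec8 0 0 0 1 0 1 1 1" "- \<i>"]) (simp_all add: cert_simps)
  also have "orb \<dots> null_vec"
    by (intro end_vec8) (simp_all add: cert_simps)
  finally show ?thesis .
qed

section \<open>Normal forms of the null vectors with \<open>q = 2\<close>\<close>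

text \<open>Taking preimages under \<open>f\<close> is injective on the finite set
  \<open>ham\<close>, hence permutes it.\<close>

lemma inv_ham:
  assumes "bij f" "\<And>w. w \<in> ham \<Longrightarrow> f -` w \<in> ham" "w \<in> ham"
  shows "inv_into UNIV f -` w \<in> ham"
proof -
  have "inj_on (\<lambda>w. f -` w) ham" using assms(1) by (intro inj_onI) (metis bij_is_surj surj_image_vimage_eq)
  then have "(\<lambda>w. f -` w) ` ham = ham" using assms(2) by (intro endo_inj_surj) auto
  then obtain w' where w': "w' \<in> ham" "w = f -` w'" using assms(3) by blast
  have "inv_into UNIV f -` w = w'"
    using assms(1) unfolding w'(2) by (auto simp: bij_is_surj surj_f_inv_f)
  then show ?thesis using w'(1) by simp
qed

lemma orb_perm_null_vec:
  assumes "bij f" "\<And>w. w \<in> ham \<Longrightarrow> f -` w \<in> ham" "orb (psi (\<lambda>j. z (f j)) m n) null_vec"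
  shows "orb (psi z m n) null_vec"
proof -
  let ?g = "inv_into UNIV f"
  have "orb (perm ?g (psi (\<lambda>j. z (f j)) m n)) (perm ?g null_vec)"
    using assms by (intro orb_perm inv_ham bij_imp_bij_inv)
  then show ?thesis using assms(1) by (simp add: perm_psi null_vec_psi bij_is_surj surj_f_inv_f)
qed

lemma orb_eichler_null_vec:
  assumes "a \<in> Alat" "ip a a = k + cnj k" "divp k" "orb (eichler a k x) null_vec"
  shows "orb x null_vec"
proof -
  have "divp (cnj k)" using assms(3) divp_cnj divp_gauss by blast
  moreover have "(\<lambda>j. - a j) \<in> Alat" using Alat_scale[OF assms(1), of "-1"] by simp
  ultimately have "orb (eichler (\<lambda>j. - a j) (cnj k) (eichler a k x)) (eichler (\<lambda>j. - a j) (cnj k) null_vec)"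
    using assms(2,4) by (intro orb_eichler) (auto simp: ip_simps)
  moreover have "eichler (\<lambda>j. - a j) (cnj k) null_vec = null_vec"
    unfolding null_vec_psi eichler_psi psi_inj by (simp add: ip_def)
  ultimately show ?thesis using eichler_inv[OF assms(2)] by simp
qed

text \<open>\<open>2 * pG\<close> is associate to \<open>pG^3\<close>, and the four units represent
  all invertible residues modulo \<open>pG^3\<close>.\<close>

lemma odd_decomp:
  assumes "x \<in> gauss" "\<not> divp x" shows "\<exists>u g. gunit u \<and> g \<in> gauss \<and> x = u + pG * g * 2"
proof -
  obtain a b where x: "x = of_int a + \<i> * of_int b" using assms(1) unfolding gauss_iff by blast
  then have o: "odd (a + b)" using assms(2) divp_iff by simp
  have c: "?thesis" if "gunit u" "x = u + 2 * (of_int p + \<i> * of_int q)" "even (p + q)" for u p q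
  proof -
    have "divp (of_int p + \<i> * of_int q)" using that(3) divp_iff by blast
    then obtain g where "g \<in> gauss" "of_int p + \<i> * of_int q = pG * g" unfolding divp_def by blast
    then show ?thesis using that(1,2) by (intro exI[of _ u] exI[of _ g]) simp
  qed
  show ?thesis
  proof (cases "odd a")
    case True
    then obtain p q where "a = 2 * p + 1" "b = 2 * q" using o by (metis even_add evenE oddE)
    then show ?thesis using c[of 1 p q] c[of "-1" "p + 1" q] x by (cases "even (p + q)") (auto simp: gunit_simps algebra_simps)
  next
    case False
    then obtain p q where "a = 2 * p" "b = 2 * q + 1" using o by (metis even_add evenE oddE)
    then show ?thesis using c[of \<i> p q] c[of "- \<i>" p "q + 1"] x by (cases "even (p + q)") (auto simp: gunit_simps algebra_simps)
  qed
qed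

text \<open>Up to units and modulo \<open>2 * pG\<close> the vector \<open>l\<close> is given by
  \<open>H\<close>, \<open>S\<close> and one further bit for each remaining coordinate: the parity
  of \<open>l j / 2\<close>.\<close>

locale class_two =
  fixes l :: "J \<Rightarrow> complex" and n :: complex and H S :: "J set"
  assumes null: "hform (psi l 2 n) (psi l 2 n) = 0" and n: "n \<in> gauss"
    and hole: "\<And>j. j \<in> H \<Longrightarrow> \<exists>g\<in>gauss. \<not> divp g \<and> l j = pG * g"
    and mid: "\<And>j. j \<in> S \<Longrightarrow> l j \<in> gauss \<and> \<not> divp (l j)"
    and other: "\<And>j. j \<notin> H \<Longrightarrow> j \<notin> S \<Longrightarrow> \<exists>g\<in>gauss. l j = 2 * g"
    and disj: "H \<inter> S = {}" and ham: "S \<in> ham"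
begin

lemma l_Alat: "l \<in> Alat"
proof -
  have g: "l j \<in> gauss \<and> (\<not> divp (l j) \<longleftrightarrow> j \<in> S)" for j
  proof -
    consider "j \<in> S" "j \<notin> H" | "j \<in> H" "j \<notin> S" | "j \<notin> S" "j \<notin> H" using disj by blast
    then show ?thesis
      by cases (use hole[of j] mid[of j] other[of j] in \<open>auto simp: divp_mult\<close>)
  qed
  then have "{j. \<not> divp (l j)} = S" by auto
  then show ?thesis using g ham by (auto simp: Alat_def)
qed

text \<open>The permutation \<open>f\<close> puts \<open>H\<close> and \<open>S\<close> into
  standard position. The transvection by the indicator of \<open>w\<close> adds 2 on
  \<open>w\<close> and so makes the halves \<open>l j / 2\<close> even; translations then reduce
  \<open>z\<close> to \<open>c\<close>. The null condition fixes \<open>n\<close> up to multiples of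
  \<open>\<i> * pG\<close>, and central translations realize the even ones, which leaves two classes
  and hence two certificates.\<close>

lemma core:
  assumes v: "indep v0 v1 v2 v3" and f: "f = aff v0 v1 v2 v3" and w: "w \<in> ham"
    and word: "\<And>j. f j \<notin> H \<Longrightarrow> f j \<notin> S \<Longrightarrow> j \<in> w \<longleftrightarrow> \<not> divp (l (f j) / 2)"
    and c: "\<And>j. c j = (if f j \<in> H then pG else if f j \<in> S then 1 else 0)"
    and cert: "orb (psi c 2 n0) null_vec" "orb (psi c 2 (n0 + \<i> * pG)) null_vec" "n0 \<in> gauss"
  shows "orb (psi l 2 n) null_vec"
proof -
  have f': "bij f" "\<And>w. w \<in> ham \<Longrightarrow> f -` w \<in> ham" unfolding f using aff_bij[OF v] aff_ham by auto
  define a where "a j = (if j \<in> w then 1 else 0 :: complex)" for j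
  have aA: "a \<in> Alat" using w by (auto simp: Alat_def a_def if_distrib[of divp] cong: if_cong)
  have "ip a a = of_nat (card w)"
    by (simp add: ip_def a_def if_distrib[of cnj] if_distrib[of "\<lambda>x. x * _"] sum.If_cases cong: if_cong)
  moreover obtain h where h: "card w = 2 * h" using ham_even_Int[OF w w] by auto
  \<comment> \<open>The factor \<open>pG\<close> keeps the real part \<open>h\<close>, half the norm
    of \<open>a\<close>, and provides the divisibility that \<open>orb_eichler\<close>
    requires.\<close>
  define k where "k = pG * of_nat h"
  have "of_nat h \<in> gauss" using gauss_intros(5)[of "int h"] by simp
  then have k: "divp k" "k \<in> gauss" by (auto simp: k_def divp_mult)
  ultimately have kk: "ip a a = k + cnj k" using h by (simp add: k_def pG_def complex_eq_iff)
  let ?l = "\<lambda>j. l (f j)"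
  have lf: "?l \<in> Alat" using l_Alat f'(2)[of "{j. \<not> divp (l j)}"] by (auto simp: Alat_def vimage_def)
  define n1 where "n1 = n - (ip a ?l + 2 * k) / cnj pG"
  have "divp (ip a ?l + 2 * k)"
    using Alat_divp_ip[OF aA lf] k by (simp add: divp_add divp_mult divp_gauss)
  then have n1: "n1 \<in> gauss" using n divp_div by (auto simp: n1_def)
  define z where "z j = l (f j) + 2 * a j" for j
  have zg: "z j \<in> gauss" for j using lf by (auto simp: z_def a_def Alat_def)
  have "\<exists>n'\<in>gauss. orb (psi z 2 n1) (psi c 2 n')"
  proof (rule orb_coords)
    fix j
    consider (h) "f j \<in> H" | (s) "f j \<notin> H" "f j \<in> S" | (o) "f j \<notin> H" "f j \<notin> S" by blast
    then show "\<exists>u g. gunit u \<and> g \<in> gauss \<and> z j = u * c j + pG * g * 2"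
    proof cases
      case h
      then obtain g where g: "g \<in> gauss" "\<not> divp g" "l (f j) = pG * g" using hole by blast
      have e: "z j = pG * (g + cnj pG * a j)"
        unfolding z_def g(3) distrib_left using pG_simps(1) by (metis mult.assoc)
      have "a j \<in> gauss" by (simp add: a_def)
      then have "g + cnj pG * a j \<in> gauss" "\<not> divp (g + cnj pG * a j)" using g by (auto simp: divp_add divp_mult)
      from odd_decomp[OF this] obtain u d where "gunit u" "d \<in> gauss" "g + cnj pG * a j = u + pG * d * 2" by blast
      then show ?thesis using c[of j] h unfolding e
        by (intro exI[of _ u] exI[of _ "pG * d"]) (auto simp: algebra_simps)
    next
      case s
      have "z j \<in> gauss" "\<not> divp (z j)" using mid[OF s(2)] zg by (auto simp: z_def a_def divp_add)
      from odd_decomp[OF this] show ?thesis using c[of j] s by simp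
    next
      case o
      then obtain g where g: "g \<in> gauss" "l (f j) = 2 * g" using other by blast
      then have "divp (g + a j)" using word[OF o] by (auto simp: a_def divp_add)
      then obtain d where d: "d \<in> gauss" "g + a j = pG * d" unfolding divp_def by blast
      have "z j = 2 * (g + a j)" by (simp add: z_def g(2))
      then have "z j = 1 * c j + pG * d * 2" using c[of j] o d(2) by simp
      then show ?thesis using d(1) gunit_simps(5) by blast
    qed
  qed (use zg n1 in auto)
  then obtain n' where n': "n' \<in> gauss" "orb (psi z 2 n1) (psi c 2 n')" by blast
  have t: "eichler a k (psi ?l 2 n) = psi z 2 n1" unfolding eichler_psi z_def[abs_def] n1_def ..
  have "hform (psi ?l 2 n) (psi ?l 2 n) = 0"
    using isomD(3)[OF perm_isom[OF f'(1)], of "psi l 2 n" "psi l 2 n"] null unfolding perm_psi by simp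
  then have "hform (psi z 2 n1) (psi z 2 n1) = 0"
    unfolding t[symmetric] isomD(3)[OF eichler_isom[OF kk]] .
  then have 1: "hform (psi c 2 n') (psi c 2 n') = 0" using orb_norm[OF n'(2)] by simp
  have 2: "hform (psi c 2 n0) (psi c 2 n0) = 0" using orb_norm[OF cert(1)] by (simp add: nu_gram(1))
  have "2 * (cnj pG * (n' - n0) + cnj (n' - n0) * pG) = hform (psi c 2 n') (psi c 2 n') - hform (psi c 2 n0) (psi c 2 n0)"
    unfolding hform_psi by (simp add: algebra_simps)
  then have "cnj pG * (n' - n0) + cnj (n' - n0) * pG = 0" unfolding 1 2 diff_self mult_eq_0_iff by simp
  then obtain d where d: "n' - n0 = of_int d * \<i> * pG" using central_diff[of "n' - n0"] n'(1) cert(3) by blast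
  have "orb (psi c 2 n') null_vec"
  proof (cases "even d")
    case True
    then obtain e where "d = 2 * e" by blast
    then have "n' = n0 + of_int e * \<i> * pG * 2" using d by (simp add: diff_eq_eq)
    then show ?thesis using orb_trans[OF orb_sym[OF orb_central[of c 2 n0 e]] cert(1)] by simp
  next
    case False
    then obtain e where "d = 2 * e + 1" by (elim oddE)
    then have "n' = (n0 + \<i> * pG) + of_int e * \<i> * pG * 2" using d by (simp add: diff_eq_eq algebra_simps)
    then show ?thesis using orb_trans[OF orb_sym[OF orb_central[of c 2 "n0 + \<i> * pG" e]] cert(2)] by simp
  qed
  then have "orb (eichler a k (psi ?l 2 n)) null_vec" unfolding t using orb_trans[OF n'(2)] by blast
  then have "orb (psi ?l 2 n) null_vec" by (rule orb_eichler_null_vec[OF aA kk k(1)])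
  then show ?thesis using orb_perm_null_vec[of f l 2 n] f' by blast
qed

end

lemma indep_ham:
  assumes "a \<noteq> b" "a \<noteq> c" "b \<noteq> c" "d \<notin> {a, b, c}" "{a, b, c, d} \<notin> ham"
  shows "indep a b c d"
  using assms tetrad_through[of a b c] unfolding indep_def xor3_def by auto

lemma tetrad_eq:
  assumes "Q \<in> ham" "card Q = 4" "a \<in> Q" "b \<in> Q" "c \<in> Q" "a \<noteq> b" "a \<noteq> c" "b \<noteq> c"
  shows "Q = {a, b, c, xor3 a b c}"
proof -
  have "card {a, b, c, xor3 a b c} = 4" using tetrad_through[of a b c] assms unfolding xor3_def by auto
  moreover have "{a, b, c, xor3 a b c} \<subseteq> Q" using assms ham_affine[OF assms(1), of a b c] by auto
  ultimately show ?thesis using assms(2) by (metis card_subset_eq finite)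
qed

text \<open>Interpolation: the code word with prescribed values at \<open>o0\<close>,
  \<open>o1\<close>, \<open>o2\<close>, \<open>o3\<close>.\<close>

definition word_with :: "bool \<Rightarrow> bool \<Rightarrow> bool \<Rightarrow> bool \<Rightarrow> J set" where
  "word_with a b c d = {j. vec8 a b c d (a \<noteq> (b \<noteq> c)) (a \<noteq> (b \<noteq> d)) (a \<noteq> (c \<noteq> d)) (b \<noteq> (c \<noteq> d)) j}"

lemma word_with_ham: "word_with a b c d \<in> ham"
  unfolding word_with_def ham_def mem_Collect_eq vec8.simps by argo

lemma word_with_mem: "j \<in> word_with a b c d \<longleftrightarrow> vec8 a b c d (a \<noteq> (b \<noteq> c)) (a \<noteq> (b \<noteq> d)) (a \<noteq> (c \<noteq> d)) (b \<noteq> (c \<noteq> d)) j"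
  by (simp add: word_with_def)

lemma cert_shift: "- 2 * \<i> + \<i> * pG = - 1 - \<i>" "- 3 * \<i> + \<i> * pG = - 1 - 2 * \<i>" "- \<i> + \<i> * pG = - 1"
  by (simp_all add: pG_def complex_eq_iff)

context class_two begin

abbreviation "oddG f j \<equiv> \<not> divp (l (f j) / 2)"

lemma class_P4N:
  assumes "S = {}" "card H = 4" "H \<notin> ham" shows "orb (psi l 2 n) null_vec"
proof -
  obtain v0 v1 v2 v3 where H: "H = {v0, v1, v2, v3}" "v0 \<noteq> v1" "v0 \<noteq> v2" "v1 \<noteq> v2" "v3 \<notin> {v0, v1, v2}"
    using assms(2) by (auto simp: card_Suc_eq numeral_eq_Suc)
  have v: "indep v0 v1 v2 v3" using H assms(3) by (intro indep_ham) auto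
  define f where "f = aff v0 v1 v2 v3"
  have "H = f ` {o0, o1, o2, o3}" unfolding f_def H(1) by auto
  then have mem: "f j \<in> H \<longleftrightarrow> j \<in> {o0, o1, o2, o3}" for j
    using aff_bij[OF v] unfolding f_def[symmetric] by (metis bij_is_inj inj_image_mem_iff)
  let ?e = "oddG f o12" and ?f = "oddG f o13" and ?g = "oddG f o23" and ?h = "oddG f o123"
  \<comment> \<open>The parities are prescribed at the other four points; these arguments solve the
    four checks for the values at \<open>o0\<close> to \<open>o3\<close>.\<close>
  let ?w = "word_with (?e \<noteq> (?f \<noteq> ?g)) (?e \<noteq> (?f \<noteq> ?h)) (?e \<noteq> (?g \<noteq> ?h)) (?f \<noteq> (?g \<noteq> ?h))"
  have "\<forall>j. f j \<notin> H \<longrightarrow> (j \<in> ?w \<longleftrightarrow> oddG f j)" unfolding all_J word_with_mem vec8.simps mem by simp argo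
  moreover have "\<forall>j. vec8 pG pG pG pG 0 0 0 0 j = (if f j \<in> H then pG else if f j \<in> S then 1 else 0)"
    unfolding all_J mem assms(1) by simp
  ultimately show ?thesis
    using core[OF v f_def word_with_ham[of "?e \<noteq> (?f \<noteq> ?g)" "?e \<noteq> (?f \<noteq> ?h)" "?e \<noteq> (?g \<noteq> ?h)" "?f \<noteq> (?g \<noteq> ?h)"],
        of "vec8 pG pG pG pG 0 0 0 0" "- 2 * \<i>"] cert_P4N_a cert_P4N_b unfolding cert_shift by simp
qed

lemma class_P6:
  assumes "S = {}" "card H = 6" shows "orb (psi l 2 n) null_vec"
proof -
  have "card (- H) = 2" using assms(2) card_compl_J[of H] by simp
  then obtain v0 v1 where "- H = {v0, v1}" and v01: "v0 \<noteq> v1" by (auto simp: card_2_iff)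
  then have H: "H = - {v0, v1}" by blast
  obtain v2 where v2: "v2 \<notin> {v0, v1}" using v01 ex_outside[of "{v0, v1}"] by auto
  have "card {v0, v1, v2, xor3 v0 v1 v2} = 4" using tetrad_through[OF v01 v2] by (simp add: xor3_def)
  then obtain v3 where "v3 \<notin> {v0, v1, v2, xor3 v0 v1 v2}"
    using ex_outside[of "{v0, v1, v2, xor3 v0 v1 v2}"] by auto
  then have v: "indep v0 v1 v2 v3" using v01 v2 by (auto simp: indep_def)
  define f where "f = aff v0 v1 v2 v3"
  have "- H = f ` {o0, o1}" unfolding f_def H(1) by auto
  then have "f j \<in> - H \<longleftrightarrow> j \<in> {o0, o1}" for j
    using aff_bij[OF v] unfolding f_def[symmetric] by (metis bij_is_inj inj_image_mem_iff)
  then have mem: "f j \<in> H \<longleftrightarrow> j \<notin> {o0, o1}" for j by blast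
  let ?w = "word_with (oddG f o0) (oddG f o1) False False"
  have "\<forall>j. f j \<notin> H \<longrightarrow> (j \<in> ?w \<longleftrightarrow> oddG f j)" unfolding all_J word_with_mem vec8.simps mem by simp
  moreover have "\<forall>j. vec8 0 0 pG pG pG pG pG pG j = (if f j \<in> H then pG else if f j \<in> S then 1 else 0)"
    unfolding all_J mem assms(1) by simp
  ultimately show ?thesis
    using core[OF v f_def word_with_ham[of "oddG f o0" "oddG f o1" False False],
        of "vec8 0 0 pG pG pG pG pG pG" "- 3 * \<i>"] cert_P6_a cert_P6_b unfolding cert_shift by simp
qed

lemma class_M2:
  assumes "Q \<in> ham" "card Q = 4" "S = - Q" "H \<subseteq> Q" "card H = 2" shows "orb (psi l 2 n) null_vec"
proof -
  obtain v0 v1 where H: "H = {v0, v1}" "v0 \<noteq> v1" using assms(5) by (auto simp: card_2_iff)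
  have "Q \<noteq> H" using assms(2,5) by auto
  then obtain v2 where v2: "v2 \<in> Q" "v2 \<notin> H" using assms(4) by blast
  have Q: "Q = {v0, v1, v2, xor3 v0 v1 v2}" using H v2 assms(4) by (intro tetrad_eq assms(1,2)) auto
  obtain v3 where "v3 \<notin> Q" using assms(2) ex_outside[of Q] by auto
  then have v: "indep v0 v1 v2 v3" using H v2 unfolding Q by (auto simp: indep_def)
  define f where "f = aff v0 v1 v2 v3"
  have "H = f ` {o0, o1}" "Q = f ` {o0, o1, o2, o12}" unfolding f_def Q H(1) by auto
  then have mem: "f j \<in> H \<longleftrightarrow> j \<in> {o0, o1}" "f j \<in> Q \<longleftrightarrow> j \<in> {o0, o1, o2, o12}" for j
    using aff_bij[OF v] unfolding f_def[symmetric] by (metis bij_is_inj inj_image_mem_iff)+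
  \<comment> \<open>Parities are prescribed at \<open>o2\<close> and \<open>o12\<close> only; the
    value at \<open>o0\<close> is chosen to give the right sum at \<open>o12\<close>.\<close>
  let ?w = "word_with (oddG f o2 \<noteq> oddG f o12) False (oddG f o2) False"
  have "\<forall>j. f j \<notin> H \<longrightarrow> f j \<notin> - Q \<longrightarrow> (j \<in> ?w \<longleftrightarrow> oddG f j)" unfolding all_J word_with_mem vec8.simps Compl_iff mem by simp argo
  moreover have "\<forall>j. vec8 pG pG 0 1 0 1 1 1 j = (if f j \<in> H then pG else if f j \<in> - Q then 1 else 0)"
    unfolding all_J Compl_iff mem by simp
  ultimately show ?thesis
    using core[OF v f_def word_with_ham[of "oddG f o2 \<noteq> oddG f o12" False "oddG f o2" False],
        of "vec8 pG pG 0 1 0 1 1 1" "- 2 * \<i>"] cert_M2_a cert_M2_b assms(3) unfolding cert_shift by simp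
qed

text \<open>An affine function has even sum over a tetrad, so parities given on all of
  \<open>Q\<close> can be interpolated exactly because of the last assumption.\<close>

lemma class_M0:
  assumes "Q \<in> ham" "card Q = 4" "S = - Q" "H = {}" "even (card (Q \<inter> {j. \<not> divp (l j / 2)}))"
  shows "orb (psi l 2 n) null_vec"
proof -
  obtain v0 v1 v2 where v012: "v0 \<in> Q" "v1 \<in> Q" "v2 \<in> Q" "v0 \<noteq> v1" "v0 \<noteq> v2" "v1 \<noteq> v2"
    using assms(2) by (auto simp: card_Suc_eq numeral_eq_Suc)
  then have Q: "Q = {v0, v1, v2, xor3 v0 v1 v2}" by (intro tetrad_eq assms(1,2))
  obtain v3 where "v3 \<notin> Q" using assms(2) ex_outside[of Q] by auto
  then have v: "indep v0 v1 v2 v3" using v012 unfolding Q by (auto simp: indep_def)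
  define f where "f = aff v0 v1 v2 v3"
  have "Q = f ` {o0, o1, o2, o12}" unfolding f_def Q by auto
  then have mem: "f j \<in> Q \<longleftrightarrow> j \<in> {o0, o1, o2, o12}" for j
    using aff_bij[OF v] unfolding f_def[symmetric] by (metis bij_is_inj inj_image_mem_iff)
  have "v0 \<noteq> xor3 v0 v1 v2" "v1 \<noteq> xor3 v0 v1 v2" "v2 \<noteq> xor3 v0 v1 v2"
    using v012 by (simp_all add: xor3_simps[THEN eq_commute[THEN trans]])
  then have "card (Q \<inter> A) = of_bool (v0 \<in> A) + of_bool (v1 \<in> A) + of_bool (v2 \<in> A) + of_bool (xor3 v0 v1 v2 \<in> A)" for A
    unfolding Q using v012 by (simp add: Int_insert_left)
  then have e: "oddG f o12 \<longleftrightarrow> (oddG f o0 \<noteq> (oddG f o1 \<noteq> oddG f o2))"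
    using assms(5) unfolding f_def aff.simps
    by (cases "divp (l v0 / 2)"; cases "divp (l v1 / 2)"; cases "divp (l v2 / 2)"; cases "divp (l (xor3 v0 v1 v2) / 2)") simp_all
  let ?w = "word_with (oddG f o0) (oddG f o1) (oddG f o2) False"
  have "\<forall>j. f j \<notin> - Q \<longrightarrow> (j \<in> ?w \<longleftrightarrow> oddG f j)" unfolding all_J word_with_mem vec8.simps Compl_iff mem e by simp
  moreover have "\<forall>j. vec8 0 0 0 1 0 1 1 1 j = (if f j \<in> H then pG else if f j \<in> - Q then 1 else 0)"
    unfolding all_J Compl_iff mem assms(4) by simp
  ultimately show ?thesis
    using core[OF v f_def word_with_ham[of "oddG f o0" "oddG f o1" "oddG f o2" False],
        of "vec8 0 0 0 1 0 1 1 1" "- \<i>"] cert_M0_a cert_M0_b assms(3) unfolding cert_shift by simp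
qed

end

section \<open>Descent\<close>

lemma nearest_odd: "\<exists>a b :: int. odd (a + b) \<and> \<bar>p - of_int a\<bar> + \<bar>q - of_int b\<bar> \<le> (1::real)"
proof -
  \<comment> \<open>The diamonds of radius 1 around the odd Gaussian integers tile the plane;
    \<open>u\<close>, \<open>v\<close> number them in the diagonal directions.\<close>
  define u v where "u = \<lfloor>(p + q) / 2\<rfloor>" and "v = \<lfloor>(p - q) / 2\<rfloor>"
  have "of_int u \<le> (p + q) / 2" "(p + q) / 2 < of_int u + 1" "of_int v \<le> (p - q) / 2" "(p - q) / 2 < of_int v + 1"
    unfolding u_def v_def by linarith+
  then have "\<bar>p - of_int (u + v + 1)\<bar> + \<bar>q - of_int (u - v)\<bar> \<le> 1" by simp
  moreover have "odd (u + v + 1 + (u - v))" by simp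
  ultimately show ?thesis by blast
qed

text \<open>The diamond around the odd number \<open>c\<close> has two opposite corners of the form
  \<open>pG * h\<close> and two divisible by 2. The corners \<open>2 * g\<close> and
  \<open>2 * g'\<close> are opposite, so \<open>g\<close> and \<open>g'\<close> differ by a unit;
  replacing \<open>g\<close> by \<open>g'\<close> toggles membership in \<open>w\<close> and
  reverses the sign of \<open>y\<close>.\<close>

definition localized :: "complex \<Rightarrow> complex \<Rightarrow> complex \<Rightarrow> complex \<Rightarrow> complex \<Rightarrow> real \<Rightarrow> real \<Rightarrow> bool" where
  "localized \<zeta> c h g g' x y \<longleftrightarrow> c \<in> gauss \<and> \<not> divp c \<and> h \<in> gauss \<and> \<not> divp h \<and> g \<in> gauss \<and> g' \<in> gauss \<and>
    (divp g' \<longleftrightarrow> \<not> divp g) \<and> 0 \<le> x \<and> 0 \<le> y \<and> x + y \<le> 1 \<and>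
    (cmod (\<zeta> - c))\<^sup>2 = x\<^sup>2 + y\<^sup>2 \<and> (cmod (\<zeta> - pG * h))\<^sup>2 = 1 + (x\<^sup>2 + y\<^sup>2) - 2 * x \<and>
    (cmod (\<zeta> - 2 * g))\<^sup>2 = 1 + (x\<^sup>2 + y\<^sup>2) - 2 * y \<and> (cmod (\<zeta> - 2 * g'))\<^sup>2 = 1 + (x\<^sup>2 + y\<^sup>2) + 2 * y"

lemma ex_localized: "\<exists>c h g g' x y. localized \<zeta> c h g g' x y"
proof -
  obtain a b where ab: "odd (a + b)" "\<bar>Re \<zeta> - of_int a\<bar> + \<bar>Im \<zeta> - of_int b\<bar> \<le> 1" using nearest_odd by blast
  define P where "P = Re \<zeta> - of_int a"
  define Q where "Q = Im \<zeta> - of_int b"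
  obtain \<sigma> \<tau> :: int where st: "\<sigma> = 1 \<or> \<sigma> = -1" "\<tau> = 1 \<or> \<tau> = -1" "of_int \<sigma> * P = \<bar>P\<bar>" "of_int \<tau> * Q = \<bar>Q\<bar>"
  proof
    show "(if P \<ge> 0 then 1 else -1) = (1::int) \<or> (if P \<ge> 0 then 1 else -1) = (-1::int)"
      "(if Q \<ge> 0 then 1 else -1) = (1::int) \<or> (if Q \<ge> 0 then 1 else -1) = (-1::int)" by auto
  qed auto
  have s2: "(of_int \<sigma> :: real)\<^sup>2 = 1" "(of_int \<tau> :: real)\<^sup>2 = 1" using st(1,2) by auto
  have PQ: "\<bar>P\<bar> + \<bar>Q\<bar> \<le> 1" using ab(2) by (simp add: P_def Q_def)
  have z: "Re \<zeta> = P + of_int a" "Im \<zeta> = Q + of_int b" by (simp_all add: P_def Q_def)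
  have d: "(cmod (\<zeta> - (of_int a + \<i> * of_int b)))\<^sup>2 = P\<^sup>2 + Q\<^sup>2"
    "(cmod (\<zeta> - (of_int (a + \<sigma>) + \<i> * of_int b)))\<^sup>2 = 1 + (P\<^sup>2 + Q\<^sup>2) - 2 * \<bar>P\<bar>"
    "(cmod (\<zeta> - (of_int (a - \<sigma>) + \<i> * of_int b)))\<^sup>2 = 1 + (P\<^sup>2 + Q\<^sup>2) + 2 * \<bar>P\<bar>"
    "(cmod (\<zeta> - (of_int a + \<i> * of_int (b + \<tau>))))\<^sup>2 = 1 + (P\<^sup>2 + Q\<^sup>2) - 2 * \<bar>Q\<bar>"
    "(cmod (\<zeta> - (of_int a + \<i> * of_int (b - \<tau>))))\<^sup>2 = 1 + (P\<^sup>2 + Q\<^sup>2) + 2 * \<bar>Q\<bar>"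
    using s2 unfolding cmod_power2 by (simp_all add: z st(3,4)[symmetric] power2_eq_square algebra_simps)
  have gs: "of_int p + \<i> * of_int q \<in> gauss" for p q by simp
  have hole: "\<exists>h. h \<in> gauss \<and> \<not> divp h \<and> of_int p + \<i> * of_int q = pG * h" if pq: "odd p" "odd q" for p q
  proof -
    obtain r t where "p = 2 * r + 1" "q = 2 * t + 1" using pq by (elim oddE)
    moreover have "\<not> divp (of_int (r + t + 1) + \<i> * of_int (t - r))" unfolding divp_iff by simp
    ultimately show ?thesis
      by (intro exI[of _ "of_int (r + t + 1) + \<i> * of_int (t - r)"]) (simp add: pG_def complex_eq_iff)
  qed
  show ?thesis
  \<comment> \<open>If \<open>a\<close> is odd and \<open>b\<close> even, the horizontal neighbours
    of the centre are divisible by 2 and the vertical ones are holes; otherwise the roles are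
    exchanged.\<close>
  proof (cases "odd a")
    case True
    then have "even b" using ab(1) by simp
    have "odd (b + \<tau>)" "even (a + \<sigma>)" using st(1,2) True \<open>even b\<close> by auto
    then obtain h where h: "h \<in> gauss" "\<not> divp h" "of_int a + \<i> * of_int (b + \<tau>) = pG * h" using hole[OF True] by blast
    obtain r t where r: "a + \<sigma> = 2 * r" "b = 2 * t" using \<open>even b\<close> \<open>even (a + \<sigma>)\<close> by (elim evenE)
    then have r': "a - \<sigma> = 2 * (r - \<sigma>)" by simp
    have g: "2 * (of_int r + \<i> * of_int t) = of_int (a + \<sigma>) + \<i> * of_int b"
      "2 * (of_int (r - \<sigma>) + \<i> * of_int t) = of_int (a - \<sigma>) + \<i> * of_int b"
      unfolding r' unfolding r by (simp_all add: algebra_simps)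
    have "localized \<zeta> (of_int a + \<i> * of_int b) h (of_int r + \<i> * of_int t) (of_int (r - \<sigma>) + \<i> * of_int t) \<bar>Q\<bar> \<bar>P\<bar>"
      unfolding localized_def g h(3)[symmetric] d divp_iff using h(1,2) PQ st(1) ab(1) gs by (auto simp: add.commute)
    then show ?thesis by blast
  next
    case False
    then have "odd b" using ab(1) by simp
    have "even (b + \<tau>)" "odd (a + \<sigma>)" using st(1,2) False \<open>odd b\<close> by auto
    then obtain h where h: "h \<in> gauss" "\<not> divp h" "of_int (a + \<sigma>) + \<i> * of_int b = pG * h" using hole \<open>odd b\<close> by blast
    obtain r t where r: "a = 2 * r" "b + \<tau> = 2 * t" using False \<open>even (b + \<tau>)\<close> by (metis evenE)
    then have r': "b - \<tau> = 2 * (t - \<tau>)" by simp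
    have g: "2 * (of_int r + \<i> * of_int t) = of_int a + \<i> * of_int (b + \<tau>)"
      "2 * (of_int r + \<i> * of_int (t - \<tau>)) = of_int a + \<i> * of_int (b - \<tau>)"
      unfolding r' unfolding r by (simp_all add: algebra_simps)
    have "localized \<zeta> (of_int a + \<i> * of_int b) h (of_int r + \<i> * of_int t) (of_int r + \<i> * of_int (t - \<tau>)) \<bar>P\<bar> \<bar>Q\<bar>"
      unfolding localized_def g h(3)[symmetric] d divp_iff using h(1,2) PQ st(2) ab(1) gs by (auto simp: add.commute)
    then show ?thesis by blast
  qed
qed

definition dist_sum :: "complex \<Rightarrow> (J \<Rightarrow> complex) \<Rightarrow> complex \<Rightarrow> (J \<Rightarrow> complex) \<Rightarrow> real" where
  "dist_sum q z m l = (\<Sum>j\<in>UNIV. (cmod (q * z j - m * l j))\<^sup>2)"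

lemma ip_self: "ip z z = of_real (\<Sum>j\<in>UNIV. (cmod (z j))\<^sup>2)"
  unfolding ip_def of_real_sum by (intro sum.cong refl) (metis complex_norm_square mult.commute)

lemma dist_sum_eq: "dist_sum (of_real q) z m l = q\<^sup>2 * Re (ip z z) + (cmod m)\<^sup>2 * Re (ip l l) - 2 * q * Re (cnj m * ip l z)"
proof -
  have e: "(cmod (of_real q * z - m * l))\<^sup>2 = q\<^sup>2 * (cmod z)\<^sup>2 + (cmod m)\<^sup>2 * (cmod l)\<^sup>2 - 2 * q * Re (cnj m * (cnj l * z))" for z l
    unfolding cmod_power2 by (simp add: power2_eq_square algebra_simps)
  have "Re (cnj m * ip l z) = (\<Sum>j\<in>UNIV. Re (cnj m * (cnj (l j) * z j)))"
    by (simp only: ip_def sum_distrib_left Re_sum)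
  then show ?thesis
    unfolding dist_sum_def e ip_self Re_complex_of_real by (simp only: sum_subtractf sum.distrib sum_distrib_left)
qed

text \<open>
  Dividing the inner product by \<open>cnj q * m\<close>, its real part is \<open>1/|m|\<^sup>2 - d\<^sup>2/2\<close> with \<open>d\<close> the distance of
  \<open>z/m\<close> to the centre \<open>l/q\<close>; the imaginary part can be made small by the choice of \<open>n'\<close>.
\<close>
lemma reduce:
  assumes "hform (psi z m n) (psi z m n) = 2" and m: "m \<noteq> 0" and ll: "ip l l = of_int (2 * q * k)" and q: "q > 0"
    and D: "dist_sum (of_int q) z m l \<le> 2 * q * (cmod m)\<^sup>2" "of_int q - dist_sum (of_int q) z m l / (2 * of_int q) < (cmod m)\<^sup>2"
  shows "\<exists>n'\<in>gauss. hform (psi l (of_int q) n') (psi l (of_int q) n') = 0 \<and>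
    (cmod (hform (psi l (of_int q) n') (psi z m n)))\<^sup>2 < 2 * (cmod m)\<^sup>2"
proof -
  define M where "M = (cmod m)\<^sup>2"
  have M: "M > 0" using m by (simp add: M_def)
  define N where "N t = - of_int k + \<i> * pG * of_int t" for t
  define h where "h t = hform (psi l (of_int q) (N t)) (psi z m n)" for t
  have null: "hform (psi l (of_int q) (N t)) (psi l (of_int q) (N t)) = 0" for t
    unfolding hform_psi ll N_def by (simp add: pG_def complex_eq_iff) (simp add: algebra_simps)
  have zz: "Re (ip z z) = 2 - 2 * Re (cnj m * cnj pG * n)"
    using arg_cong[OF assms(1), of Re] unfolding hform_psi by (simp add: algebra_simps)
  have re: "Re (h t * cnj m) = of_int q - dist_sum (of_int q) z m l / (2 * of_int q)" for t
  proof -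
    have "Re (h t * cnj m) = Re (cnj m * ip l z) + of_int q * Re (cnj m * cnj pG * n) - of_int k * M"
      unfolding h_def hform_psi N_def M_def cmod_power2 by (simp add: pG_def power2_eq_square algebra_simps)
    moreover have "dist_sum (of_int q) z m l = (of_int q)\<^sup>2 * (2 - 2 * Re (cnj m * cnj pG * n)) + M * (2 * of_int q * of_int k) - 2 * of_int q * Re (cnj m * ip l z)"
      using dist_sum_eq[of "of_int q" z m l] ll zz by (simp add: M_def)
    moreover have "X = of_int q - d / (2 * of_int q)" if "X = P + of_int q * B - of_int k * M"
      "d = (of_int q)\<^sup>2 * (2 - 2 * B) + M * (2 * of_int q * of_int k) - 2 * of_int q * P" for X P B d :: real
    proof -
      have "d = 2 * of_int q * (of_int q - X)" unfolding that by (simp add: algebra_simps power2_eq_square)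
      then show ?thesis using q by simp
    qed
    ultimately show ?thesis by blast
  qed
  have im: "Im (h t * cnj m) = Im (h 0 * cnj m) - 2 * M * of_int t" for t
    unfolding h_def hform_psi N_def M_def cmod_power2 by (simp add: pG_def power2_eq_square algebra_simps)
  define t where "t = round (Im (h 0 * cnj m) / (2 * M))"
  have "\<bar>of_int t - Im (h 0 * cnj m) / (2 * M)\<bar> \<le> 1 / 2" unfolding t_def by (rule of_int_round_abs_le)
  moreover have "Im (h t * cnj m) = (Im (h 0 * cnj m) / (2 * M) - of_int t) * (2 * M)"
    using M(1) unfolding im[of t] by (simp add: field_simps)
  ultimately have "\<bar>Im (h t * cnj m)\<bar> \<le> 1 / 2 * (2 * M)"
    using M(1) by (simp add: abs_mult abs_minus_commute)
  then have "(Im (h t * cnj m))\<^sup>2 \<le> M\<^sup>2" using M(1) by (intro abs_le_square_iff[THEN iffD1]) auto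
  moreover have "\<bar>Re (h t * cnj m)\<bar> < M"
  proof -
    have "dist_sum (of_int q) z m l / (2 * of_int q) \<le> M" using D(1) q by (simp add: M_def field_simps)
    then show ?thesis using D(2) q unfolding re M_def by (simp add: abs_less_iff)
  qed
  then have "(Re (h t * cnj m))\<^sup>2 < M\<^sup>2" using power_strict_mono[of "\<bar>Re (h t * cnj m)\<bar>" M 2] by simp
  ultimately have "(cmod (h t * cnj m))\<^sup>2 < 2 * M\<^sup>2" by (simp add: cmod_power2)
  then have "(cmod (h t))\<^sup>2 * M < 2 * M * M" by (simp add: norm_mult power_mult_distrib M_def power2_eq_square mult_ac)
  then have "(cmod (h t))\<^sup>2 < 2 * M" using M(1) by simp
  then show ?thesis using null[of t] unfolding h_def M_def
    by (intro bexI[of _ "N t"]) (auto simp: N_def)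
qed

lemma norm_mod4:
  assumes "c \<in> gauss"
  shows "\<exists>e :: int. (cmod c)\<^sup>2 = of_int (2 * e + of_bool (\<not> divp c))" "\<not> divp c \<Longrightarrow> \<exists>e :: int. (cmod c)\<^sup>2 = of_int (4 * e + 1)"
proof -
  obtain a b where c: "c = of_int a + \<i> * of_int b" using assms unfolding gauss_iff by blast
  have n: "(cmod c)\<^sup>2 = of_int (a\<^sup>2 + b\<^sup>2)" unfolding cmod_power2 c by simp
  have "odd (a\<^sup>2 + b\<^sup>2) \<longleftrightarrow> \<not> divp c" unfolding c divp_iff by simp
  then have "a\<^sup>2 + b\<^sup>2 = 2 * ((a\<^sup>2 + b\<^sup>2) div 2) + of_bool (\<not> divp c)" by (cases "divp c") (auto elim!: evenE oddE)
  then show "\<exists>e :: int. (cmod c)\<^sup>2 = of_int (2 * e + of_bool (\<not> divp c))" unfolding n by metis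
  assume "\<not> divp c"
  then have o: "odd (a + b)" unfolding c divp_iff .
  have "\<exists>e. a\<^sup>2 + b\<^sup>2 = 4 * e + 1"
  proof (cases "odd a")
    case True
    then obtain r t where "a = 2 * r + 1" "b = 2 * t" using o by (metis even_add evenE oddE)
    then show ?thesis by (intro exI[of _ "r * r + r + t * t"]) (simp add: power2_eq_square algebra_simps)
  next
    case False
    then obtain r t where "a = 2 * r" "b = 2 * t + 1" using o by (metis even_add evenE oddE)
    then show ?thesis by (intro exI[of _ "r * r + t + t * t"]) (simp add: power2_eq_square algebra_simps)
  qed
  then show "\<exists>e :: int. (cmod c)\<^sup>2 = of_int (4 * e + 1)" unfolding n by metis
qed

lemma Alat_norm:
  assumes "l \<in> Alat" shows "\<exists>k. ip l l = of_int (2 * 1 * k)"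
proof -
  have "\<forall>j. \<exists>e :: int. (cmod (l j))\<^sup>2 = of_int (2 * e + of_bool (\<not> divp (l j)))"
    using assms norm_mod4(1) by (auto simp: Alat_def)
  then obtain e :: "J \<Rightarrow> int" where e: "(cmod (l j))\<^sup>2 = of_int (2 * e j + of_bool (\<not> divp (l j)))" for j by metis
  let ?w = "{j. \<not> divp (l j)}"
  have "even (card ?w)" using assms ham_even_Int[of ?w ?w] by (simp add: Alat_def)
  then obtain h where h: "card ?w = 2 * h" by blast
  have "ip l l = of_int (2 * (sum e UNIV) + int (card ?w))"
    unfolding ip_self e by (simp add: sum.distrib sum_distrib_left)
  then show ?thesis unfolding h by (intro exI[of _ "(sum e UNIV) + int h"]) (simp add: algebra_simps)
qed

definition centre_type :: "J set \<Rightarrow> J set \<Rightarrow> (J \<Rightarrow> complex) \<Rightarrow> bool" where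
  "centre_type H S l \<longleftrightarrow> (\<forall>j\<in>H. \<exists>g\<in>gauss. \<not> divp g \<and> l j = pG * g) \<and> (\<forall>j\<in>S. l j \<in> gauss \<and> \<not> divp (l j)) \<and>
     (\<forall>j. j \<notin> H \<longrightarrow> j \<notin> S \<longrightarrow> (\<exists>g\<in>gauss. l j = 2 * g)) \<and> H \<inter> S = {} \<and> S \<in> ham"

text \<open>Modulo 4 each hole contributes 2, each odd coordinate 1, the others 0, and code words
  have size 0, 4 or 8. Divisibility by \<open>2 * q\<close> is what \<open>reduce\<close> needs for
  a Gaussian \<open>n'\<close>.\<close>

lemma centre_type_norm:
  assumes "centre_type H S l" "even (card H)" shows "\<exists>k. ip l l = of_int (2 * 2 * k)"
proof -
  have "\<exists>e :: int. (cmod (l j))\<^sup>2 = of_int (4 * e + 2 * of_bool (j \<in> H) + of_bool (j \<in> S))" for j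
  proof -
    consider "j \<in> H" "j \<notin> S" | "j \<in> S" "j \<notin> H" | "j \<notin> H" "j \<notin> S" using assms(1) by (auto simp: centre_type_def)
    then show ?thesis
    proof cases
      case 1
      then obtain g where g: "g \<in> gauss" "\<not> divp g" "l j = pG * g" using assms(1) by (auto simp: centre_type_def)
      then obtain e :: int where "(cmod g)\<^sup>2 = of_int (4 * e + 1)" using norm_mod4(2) by blast
      moreover have "(cmod (l j))\<^sup>2 = 2 * (cmod g)\<^sup>2" unfolding g(3) norm_mult power_mult_distrib cmod_power2[of pG] by (simp add: pG_def)
      ultimately show ?thesis using 1 by (intro exI[of _ "2 * e"]) simp
    next
      case 2
      then have "l j \<in> gauss" "\<not> divp (l j)" using assms(1) by (auto simp: centre_type_def)
      from norm_mod4(2)[OF this] show ?thesis using 2 by auto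
    next
      case 3
      then obtain g where g: "g \<in> gauss" "l j = 2 * g" using assms(1) by (auto simp: centre_type_def)
      from norm_mod4(1)[OF this(1)] obtain e :: int where "(cmod g)\<^sup>2 = of_int e" by blast
      moreover have "(cmod (l j))\<^sup>2 = 4 * (cmod g)\<^sup>2" unfolding g(2) norm_mult power_mult_distrib by simp
      ultimately show ?thesis using 3 by (intro exI[of _ e]) simp
    qed
  qed
  then obtain e :: "J \<Rightarrow> int" where e: "(cmod (l j))\<^sup>2 = of_int (4 * e j + 2 * of_bool (j \<in> H) + of_bool (j \<in> S))" for j by metis
  obtain h where h: "card H = 2 * h" using assms(2) by blast
  have "S \<in> ham" using assms(1) by (simp add: centre_type_def)
  then have "card S = 4 \<or> card S = 0 \<or> card S = 8" using ham_card[of S] by (cases "S = {}"; cases "S = UNIV") auto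
  then obtain i where i: "card S = 4 * i" by (metis mult_0_right mult.right_neutral numeral_Bit0 mult_2_right)
  have "ip l l = of_int (4 * (sum e UNIV) + 2 * int (card H) + int (card S))"
    unfolding ip_self e by (simp add: sum.distrib sum_distrib_left)
  then show ?thesis unfolding h i by (intro exI[of _ "(sum e UNIV) + int h + int i"]) (simp add: algebra_simps)
qed

lemma norm2_divp:
  assumes "m \<in> gauss" "(cmod m)\<^sup>2 = 2" obtains r where "r \<in> gauss" "\<not> divp r" "m = pG * r"
proof -
  have "divp m" using norm_mod4(2)[OF assms(1)] assms(2) by (metis even_add even_mult_iff even_numeral numeral_Bit0 odd_one of_int_eq_iff of_int_numeral even_plus_one_iff)
  then obtain r where r: "r \<in> gauss" "m = pG * r" unfolding divp_def by blast
  have "\<not> divp r"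
  proof
    assume "divp r"
    then obtain t where t: "t \<in> gauss" "r = pG * t" unfolding divp_def by blast
    obtain e :: int where "(cmod t)\<^sup>2 = of_int e" using norm_mod4(1)[OF t(1)] by blast
    moreover have "(cmod m)\<^sup>2 = 4 * (cmod t)\<^sup>2"
      unfolding r(2) t(2) norm_mult power_mult_distrib cmod_power2[of pG] by (simp add: pG_def)
    ultimately have "of_int (4 * e) = (of_int 2 :: real)" using assms(2) by simp
    then have "4 * e = 2" by (simp only: of_int_eq_iff)
    then show False by presburger
  qed
  then show ?thesis using that r by blast
qed

text \<open>The case in which \<open>z/m\<close> is itself a centre and the bound in \<open>reduce\<close> would not be strict.\<close>
lemma touching:
  assumes "centre_type H S l" "m \<in> gauss" "(cmod m)\<^sup>2 = 2" "z \<in> Alat" "\<And>j. 2 * z j = m * l j"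
  shows "H \<in> ham \<and> S = {}"
proof -
  obtain r where r: "r \<in> gauss" "\<not> divp r" "m = pG * r" using norm2_divp assms(2,3) by blast
  have "pG * (cnj pG * z j) = pG * (r * l j)" for j
    using assms(5)[of j] pG_simps(1) unfolding r(3) by (metis mult.assoc)
  then have e: "cnj pG * z j = r * l j" for j using pG_simps(3) by simp
  have z: "z j \<in> gauss" for j using assms(4) by (simp add: Alat_def)
  have "S = {}"
  proof -
    have "j \<notin> S" for j
    proof
      assume "j \<in> S"
      then have "l j \<in> gauss" "\<not> divp (l j)" using assms(1) by (auto simp: centre_type_def)
      then have "\<not> divp (r * l j)" using r by (simp add: divp_mult)
      then show False using z[of j] unfolding e[symmetric] by (simp add: divp_mult)
    qed
    then show ?thesis by blast
  qed
  moreover have "\<not> divp (z j) \<longleftrightarrow> j \<in> H" for j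
  proof (cases "j \<in> H")
    case True
    then obtain g where g: "g \<in> gauss" "\<not> divp g" "l j = pG * g" using assms(1) by (auto simp: centre_type_def)
    have "cnj pG * z j = cnj pG * (\<i> * r * g)" unfolding e g(3) by (simp add: pG_def algebra_simps)
    then have "z j = \<i> * r * g" using pG_simps(3) by simp
    then show ?thesis using True g r by (simp add: divp_mult)
  next
    case False
    then obtain g where g: "g \<in> gauss" "l j = 2 * g" using assms(1) \<open>S = {}\<close> by (auto simp: centre_type_def)
    have "2 * z j = 2 * (m * g)" using assms(5)[of j] g(2) by simp
    then have "z j = m * g" by simp
    then show ?thesis using False g r by (auto simp: divp_mult)
  qed
  then have "{j. \<not> divp (z j)} = H" by blast
  then have "H \<in> ham" using assms(4) by (auto simp: Alat_def)
  ultimately show ?thesis by blast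
qed

lemma dist_sum_nonneg: "0 \<le> dist_sum q z m l"
  unfolding dist_sum_def by (intro sum_nonneg) simp

text \<open>The strict bound in \<open>reduce\<close> can fail only for \<open>|m|^2 = 2\<close> and
  distance 0, which \<open>touching\<close> excludes.\<close>

lemma reduce_centre_type:
  assumes "z \<in> Alat" "m \<in> gauss" "hform (psi z m n) (psi z m n) = 2" "(cmod m)\<^sup>2 \<ge> 2"
    and l: "centre_type H S l" "even (card H)" "\<not> (H \<in> ham \<and> S = {})" "dist_sum 2 z m l \<le> 4 * (cmod m)\<^sup>2"
  obtains n' where "class_two l n' H S" "(cmod (hform (psi l 2 n') (psi z m n)))\<^sup>2 < 2 * (cmod m)\<^sup>2"
proof -
  have m: "m \<noteq> 0" using assms(4) by auto
  obtain k where k: "ip l l = of_int (2 * 2 * k)" using centre_type_norm[OF l(1,2)] by blast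
  have "2 - dist_sum 2 z m l / 4 < (cmod m)\<^sup>2"
  proof (cases "(cmod m)\<^sup>2 = 2")
    case True
    have "dist_sum 2 z m l \<noteq> 0"
    proof
      assume "dist_sum 2 z m l = 0"
      then have "\<forall>j. (cmod (2 * z j - m * l j))\<^sup>2 = 0"
        unfolding dist_sum_def by (subst (asm) sum_nonneg_eq_0_iff) auto
      then have "2 * z j = m * l j" for j by simp
      from touching[OF l(1) assms(2) True assms(1) this] show False using l(3) by blast
    qed
    then show ?thesis using dist_sum_nonneg[of 2 z m l] True by simp
  next
    case False
    then show ?thesis using dist_sum_nonneg[of 2 z m l] assms(4) by simp
  qed
  then obtain n' where n': "n' \<in> gauss" "hform (psi l 2 n') (psi l 2 n') = 0"
    "(cmod (hform (psi l 2 n') (psi z m n)))\<^sup>2 < 2 * (cmod m)\<^sup>2"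
    using reduce[OF assms(3) m k] l(4) by auto
  have "class_two l n' H S" using l(1) n' unfolding class_two_def centre_type_def by blast
  then show ?thesis using that n'(3) by blast
qed

lemma descent:
  assumes "z \<in> Alat" "m \<in> gauss" "hform (psi z m n) (psi z m n) = 2" "(cmod m)\<^sup>2 \<ge> 2"
  shows "\<exists>\<nu>. orb \<nu> null_vec \<and> (cmod (hform \<nu> (psi z m n)))\<^sup>2 < 2 * (cmod m)\<^sup>2"
proof -
  define M where "M = (cmod m)\<^sup>2"
  have m: "m \<noteq> 0" and M: "M \<ge> 2" using assms(4) by (auto simp: M_def)
  have "\<forall>j. \<exists>c h g g' x y. localized (2 * z j / m) c h g g' x y" using ex_localized by blast
  then obtain c h g g' x y where loc: "\<And>j. localized (2 * z j / m) (c j) (h j) (g j) (g' j) (x j) (y j)" by metis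
  note loc' = loc[unfolded localized_def]
  define w where "w = {j. \<not> divp (g j)}"
  define W where "W = (\<Sum>j\<in>UNIV. (x j)\<^sup>2 + (y j)\<^sup>2)"
  have d: "(cmod (2 * z j - m * t))\<^sup>2 = M * (cmod (2 * z j / m - t))\<^sup>2" for j t
  proof -
    have "2 * z j - m * t = m * (2 * z j / m - t)" using m by (simp add: field_simps)
    then show ?thesis by (simp add: M_def norm_mult power_mult_distrib)
  qed
  have d1: "(cmod (1 * z j - m * t))\<^sup>2 = M / 4 * (cmod (2 * z j / m - 2 * t))\<^sup>2" for j t
  proof -
    have e: "2 * (1 * z j - m * t) = 2 * z j - m * (2 * t)" by (simp add: algebra_simps)
    have "(cmod (2 * (1 * z j - m * t)))\<^sup>2 = 4 * (cmod (1 * z j - m * t))\<^sup>2"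
      unfolding norm_mult power_mult_distrib by simp
    then have "4 * (cmod (1 * z j - m * t))\<^sup>2 = (cmod (2 * z j - m * (2 * t)))\<^sup>2" unfolding e by simp
    then show ?thesis unfolding d by simp
  qed
  have "covered x y w" using loc' by (intro covering) auto
  then consider (A) u where "u \<in> ham" "W / 2 \<le> (\<Sum>j\<in>UNIV. if j \<in> sdiff u w then - y j else y j)"
    | (M) Q B where "Q \<in> ham" "card Q = 4" "card (Q \<inter> B) = 2 \<or> Q \<inter> B = {} \<and> even (card (Q \<inter> w))" "W / 2 \<le> (\<Sum>j\<in>Q. coord_pick x y B j)"
    | (P) B where "card B = 6 \<or> card B = 4 \<and> B \<notin> ham" "2 + W / 2 \<le> (\<Sum>j\<in>UNIV. coord_pick x y B j)"
    unfolding covered_def Let_def W_def[symmetric] by blast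
  then show ?thesis
  proof cases
    case (A u)
    \<comment> \<open>Passing to \<open>g'\<close> where \<open>u\<close> and \<open>w\<close>
      disagree makes \<open>u\<close> the set of odd positions.\<close>
    define l where "l j = (if j \<in> sdiff u w then g' j else g j)" for j
    have "{j. \<not> divp (l j)} = u" using loc' by (intro Set.set_eqI) (auto simp: l_def w_def)
    then have lA: "l \<in> Alat" using A(1) loc' by (auto simp: Alat_def l_def)
    have "dist_sum 1 z m l = (\<Sum>j\<in>UNIV. M / 4 * (1 + ((x j)\<^sup>2 + (y j)\<^sup>2) - 2 * (if j \<in> sdiff u w then - y j else y j)))"
      unfolding dist_sum_def d1 using loc' by (intro sum.cong refl) (simp add: l_def)
    also have "\<dots> = M / 4 * (8 + W - 2 * (\<Sum>j\<in>UNIV. if j \<in> sdiff u w then - y j else y j))"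
      unfolding sum_distrib_left[symmetric] by (simp add: W_def sum_subtractf sum.distrib flip: sum_distrib_left)
    also have "\<dots> \<le> M / 4 * 8" using A(2) M by (intro mult_left_mono) auto
    finally have D: "dist_sum 1 z m l \<le> 2 * M" by simp
    obtain k where k: "ip l l = of_int (2 * 1 * k)" using Alat_norm[OF lA] by blast
    have "1 - dist_sum 1 z m l / 2 < M" using dist_sum_nonneg[of 1 z m l] M by simp
    then obtain n' where "n' \<in> gauss" "hform (psi l 1 n') (psi l 1 n') = 0"
      "(cmod (hform (psi l 1 n') (psi z m n)))\<^sup>2 < 2 * (cmod m)\<^sup>2"
      using reduce[OF assms(3) m k] D by (auto simp: M_def)
    then show ?thesis using family_A[OF lA] by blast
  next
    case (M Q B)
    define l where "l j = (if j \<in> Q then if j \<in> B then pG * h j else 2 * g j else c j)" for j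
    have centre_type: "centre_type (Q \<inter> B) (- Q) l" using loc' ham_compl[OF M(1)] by (auto simp: centre_type_def l_def)
    have "even (card (Q \<inter> B))" using M(3) by auto
    have "- Q \<noteq> {}" using M(2) card_compl_J[of Q] by auto
    have "dist_sum 2 z m l = (\<Sum>j\<in>UNIV. M * ((x j)\<^sup>2 + (y j)\<^sup>2 + (if j \<in> Q then 1 - 2 * coord_pick x y B j else 0)))"
      unfolding dist_sum_def d using loc' by (intro sum.cong refl) (simp add: l_def coord_pick_def)
    also have "\<dots> = M * (W + (4 - 2 * (\<Sum>j\<in>Q. coord_pick x y B j)))"
      using M(2) by (simp add: W_def sum.If_cases sum.distrib sum_subtractf flip: sum_distrib_left)
    also have "\<dots> \<le> M * 4" using M(4) \<open>M \<ge> 2\<close> by (intro mult_left_mono) auto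
    finally have D: "dist_sum 2 z m l \<le> 4 * (cmod m)\<^sup>2" by (simp add: M_def)
    obtain n' where n': "class_two l n' (Q \<inter> B) (- Q)" "(cmod (hform (psi l 2 n') (psi z m n)))\<^sup>2 < 2 * (cmod m)\<^sup>2"
      using reduce_centre_type[OF assms centre_type \<open>even (card (Q \<inter> B))\<close> _ D] \<open>- Q \<noteq> {}\<close> by blast
    interpret class_two l n' "Q \<inter> B" "- Q" by (rule n'(1))
    have "orb (psi l 2 n') null_vec"
      using M(3)
    proof
      assume "card (Q \<inter> B) = 2"
      then show ?thesis by (intro class_M2[of Q] M(1,2)) auto
    next
      assume e: "Q \<inter> B = {} \<and> even (card (Q \<inter> w))"
      then have "Q \<inter> {j. \<not> divp (l j / 2)} = Q \<inter> w" by (auto simp: l_def w_def)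
      then show ?thesis using e by (intro class_M0[of Q] M(1,2)) auto
    qed
    then show ?thesis using n'(2) by blast
  next
    case (P B)
    define l where "l j = (if j \<in> B then pG * h j else 2 * g j)" for j
    have centre_type: "centre_type B {} l" using loc' by (auto simp: centre_type_def l_def ham_def)
    have "even (card B)" using P(1) by auto
    \<comment> \<open>Six points never form a word, so only sets of four need the explicit
      exclusion.\<close>
    have nh: "B \<notin> ham" using P(1) ham_card[of B] by (cases "B = {}"; cases "B = UNIV") auto
    have "dist_sum 2 z m l = (\<Sum>j\<in>UNIV. M * (1 + ((x j)\<^sup>2 + (y j)\<^sup>2) - 2 * coord_pick x y B j))"
      unfolding dist_sum_def d using loc' by (intro sum.cong refl) (simp add: l_def coord_pick_def)
    also have "\<dots> = M * (8 + W - 2 * (\<Sum>j\<in>UNIV. coord_pick x y B j))"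
      by (simp add: W_def sum.distrib sum_subtractf flip: sum_distrib_left)
    also have "\<dots> \<le> M * 4" using P(2) \<open>M \<ge> 2\<close> by (intro mult_left_mono) auto
    finally have D: "dist_sum 2 z m l \<le> 4 * (cmod m)\<^sup>2" by (simp add: M_def)
    obtain n' where n': "class_two l n' B {}" "(cmod (hform (psi l 2 n') (psi z m n)))\<^sup>2 < 2 * (cmod m)\<^sup>2"
      using reduce_centre_type[OF assms centre_type \<open>even (card B)\<close> _ D] nh by blast
    interpret class_two l n' B "{}" by (rule n'(1))
    have "orb (psi l 2 n') null_vec" using P(1) class_P6 class_P4N by blast
    then show ?thesis using n'(2) by blast
  qed
qed

section \<open>Integral vectors and the induction on \<open>|m|^2\<close>\<close>

definition integral_coords :: "gvec \<Rightarrow> bool" where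
  "integral_coords s \<longleftrightarrow> Zc s \<in> Alat \<and> Mc s \<in> gauss \<and> Nc s \<in> gauss"

lemma integral_coords_psi: "integral_coords (psi z m n) \<longleftrightarrow> z \<in> Alat \<and> m \<in> gauss \<and> n \<in> gauss"
  by (simp add: integral_coords_def psi_coord_inv)

lemma single_Alat: "divp c \<Longrightarrow> single j c \<in> Alat"
  by (auto simp: Alat_def single_def ham_def divp_gauss)

lemma integral_coords_rf:
  assumes "r \<in> gens" "integral_coords s" shows "integral_coords (rf r s)"
proof -
  obtain z m n where s: "s = psi z m n" by (rule psi_exhaust)
  then have i: "z \<in> Alat" "m \<in> gauss" "n \<in> gauss" using assms(2) by (auto simp: integral_coords_psi)
  obtain a k l where r: "r = psi a k l" "a \<in> Alat" "k \<in> gauss" "l \<in> gauss"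
    using assms(1)
  proof (cases rule: gens_cases)
    case (1 u j l)
    then show ?thesis using that[of "single j (u * pG)" 0 l] by (simp add: single_Alat divp_mult)
  next
    case (2 w)
    then show ?thesis using that[of "wvec w" 1 "nw w"] by (simp add: wvec_Alat)
  qed
  have "divp (ip a z + cnj k * cnj pG * n + cnj l * pG * m)"
    using Alat_divp_ip[OF r(2) i(1)] i r by (simp add: divp_add divp_mult divp_gauss)
  then obtain q where q: "q \<in> gauss" "ip a z + cnj k * cnj pG * n + cnj l * pG * m = pG * q" unfolding divp_def by blast
  have "rf r s = psi (\<lambda>j. z j + (- q) * a j) (m - q * k) (n - q * l)"
    unfolding r(1) s rf_psi q(2) half_pG(2) Let_def by simp
  moreover have "(\<lambda>j. z j + (- q) * a j) \<in> Alat" using i r q(1) by (intro Alat_add Alat_scale) auto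
  ultimately show ?thesis using i r q(1) by (simp add: integral_coords_psi)
qed

lemma integral_coords_rgrp: "g \<in> rgrp gens \<Longrightarrow> integral_coords s \<Longrightarrow> integral_coords (g s)"
  by (induction rule: rgrp.induct) (auto intro: integral_coords_rf)

lemma gunit_iff: "v \<in> gauss \<Longrightarrow> (cmod v)\<^sup>2 < 2 \<Longrightarrow> v \<noteq> 0 \<Longrightarrow> gunit v"
proof -
  assume a: "v \<in> gauss" "(cmod v)\<^sup>2 < 2" "v \<noteq> 0"
  then obtain a b where v: "v = of_int a + \<i> * of_int b" unfolding gauss_iff by blast
  have "of_int (a\<^sup>2 + b\<^sup>2) < (of_int 2 :: real)" using a(2) unfolding cmod_power2 v by simp
  then have n: "a\<^sup>2 + b\<^sup>2 < 2" by (simp only: of_int_less_iff)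
  then have "a\<^sup>2 < 4" "b\<^sup>2 < 4" using zero_le_power2[of a] zero_le_power2[of b] by linarith+
  then have "\<bar>a\<bar>\<^sup>2 < 2\<^sup>2" "\<bar>b\<bar>\<^sup>2 < 2\<^sup>2" by simp_all
  then have "\<bar>a\<bar> < 2" "\<bar>b\<bar> < 2"
    using power2_less_imp_less[of "\<bar>a\<bar>" 2] power2_less_imp_less[of "\<bar>b\<bar>" 2] by simp_all
  then have "a = 0 \<or> a = 1 \<or> a = -1" "b = 0 \<or> b = 1 \<or> b = -1" by auto
  then show "gunit v" using n a(3) unfolding gunit_def v by auto
qed

text \<open>Norm 2 leaves no room for a nonempty set of odd positions, which has at least four
  elements. So every coordinate is divisible by \<open>pG\<close>, and a nonzero one already uses up
  the whole norm.\<close>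

lemma null_root:
  assumes "z \<in> Alat" "n \<in> gauss" "hform (psi z 0 n) (psi z 0 n) = 2"
  shows "psi z 0 n \<in> refl_roots"
proof -
  have zg: "z j \<in> gauss" for j using assms(1) by (simp add: Alat_def)
  then have "\<forall>j. \<exists>e :: int. (cmod (z j))\<^sup>2 = of_int (2 * e + of_bool (\<not> divp (z j)))" using norm_mod4(1) by blast
  then obtain e :: "J \<Rightarrow> int" where e: "(cmod (z j))\<^sup>2 = of_int (2 * e j + of_bool (\<not> divp (z j)))" for j by metis
  define N where "N j = 2 * e j + of_bool (\<not> divp (z j))" for j
  have N: "(cmod (z j))\<^sup>2 = of_int (N j)" for j using e by (simp add: N_def)
  have N0: "N j \<ge> 0" for j using N[of j] by (metis of_int_0_le_iff zero_le_power2)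
  have "ip z z = 2" using assms(3) by (simp add: hform_psi)
  then have "of_int (sum N UNIV) = (of_int 2 :: complex)" unfolding ip_self N by simp
  then have sN: "(sum N UNIV) = 2" by (simp only: of_int_eq_iff)
  let ?w = "{j. \<not> divp (z j)}"
  have wh: "?w \<in> ham" using assms(1) by (simp add: Alat_def)
  have "?w = {}"
  proof (rule ccontr)
    assume ne: "?w \<noteq> {}"
    have "card ?w \<ge> 4" using ham_card[OF wh ne] by (cases "?w = UNIV") auto
    moreover have "1 \<le> N j" if "j \<in> ?w" for j using that N0[of j] unfolding N_def by auto
    then have "(\<Sum>j\<in>?w. 1) \<le> (sum N ?w)" by (rule sum_mono)
    moreover have "(sum N ?w) \<le> (sum N UNIV)" using N0 by (intro sum_mono2) auto
    ultimately show False using sN by simp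
  qed
  then have ev: "N j = 2 * e j" "divp (z j)" for j by (auto simp: N_def)
  have "\<exists>j. N j \<noteq> 0" using sN by (metis sum.neutral zero_neq_numeral)
  then obtain j where j: "N j \<noteq> 0" by blast
  then have "N j \<ge> 2" using ev[of j] N0[of j] by simp
  moreover have s2: "(sum N (UNIV - {j})) = 2 - N j" using sN sum.remove[of UNIV j N] by simp
  moreover have "(sum N (UNIV - {j})) \<ge> 0" using N0 by (intro sum_nonneg) auto
  ultimately have Nj: "N j = 2" "(sum N (UNIV - {j})) = 0" by auto
  then have "N k = 0" if "k \<noteq> j" for k using N0 that by (subst (asm) sum_nonneg_eq_0_iff) auto
  then have "z k = 0" if "k \<noteq> j" for k using N[of k] that by simp
  moreover obtain v where v: "v \<in> gauss" "z j = pG * v" using ev(2)[of j] unfolding divp_def by blast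
  ultimately have z: "z = single j (v * pG)" by (auto simp: single_def fun_eq_iff mult.commute)
  have "2 * (cmod v)\<^sup>2 = 2" using N[of j] Nj(1) unfolding v(2) norm_mult power_mult_distrib cmod_power2[of pG] by (simp add: pG_def)
  then have "gunit v" using v(1) by (intro gunit_iff) auto
  then show ?thesis unfolding z by (intro Z0_refl_roots_unit assms(2))
qed

lemma integral_coords_refl_roots:
  assumes "integral_coords s" "hform s s = 2" shows "s \<in> refl_roots"
  using assms
\<comment> \<open>For integral vectors \<open>|m|^2\<close> is an integer, so the floor loses
  nothing and a strict decrease remains strict.\<close>
proof (induction "nat \<lfloor>(cmod (Mc s))\<^sup>2\<rfloor>" arbitrary: s rule: less_induct)
  case less
  obtain z m n where s: "s = psi z m n" by (rule psi_exhaust)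
  have i: "z \<in> Alat" "m \<in> gauss" "n \<in> gauss" using less.prems(1) by (auto simp: integral_coords_psi s)
  consider "m = 0" | "gunit m" | "(cmod m)\<^sup>2 \<ge> 2" using gunit_iff[OF i(2)] by fastforce
  then show ?case
  proof cases
    case 1
    then show ?thesis using null_root i less.prems(2) unfolding s by blast
  next
    case 2
    have c: "cscale (cnj m) s = psi (\<lambda>j. cnj m * z j) 1 (cnj m * n)" unfolding s psi_scale using gunit_simps(2)[OF 2] by simp
    have o: "orb s (cscale (cnj m) s)" using 2 by (intro orb_unit gunit_simps)
    have "hform (cscale (cnj m) s) (cscale (cnj m) s) = 2" using orb_norm[OF o] less.prems(2) by simp
    then have "cscale (cnj m) s \<in> refl_roots" unfolding c using i by (intro Z1_refl_roots Alat_scale) auto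
    then show ?thesis using refl_roots_orb orb_sym[OF o] by blast
  next
    case 3
    obtain \<nu> where \<nu>: "orb \<nu> null_vec" "(cmod (hform \<nu> s))\<^sup>2 < 2 * (cmod m)\<^sup>2"
      using descent[OF i(1,2) _ 3] less.prems(2) unfolding s by blast
    obtain g u where g: "g \<in> rgrp gens" "gunit u" "null_vec = cscale u (g \<nu>)" using \<nu>(1) unfolding orb_def by blast
    have "hform null_vec (g s) = cnj u * hform \<nu> s" unfolding g(3) hform_scale_left isomD(3)[OF rgrp_isom[OF g(1)]] ..
    moreover have "cmod u = 1" using g(2) by (auto simp: gunit_def)
    ultimately have "(cmod (hform null_vec (g s)))\<^sup>2 < 2 * (cmod m)\<^sup>2" using \<nu>(2) by (simp add: norm_mult)
    moreover have "(cmod (Mc (g s)))\<^sup>2 = (cmod (hform null_vec (g s)))\<^sup>2 / 2"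
      unfolding Mc_def norm_mult power_mult_distrib norm_divide power_divide complex_mod_cnj cmod_power2[of pG] by (simp add: pG_def)
    ultimately have lt: "(cmod (Mc (g s)))\<^sup>2 < (cmod m)\<^sup>2" by simp
    have ig: "integral_coords (g s)" using integral_coords_rgrp[OF g(1)] less.prems(1) by blast
    obtain a b :: int where ab: "(cmod (Mc (g s)))\<^sup>2 = of_int a" "(cmod m)\<^sup>2 = of_int b"
      using norm_mod4(1)[OF i(2)] norm_mod4(1)[of "Mc (g s)"] ig unfolding integral_coords_def by blast
    have "a \<ge> 0" using ab(1) by (metis of_int_0_le_iff zero_le_power2)
    then have "nat \<lfloor>(cmod (Mc (g s)))\<^sup>2\<rfloor> < nat \<lfloor>(cmod (Mc s))\<^sup>2\<rfloor>"
      using lt unfolding s psi_coord_inv unfolding s[symmetric] ab by simp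
    then have "g s \<in> refl_roots" using less.hyps ig isomD(3)[OF rgrp_isom[OF g(1)]] less.prems(2) by simp
    then show ?thesis using refl_roots_orb orb_sym[OF orb_app[OF g(1)]] by blast
  qed
qed

section \<open>The 32 roots\<close>

text \<open>Each pair of points exchanged by \<open>t_a\<close> has one member with first coordinate
  0. \<open>index_of\<close> names the pair, \<open>flip\<close> tells which member is
  meant.\<close>

definition flip :: "bit^4 \<Rightarrow> bool" where "flip u \<longleftrightarrow> u $ 1 = 1"

definition index_of :: "bit^4 \<Rightarrow> J" where
  "index_of u = JJ (u $ 2 \<noteq> u $ 1) (u $ 3 \<noteq> u $ 1) (u $ 4 \<noteq> u $ 1)"

fun point_at :: "J \<Rightarrow> bit^4" where
  "point_at (JJ a b c) = vec4 0 (of_bool a) (of_bool b) (of_bool c)"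

definition hyp_word :: "(bit^4) set \<Rightarrow> J set" where "hyp_word v = {j. point_at j \<in> v}"

definition proot :: "bit^4 \<Rightarrow> gvec" where
  "proot u = (if flip u then psi (single (index_of u) (- pG)) 0 1 else psi (single (index_of u) pG) 0 0)"

definition hroot :: "J set \<Rightarrow> gvec" where
  "hroot w = psi (wvec w) 1 (nw w)"

lemma antipode_psi: "psi (single j (- pG)) 0 1 = null_vec - frame_root j"
  unfolding null_vec_psi frame_root_psi[symmetric] psi_diff psi_inj by (auto simp: single_def)

lemma root_of_Point: "root_of (Point u) = proot u"
proof -
  have e: "\<forall>j k. j \<noteq> k \<longrightarrow> root_of (Point (pt_e j k)) = proot (pt_e j k)"
    unfolding forall_4 proot_def flip_def index_of_def antipode_psi frame_root_psi
    by (simp add: root_of_eq[OF root_table.e] pt_nth vec_eq_iff forall_4 prod_eq_iff null_vec_def)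
  have k: "\<forall>k. root_of (Point (pt_c k)) = proot (pt_c k) \<and> root_of (Point (pt_g k)) = proot (pt_g k)"
    unfolding forall_4 proot_def flip_def index_of_def antipode_psi frame_root_psi
    by (simp add: root_of_eq[OF root_table.c] root_of_eq[OF root_table.g] pt_nth vec_eq_iff forall_4 prod_eq_iff null_vec_def)
  have az: "root_of (Point pt_a) = proot pt_a" "root_of (Point 0) = proot 0"
    unfolding forall_4 proot_def flip_def index_of_def antipode_psi frame_root_psi
    by (simp_all add: root_of_eq[OF root_table.a] root_of_eq[OF root_table.z] pt_nth vec_eq_iff forall_4 prod_eq_iff null_vec_def)
  show ?thesis by (cases u rule: points_cases) (use e k az in auto)
qed

lemma point_at_nth: "point_at j $ 1 = 0" "point_at j $ 2 = of_bool (j1 j)" "point_at j $ 3 = of_bool (j2 j)" "point_at j $ 4 = of_bool (j3 j)"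
  by (cases j; simp)+

lemma hyp_word_mem:
  "j \<in> hyp_word (hyp_d k) \<longleftrightarrow> point_at j $ k = 0" "j \<in> hyp_word (hyp_f k) \<longleftrightarrow> point_at j $ k = point_at j $ 2 + point_at j $ 3 + point_at j $ 4"
  "j \<in> hyp_word (hyp_b k) \<longleftrightarrow> point_at j $ k \<noteq> point_at j $ 2 + point_at j $ 3 + point_at j $ 4" "j \<in> hyp_word (hyp_h k) \<longleftrightarrow> point_at j $ k \<noteq> 0"
  by (auto simp: hyp_word_def hyp_d_def hyp_f_def hyp_b_def hyp_h_def sum_4 point_at_nth)

lemma hroot_eqI:
  assumes "\<forall>j. hform (frame_root j) s = (if j \<in> w then pG else 0)" "hform null_vec s = pG" "hform null_dual s = cnj pG * nw w"
  shows "s = hroot w"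
proof -
  have "Zc s = wvec w" using assms(1) by (auto simp: Zc_def wvec_def fun_eq_iff pG_def complex_eq_iff)
  moreover have "Mc s = 1" "Nc s = nw w" using assms(2,3) pG_simps(1,2) by (simp_all add: Mc_def Nc_def mult_ac)
  ultimately show ?thesis unfolding hroot_def using psi_coords[of s] by simp
qed

lemma nw_iff: "(w = {}) = (\<forall>j. j \<notin> w)" "(w = UNIV) = (\<forall>j. j \<in> w)"
  by auto

lemma root_of_Hyper_d: "\<forall>k. root_of (Hyper (hyp_d k)) = hroot (hyp_word (hyp_d k))"
  unfolding forall_4
  by (intro conjI hroot_eqI; unfold root_of_eq[OF root_table.d] nw_def nw_iff hyp_word_mem all_J;
      simp add: hform_expand point_at_nth null_vec_def null_dual_def pG_def complex_eq_iff)

lemma root_of_Hyper_f: "\<forall>k. root_of (Hyper (hyp_f k)) = hroot (hyp_word (hyp_f k))"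
  unfolding forall_4
  by (intro conjI hroot_eqI; unfold root_of_eq[OF root_table.f] nw_def nw_iff hyp_word_mem all_J;
      simp add: hform_expand point_at_nth null_vec_def null_dual_def pG_def complex_eq_iff)

lemma root_of_Hyper_b: "\<forall>k. root_of (Hyper (hyp_b k)) = hroot (hyp_word (hyp_b k))"
  unfolding forall_4
  by (intro conjI hroot_eqI; unfold root_of_eq[OF root_table.b] nw_def nw_iff hyp_word_mem all_J;
      simp add: hform_expand point_at_nth null_vec_def null_dual_def pG_def complex_eq_iff)

lemma root_of_Hyper_h: "\<forall>k. root_of (Hyper (hyp_h k)) = hroot (hyp_word (hyp_h k))"
  unfolding forall_4
  by (intro conjI hroot_eqI; unfold root_of_eq[OF root_table.h] nw_def nw_iff hyp_word_mem all_J;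
      simp add: hform_expand point_at_nth null_vec_def null_dual_def pG_def complex_eq_iff)

lemma root_of_Hyper: "v \<in> hyperplanes \<Longrightarrow> root_of (Hyper v) = hroot (hyp_word v)"
  using root_of_Hyper_d root_of_Hyper_f root_of_Hyper_b root_of_Hyper_h unfolding hyperplanes_def by blast

lemma hyp_word_ham: "v \<in> hyperplanes \<Longrightarrow> hyp_word v \<in> ham"
proof -
  have "\<forall>k. hyp_word (hyp_d k) \<in> ham \<and> hyp_word (hyp_f k) \<in> ham \<and> hyp_word (hyp_b k) \<in> ham \<and> hyp_word (hyp_h k) \<in> ham"
    unfolding forall_4 ham_def mem_Collect_eq hyp_word_mem point_at_nth by simp
  then show "v \<in> hyperplanes \<Longrightarrow> ?thesis" unfolding hyperplanes_def by blast
qed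

lemma bit_add_1: "x + 1 = (0 :: bit) \<longleftrightarrow> x \<noteq> 0"
  by (cases x) simp_all

text \<open>The linear forms defining \<open>hyp_d k\<close> and \<open>hyp_f k\<close> take the
  value 1 at \<open>pt_a\<close>.\<close>

lemma add_a_mem: "v \<in> hyperplanes \<Longrightarrow> u + pt_a \<in> v \<longleftrightarrow> u \<notin> v"
proof -
  have "u + pt_a \<in> hyp_d k \<longleftrightarrow> u \<notin> hyp_d k" "u + pt_a \<in> hyp_f k \<longleftrightarrow> u \<notin> hyp_f k" for k
    by (simp add: hyp_d_def pt_nth bit_add_1)
      (cases "u $ 1"; cases "u $ 2"; cases "u $ 3"; cases "u $ 4"; cases "u $ k"; simp add: hyp_f_def pt_nth sum_4)
  then show "v \<in> hyperplanes \<Longrightarrow> ?thesis" unfolding hyperplanes_def hyp_b_def hyp_h_def by blast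
qed

lemma point_at_index_of: "u = (if flip u then point_at (index_of u) + pt_a else point_at (index_of u))"
  by (cases "u $ 1"; cases "u $ 2"; cases "u $ 3"; cases "u $ 4")
    (simp_all add: flip_def index_of_def vec_eq_iff forall_4 pt_nth)

lemma point_mem: "v \<in> hyperplanes \<Longrightarrow> u \<in> v \<longleftrightarrow> (index_of u \<in> hyp_word v) \<noteq> flip u"
  using point_at_index_of[of u] add_a_mem[of v "point_at (index_of u)"] unfolding hyp_word_def by (metis mem_Collect_eq)

lemma index_of_point_at: "index_of (point_at j) = j" "\<not> flip (point_at j)" "index_of (point_at j + pt_a) = j" "flip (point_at j + pt_a)"
  by (cases j; auto simp: index_of_def flip_def pt_nth)+

lemma hyp_word_inj: "inj_on hyp_word hyperplanes"
  using point_mem by (intro inj_onI) blast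

lemma pt_a_add [simp]: "u + pt_a + pt_a = u"
proof -
  have "x + 1 + 1 = (x :: bit)" for x by (cases x) simp_all
  then show ?thesis unfolding vec_eq_iff vector_add_component pt_nth(1) by blast
qed

lemma hyp_t_a: "v \<in> hyperplanes \<Longrightarrow> (\<lambda>x. x + pt_a) ` v = - v"
proof -
  assume v: "v \<in> hyperplanes"
  have "x \<in> (\<lambda>x. x + pt_a) ` v \<longleftrightarrow> x + pt_a \<in> v" for x
    by (auto intro: rev_image_eqI[of "x + pt_a"])
  then have "x \<in> (\<lambda>x. x + pt_a) ` v \<longleftrightarrow> x \<notin> v" for x
    using add_a_mem[OF v, of x] by simp
  then show ?thesis by blast
qed

lemma point_eqI: "index_of u = index_of u' \<Longrightarrow> flip u = flip u' \<Longrightarrow> u = u'"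
  using point_at_index_of[of u] point_at_index_of[of u'] by metis

lemma point_anti: "index_of u = index_of u' \<Longrightarrow> flip u \<noteq> flip u' \<Longrightarrow> u' = u + pt_a"
  using point_at_index_of[of u] point_at_index_of[of u'] by (metis pt_a_add)

lemma gram_pp: "hform (proot u) (proot u') = (if u = u' then 2 else if u' = u + pt_a then -2 else 0)"
proof -
  have "u + pt_a = (if flip u then point_at (index_of u) else point_at (index_of u) + pt_a)"
  proof (cases "flip u")
    case True
    then have "u + pt_a = point_at (index_of u) + pt_a + pt_a" using point_at_index_of[of u] by metis
    then show ?thesis using True by simp
  next
    case False
    then show ?thesis using point_at_index_of[of u] by metis
  qed
  then have a: "index_of (u + pt_a) = index_of u" "flip (u + pt_a) \<longleftrightarrow> \<not> flip u" using index_of_point_at by simp_all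
  consider "index_of u = index_of u'" "flip u = flip u'" | "index_of u = index_of u'" "flip u \<noteq> flip u'" | "index_of u \<noteq> index_of u'" by blast
  then show ?thesis
  proof cases
    case 1
    then have "u' = u" using point_eqI by metis
    then show ?thesis by (simp add: proot_def hform_psi ip_single pG_simps)
  next
    case 2
    then have "u' = u + pt_a" "u \<noteq> u'" using point_anti by metis+
    moreover have "hform (proot u) (proot u') = -2"
      using 2 by (cases "flip u") (simp_all add: proot_def hform_psi ip_single pG_simps)
    ultimately show ?thesis by metis
  next
    case 3
    then have "u' \<noteq> u + pt_a" "u \<noteq> u'" using a(1) by metis+
    moreover have "hform (proot u) (proot u') = 0"
      using 3 by (auto simp: proot_def hform_psi ip_single single_def)
    ultimately show ?thesis by simp
  qed
qed

lemma gram_ph: "hform (proot u) (hroot w) = (if (index_of u \<in> w) \<noteq> flip u then pG else 0)"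
  by (auto simp: proot_def hroot_def hform_psi ip_single wvec_def pG_def complex_eq_iff)

lemma ham_card_Int:
  assumes "w \<in> ham" "w' \<in> ham" "card w = 4" "card w' = 4" "w \<noteq> w'" "w' \<noteq> - w"
  shows "card (w \<inter> w') = 2"
proof -
  have "sdiff w w' \<noteq> {}" "sdiff w w' \<noteq> UNIV" using assms(5,6) by (auto simp: sdiff_def)
  then have "card (sdiff w w') = 4" using ham_card ham_sdiff assms(1,2) by blast
  moreover have "card (sdiff w w') = card (w - w') + card (w' - w)"
    unfolding sdiff_def by (intro card_Un_disjoint) auto
  moreover have "card w = card (w - w') + card (w \<inter> w')" "card w' = card (w' - w) + card (w \<inter> w')"
    by (metis Int_commute Int_Diff_Un add.commute card_Un_disjoint finite Int_Diff_disjoint)+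
  ultimately show ?thesis using assms(3,4) by simp
qed

lemma gram_hh:
  assumes "w \<in> ham" "w' \<in> ham"
  shows "hform (hroot w) (hroot w') = (if w = w' then 2 else if w' = - w then -2 else 0)"
proof -
  have e: "hform (hroot w) (hroot w') = of_nat (card (w \<inter> w')) + cnj pG * nw w' + cnj (nw w) * pG"
    by (simp add: hroot_def hform_psi ip_wvec)
  have c: "w = {} \<or> w = UNIV \<or> w \<noteq> {} \<and> w \<noteq> UNIV \<and> card w = 4" if "w \<in> ham" for w using ham_card that by blast
  consider "w = {} \<or> w = UNIV \<or> w' = {} \<or> w' = UNIV" | "w \<noteq> {}" "w \<noteq> UNIV" "w' \<noteq> {}" "w' \<noteq> UNIV" by blast
  then show ?thesis
  proof cases
    case 1
    then show ?thesis using c[OF assms(1)] c[OF assms(2)] unfolding e by (auto simp: nw_def pG_def complex_eq_iff)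
  next
    case 2
    then have "card w = 4" "card w' = 4" using ham_card assms by auto
    moreover have "card (w \<inter> w') = (if w = w' then 4 else if w' = - w then 0 else 2)"
      using ham_card_Int[OF assms] \<open>card w = 4\<close> \<open>card w' = 4\<close> by auto
    ultimately show ?thesis using 2 unfolding e by (auto simp: nw_def pG_def complex_eq_iff)
  qed
qed

lemma DD_cases:
  assumes "d \<in> DD" obtains u where "d = Point u" | v where "v \<in> hyperplanes" "d = Hyper v"
  using assms by (auto simp: DD_def)

lemma hyp_word_compl: "hyp_word (- v) = - hyp_word v"
  by (auto simp: hyp_word_def)

lemma hyp_compl: assumes "v \<in> hyperplanes" shows "- v \<in> hyperplanes"
proof -
  have "- hyp_d k = hyp_h k" "- hyp_f k = hyp_b k" "- hyp_b k = hyp_f k" "- hyp_h k = hyp_d k" for k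
    by (auto simp: hyp_b_def hyp_h_def)
  then show ?thesis using assms unfolding hyperplanes_def by (elim UnE rangeE) simp_all
qed

text \<open>The squared moduli 2, 4 and 0 correspond to the braid relation, the relation of length
  four and commutation.\<close>

lemma gram_DD:
  assumes "d \<in> DD" "d' \<in> DD" "d \<noteq> d'"
  shows "hform (root_of d) (root_of d') =
    (if incident_pair d d' then (case d of Point _ \<Rightarrow> pG | Hyper _ \<Rightarrow> cnj pG) else if d' = t_a d then -2 else 0)"
  using assms(1)
proof (cases rule: DD_cases)
  case (1 u)
  note u = 1
  show ?thesis using assms(2)
  proof (cases rule: DD_cases)
    case (1 u')
    have "\<not> incident_pair d d'" unfolding u 1 by (auto simp: incident_pair_def doubleton_eq_iff)
    then show ?thesis using assms(3) unfolding u 1 by (simp add: root_of_Point gram_pp)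
  next
    case (2 v)
    have "incident_pair d d' \<longleftrightarrow> u \<in> v" unfolding u 2 by (auto simp: incident_pair_def doubleton_eq_iff)
    then show ?thesis unfolding u 2 by (simp add: root_of_Point root_of_Hyper 2(1) gram_ph point_mem)
  qed
next
  case (2 v)
  note v = 2
  show ?thesis using assms(2)
  proof (cases rule: DD_cases)
    case (1 u)
    have "incident_pair d d' \<longleftrightarrow> u \<in> v" unfolding v 1 by (auto simp: incident_pair_def doubleton_eq_iff)
    moreover have "hform (root_of d) (root_of d') = cnj (if u \<in> v then pG else 0)"
      unfolding v 1 by (subst hform_sym) (simp add: root_of_Point root_of_Hyper v(1) gram_ph point_mem)
    ultimately show ?thesis unfolding v 1 by simp
  next
    case (2 v')
    have "\<not> incident_pair d d'" unfolding v 2 by (auto simp: incident_pair_def doubleton_eq_iff)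
    moreover have "hyp_word v = hyp_word v' \<longleftrightarrow> v = v'" using inj_on_eq_iff[OF hyp_word_inj v(1) 2(1)] .
    moreover have "hyp_word v' = - hyp_word v \<longleftrightarrow> v' = - v"
      using inj_on_eq_iff[OF hyp_word_inj 2(1) hyp_compl[OF v(1)]] unfolding hyp_word_compl .
    ultimately show ?thesis using assms(3) unfolding v 2
      by (simp add: root_of_Hyper v(1) 2(1) gram_hh hyp_word_ham hyp_t_a)
  qed
qed

lemma card_hyperplanes: "card hyperplanes = 16"
proof -
  have r: "card (range f) = 4" if "\<And>j k. f j = f k \<longleftrightarrow> j = k" for f :: "4 \<Rightarrow> (bit^4) set"
    using card_image[of f UNIV] that by (simp add: inj_on_def)
  have "card (range hyp_d \<union> range hyp_f \<union> range hyp_b \<union> range hyp_h) = 4 + 4 + 4 + 4"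
  proof -
    have "range hyp_d \<inter> range hyp_f = {}" "(range hyp_d \<union> range hyp_f) \<inter> range hyp_b = {}"
      "(range hyp_d \<union> range hyp_f \<union> range hyp_b) \<inter> range hyp_h = {}"
      by (auto simp: hyp_eq)
    then show ?thesis by (simp add: card_Un_disjoint r hyp_eq)
  qed
  then show ?thesis by (simp add: hyperplanes_def)
qed

lemma card_points: "card (UNIV :: (bit^4) set) = 16"
proof -
  have "inj (\<lambda>u. (index_of u, flip u))" using point_eqI by (auto intro: injI)
  moreover have "range (\<lambda>u. (index_of u, flip u)) = UNIV"
  proof -
    have "(j, b) \<in> range (\<lambda>u. (index_of u, flip u))" for j b
      using index_of_point_at[of j] by (cases b) (auto intro: rev_image_eqI[of "point_at j"] rev_image_eqI[of "point_at j + pt_a"])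
    then show ?thesis by auto
  qed
  ultimately have "card (UNIV :: (bit^4) set) = card (UNIV :: (J \<times> bool) set)" using card_image by metis
  then show ?thesis by (simp add: card_cartesian_product flip: UNIV_Times_UNIV)
qed

text \<open>By counting: 16 hyperplanes have distinct traces, and there are at most 16 affine
  functions on \<open>J\<close>.\<close>

lemma hyp_word_image: "hyp_word ` hyperplanes = ham"
proof (rule card_subset_eq)
  show "hyp_word ` hyperplanes \<subseteq> ham" using hyp_word_ham by blast
  have "ham \<subseteq> range (\<lambda>(l, s). plane l s)" using ham_plane by fastforce
  then have "card ham \<le> card (range (\<lambda>(l, s). plane l s))" by (intro card_mono) auto
  also have "\<dots> \<le> card (UNIV :: (J \<times> bool) set)" by (rule card_image_le) simp
  also have "\<dots> = 16" by (simp add: card_cartesian_product flip: UNIV_Times_UNIV)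
  finally have "card ham \<le> 16" .
  moreover have "card (hyp_word ` hyperplanes) = 16" using card_image[OF hyp_word_inj] card_hyperplanes by simp
  moreover have "card (hyp_word ` hyperplanes) \<le> card ham" using \<open>hyp_word ` hyperplanes \<subseteq> ham\<close> by (intro card_mono) auto
  ultimately show "card (hyp_word ` hyperplanes) = card ham" by simp
qed simp

lemma root_of_DD: "root_of ` DD = gens"
proof -
  have "range proot = (\<Union>j. {psi (single j pG) 0 0, psi (single j (- pG)) 0 1})"
  proof
    show "(\<Union>j. {psi (single j pG) 0 0, psi (single j (- pG)) 0 1}) \<subseteq> range proot"
    proof -
      have "psi (single j pG) 0 0 = proot (point_at j)" "psi (single j (- pG)) 0 1 = proot (point_at j + pt_a)" for j
        by (simp_all add: proot_def index_of_point_at)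
      then show ?thesis by auto
    qed
  qed (auto simp: proot_def)
  moreover have "root_of ` Hyper ` hyperplanes = hroot ` hyp_word ` hyperplanes"
    unfolding image_image using root_of_Hyper by (intro image_cong) auto
  moreover have "root_of ` range Point = range proot" unfolding image_image root_of_Point ..
  ultimately show ?thesis unfolding DD_def image_Un hyp_word_image gens_def hroot_def[abs_def] by simp
qed

lemma root_of_norm: "d \<in> DD \<Longrightarrow> hform (root_of d) (root_of d) = 2"
  using root_of_DD norm2 by blast

text \<open>Equal roots at distinct elements of \<open>DD\<close> would have inner product 2, which
  is not among the values \<open>pG\<close>, \<open>cnj pG\<close>, -2, 0.\<close>

lemma card_roots: "card (root_of ` DD) = 32"
proof -
  have "inj_on root_of DD"
  proof (intro inj_onI, rule ccontr)
    fix d d' assume a: "d \<in> DD" "d' \<in> DD" "root_of d = root_of d'" "d \<noteq> d'"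
    have "hform (root_of d) (root_of d') = 2" using root_of_norm[OF a(2)] a(3) by simp
    then show False using gram_DD[OF a(1,2,4)]
      by (auto simp: pG_def complex_eq_iff split: if_splits vertex.splits)
  qed
  moreover have "card DD = 32"
  proof -
    have "card (range Point) = 16" using card_image[of Point UNIV] card_points by (simp add: inj_on_def)
    moreover have "card (Hyper ` hyperplanes) = 16" using card_image[of Hyper hyperplanes] card_hyperplanes by (simp add: inj_on_def)
    ultimately show ?thesis unfolding DD_def by (subst card_Un_disjoint) (auto intro: card_ge_0_finite)
  qed
  ultimately show ?thesis by (simp add: card_image)
qed

section \<open>Elements of \<open>L\<close> in the adapted coordinates\<close>

lemma D4G_iff: "(a, b) \<in> D4G \<longleftrightarrow> a \<in> gauss \<and> b \<in> gauss \<and> (divp a \<longleftrightarrow> divp b)"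
  unfolding D4G_def using divp_add[of a b] by (auto simp: divp_def)

lemma L_iff: "(x, m, n) \<in> L \<longleftrightarrow> (\<forall>j. fst (x $ j) \<in> gauss \<and> snd (x $ j) \<in> gauss \<and> (divp (fst (x $ j)) \<longleftrightarrow> divp (snd (x $ j)))) \<and> m \<in> gauss \<and> n \<in> gauss"
  unfolding L_def by (simp add: D4G_iff[symmetric])

lemma L_add: "x \<in> L \<Longrightarrow> y \<in> L \<Longrightarrow> x + y \<in> L"
  by (cases x; cases y) (simp add: L_iff divp_add)

lemma L_scale: "x \<in> L \<Longrightarrow> c \<in> gauss \<Longrightarrow> cscale c x \<in> L"
  by (cases x) (simp add: L_iff cscale_def divp_mult)

lemma L_diff: "x \<in> L \<Longrightarrow> y \<in> L \<Longrightarrow> x - y \<in> L"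
  by (cases x; cases y) (simp add: L_iff divp_diff)

lemma divp_addI: "divp x \<Longrightarrow> divp y \<Longrightarrow> divp (x + y)"
  using divp_add divp_gauss by blast

text \<open>The two entries of a block have equal parity, so the two products in
  \<open>D4G_form\<close> do too; \<open>G11_form\<close> has explicit factors.\<close>

lemma L_divp: assumes "x \<in> L" "y \<in> L" shows "divp (hform x y)"
proof -
  obtain v m n v' m' n' where e: "x = (v, m, n)" "y = (v', m', n')" by (cases x; cases y)
  have "divp (D4G_form (v $ j) (v' $ j))" for j
    using assms unfolding e L_iff D4G_form_def by (simp add: divp_add divp_mult divp_cnj)
  moreover have "divp (G11_form (m, n) (m', n'))"
    using assms unfolding e L_iff G11_form_def by (simp add: divp_add divp_mult)
  ultimately show ?thesis unfolding e hform_def sum_4 by (simp add: divp_addI)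
qed

lemma root_table_L: "root_table d x \<Longrightarrow> x \<in> L"
  by (induction rule: root_table.induct) (simp_all add: L_iff divp_mult divp_diff)

lemma root_of_L: "d \<in> DD \<Longrightarrow> root_of d \<in> L"
  using ex1_root_table root_table_L root_of_eq by metis

lemma nu_L: "null_vec \<in> L" "null_dual \<in> L"
  unfolding null_vec_def null_dual_def L_iff forall_4 by (simp_all add: divp_add)

text \<open>The four words tested are the supports of the parity checks that define
  \<open>ham\<close>.\<close>

lemma ham_dual:
  assumes "\<And>w. w \<in> ham \<Longrightarrow> even (card (w \<inter> W))" shows "W \<in> ham"
proof -
  have "{o0, o1, o2, o12} \<in> ham" "{o0, o1, o3, o13} \<in> ham" "{o0, o2, o3, o23} \<in> ham" "{o1, o2, o3, o123} \<in> ham"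
    by (simp_all add: ham_def)
  from this[THEN assms] show ?thesis
    unfolding card_J sum_J ham_def mem_Collect_eq
    by (cases "o0 \<in> W"; cases "o1 \<in> W"; cases "o2 \<in> W"; cases "o3 \<in> W"; simp add: of_bool_def split: if_splits)
qed

text \<open>The coordinates are inner products with elements of \<open>L\<close>, divided by
  \<open>pG\<close> or its conjugate. Pairing with the hyperplane roots makes the odd positions
  orthogonal to every word, hence a word by self-duality.\<close>

lemma L_integral_coords: assumes "x \<in> L" shows "integral_coords x"
proof -
  have p: "t * (pG / 2) = t / cnj pG" "t * (cnj pG / 2) = t / pG" for t
    using pG_simps(1,3) by (simp_all add: field_simps)
  have "frame_root j \<in> L" for j using root_of_L[of "Point (point_at j)"] by (simp add: DD_def root_of_Point proot_def index_of_point_at frame_root_psi)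
  then have z: "Zc x j \<in> gauss" for j unfolding Zc_def p using L_divp assms divp_div by blast
  have n: "Nc x \<in> gauss" unfolding Nc_def p using L_divp nu_L assms divp_div by blast
  obtain t where "t \<in> gauss" "hform null_vec x = pG * t" using L_divp[OF nu_L(1) assms] unfolding divp_def by blast
  then have m: "Mc x \<in> gauss" unfolding Mc_def p using pG_simps(3) by simp
  have "even (card (w \<inter> {j. \<not> divp (Zc x j)}))" if w: "w \<in> ham" for w
  proof -
    obtain v where v: "v \<in> hyperplanes" "w = hyp_word v" using w hyp_word_image by blast
    then have "hroot w \<in> L" using root_of_L[of "Hyper v"] by (simp add: DD_def root_of_Hyper)
    then have d: "divp (hform (hroot w) x)" using L_divp assms by blast
    have "hform (hroot w) x = ip (wvec w) (Zc x) + (cnj pG * Nc x + cnj (nw w) * pG * Mc x)"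
      using hform_psi[of "wvec w" 1 "nw w" "Zc x" "Mc x" "Nc x"] unfolding hroot_def psi_coords by (simp add: add.assoc)
    moreover have wg: "wvec w j \<in> gauss" for j by (simp add: wvec_def)
    then have "ip (wvec w) (Zc x) \<in> gauss" using z ip_gauss by blast
    ultimately have "divp (ip (wvec w) (Zc x))" using d m n by (simp add: divp_add divp_mult)
    moreover have "{j. \<not> divp (wvec w j)} = w" by (auto simp: wvec_def)
    ultimately show ?thesis using divp_ip[OF wg z] by simp
  qed
  then have "{j. \<not> divp (Zc x j)} \<in> ham" by (rule ham_dual)
  then show ?thesis using z m n by (simp add: integral_coords_def Alat_def)
qed

section \<open>Coxeter relations and the generated group\<close>

text \<open>Products of the two reflections keep \<open>x\<close> within its coset modulo the span
  of \<open>r\<close> and \<open>s\<close>. Tracking the coefficients \<open>A\<close>,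
  \<open>B\<close> turns the Coxeter relations into polynomial identities in
  \<open>c\<close>.\<close>

lemma rf_pair:
  assumes "hform r r = 2" "c = (1 - \<i>) / 2"
  shows "rf r (x - cscale A r - cscale B s) = x - cscale (A + c * (hform r x - 2 * A - hform r s * B)) r - cscale B s"
proof -
  have e: "(1 - \<i>) * (hform r (x - cscale A r - cscale B s) / 2) = c * (hform r x - 2 * A - hform r s * B)"
    using assms by (simp add: hform_simps mult.commute)
  show ?thesis unfolding rf_def e cscale_add_left by (simp only: diff_diff_eq add_ac)
qed

lemma rf_pair':
  assumes "hform s s = 2" "c = (1 - \<i>) / 2"
  shows "rf s (x - cscale A r - cscale B s) = x - cscale A r - cscale (B + c * (hform s x - 2 * B - hform s r * A)) s"
  using rf_pair[OF assms, of x B A r] by (simp add: algebra_simps)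

text \<open>Equivalent to \<open>(1 - 2 * c)^2 = -1\<close>, where \<open>1 - 2 * c = \<i>\<close>
  is the eigenvalue of the reflection on its root.\<close>

lemma half_square: assumes "c = (1 - \<i>) / 2" shows "2 * (c * c) = 2 * c - 1"
  unfolding assms by (simp add: complex_eq_iff)

lemma rf_commute:
  assumes "hform r r = 2" "hform s s = 2" "hform r s = 0"
  shows "rf r \<circ> rf s = rf s \<circ> rf r"
proof
  fix x
  have "hform s r = 0" using hform_sym[of r s] assms(3) by simp
  then show "(rf r \<circ> rf s) x = (rf s \<circ> rf r) x"
    using assms by (simp add: rf_def hform_simps algebra_simps)
qed

lemma rf_braid:
  assumes n: "hform r r = 2" "hform s s = 2" and pq: "hform r s * cnj (hform r s) = 2"
  shows "rf r \<circ> rf s \<circ> rf r = rf s \<circ> rf r \<circ> rf s"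
proof
  fix x
  define c where "c = (1 - \<i>) / 2"
  define a b p q where "a = hform r x" and "b = hform s x" and "p = hform r s" and "q = hform s r"
  note R = rf_pair[OF n(1) c_def, of x _ _ s, folded a_def p_def]
    and S = rf_pair'[OF n(2) c_def, of x _ r, folded b_def q_def]
  have x: "x = x - cscale 0 r - cscale 0 s" by simp
  have e: "2 * (c * c) = 2 * c - 1" by (rule half_square[OF c_def])
  have pq: "p * q = 2" using pq hform_sym[of r s] by (simp add: p_def q_def)
  have "c * a + c * (a - 2 * (c * a) - p * (c * (b - q * (c * a)))) = c * (a - p * (c * b))"
    "c * (b - q * (c * a)) = c * b + c * (b - 2 * (c * b) - q * (c * (a - p * (c * b))))"
    using e pq by algebra+
  then have "rf r (rf s (rf r (x - cscale 0 r - cscale 0 s))) = rf s (rf r (rf s (x - cscale 0 r - cscale 0 s)))"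
    unfolding R S by simp
  then show "(rf r \<circ> rf s \<circ> rf r) x = (rf s \<circ> rf r \<circ> rf s) x" by simp
qed

lemma rf_braid4:
  assumes n: "hform r r = 2" "hform s s = 2" and pq: "hform r s = -2"
  shows "rf r \<circ> rf s \<circ> rf r \<circ> rf s = rf s \<circ> rf r \<circ> rf s \<circ> rf r"
proof
  fix x
  define c where "c = (1 - \<i>) / 2"
  define a b where "a = hform r x" and "b = hform s x"
  have q: "hform s r = -2" using hform_sym[of s r] pq by simp
  note R = rf_pair[OF n(1) c_def, of x _ _ s, folded a_def, unfolded pq]
    and S = rf_pair'[OF n(2) c_def, of x _ r, folded b_def, unfolded q]
  have e: "2 * (c * c) = 2 * c - 1" by (rule half_square[OF c_def])
  define f g where "f A B = A + c * (a - 2 * A - -2 * B)" and "g A B = B + c * (b - 2 * B - -2 * A)" for A B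
  have "f (f 0 (g 0 0)) (g (f 0 (g 0 0)) (g 0 0)) = f (f 0 0) (g (f 0 0) 0)"
    "g (f 0 (g 0 0)) (g 0 0) = g (f (f 0 0) (g (f 0 0) 0)) (g (f 0 0) 0)"
    unfolding f_def g_def using e by algebra+
  then have "rf r (rf s (rf r (rf s (x - cscale 0 r - cscale 0 s)))) = rf s (rf r (rf s (rf r (x - cscale 0 r - cscale 0 s))))"
    unfolding R[folded f_def] S[folded g_def] by simp
  then show "(rf r \<circ> rf s \<circ> rf r \<circ> rf s) x = (rf s \<circ> rf r \<circ> rf s \<circ> rf r) x" by simp
qed

section \<open>From maps of the ambient space to the group \<open>Aut_L\<close>\<close>

lemma Aut_subgroup: "subgroup lattice_auts (BijGroup L)"
proof (rule group.subgroupI[OF group_BijGroup])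
  have car: "carrier (BijGroup L) = Bij L" by (simp add: BijGroup_def)
  show "lattice_auts \<subseteq> carrier (BijGroup L)" unfolding car by (auto simp: lattice_auts_def)
  have "(\<lambda>x\<in>L. x) \<in> lattice_auts" by (simp add: lattice_auts_def id_Bij L_add L_scale)
  then show "lattice_auts \<noteq> {}" by blast
  fix f assume f: "f \<in> lattice_auts"
  then have fB: "f \<in> Bij L" by (simp add: lattice_auts_def)
  then have img: "f ` L = L" "inj_on f L" by (simp_all add: Bij_def bij_betw_def)
  let ?g = "\<lambda>x\<in>L. inv_into L f x"
  have inj: "x = y" if "x \<in> L" "y \<in> L" "f x = f y" for x y using img(2) that by (simp add: inj_on_def)
  have gL: "inv_into L f x \<in> L" "f (inv_into L f x) = x" if "x \<in> L" for x
    using that img(1) by (simp_all add: inv_into_into f_inv_into_f)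
  have lin: "f (x + y) = f x + f y" "hform (f x) (f y) = hform x y" if "x \<in> L" "y \<in> L" for x y
    using f that by (simp_all add: lattice_auts_def)
  have sc: "f (cscale c x) = cscale c (f x)" if "c \<in> gauss" "x \<in> L" for c x
    using f that by (simp add: lattice_auts_def)
  have "inv_into L f (x + y) = inv_into L f x + inv_into L f y" if "x \<in> L" "y \<in> L" for x y
    by (rule inj) (simp_all add: gL that L_add lin)
  moreover have "inv_into L f (cscale c x) = cscale c (inv_into L f x)" if "c \<in> gauss" "x \<in> L" for c x
    by (rule inj) (simp_all add: gL that L_scale sc)
  moreover have "hform (inv_into L f x) (inv_into L f y) = hform x y" if "x \<in> L" "y \<in> L" for x y
    using lin(2)[of "inv_into L f x" "inv_into L f y"] that gL by simp
  ultimately have "?g \<in> lattice_auts"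
    using restrict_inv_into_Bij[OF fB] by (simp add: lattice_auts_def L_add L_scale)
  then show "inv\<^bsub>BijGroup L\<^esub> f \<in> lattice_auts" using inv_BijGroup[OF fB] by simp
  fix g assume g: "g \<in> lattice_auts"
  then have gB: "g \<in> Bij L" by (simp add: lattice_auts_def)
  have "g x \<in> L" if "x \<in> L" for x using Bij_imp_funcset[OF gB] that by blast
  then have "compose L f g \<in> lattice_auts"
    using f g compose_Bij[OF fB gB] by (simp add: lattice_auts_def compose_def L_add L_scale)
  then show "f \<otimes>\<^bsub>BijGroup L\<^esub> g \<in> lattice_auts" using fB gB by (simp add: BijGroup_def)
qed

lemma Aut_group: "group Aut_L"
  unfolding Aut_L_def by (rule group.subgroup_imp_group[OF group_BijGroup Aut_subgroup])

lemma Aut_carrier: "carrier Aut_L = lattice_auts"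
  by (simp add: Aut_L_def)

lemma Aut_one: "\<one>\<^bsub>Aut_L\<^esub> = restrict id L"
  by (simp add: Aut_L_def BijGroup_def id_def)

text \<open>Multiplication in \<open>Aut_L\<close> composes functions restricted to
  \<open>L\<close>; for maps of this kind identities between unrestricted compositions carry over
  (\<open>acts_mult\<close>).\<close>

definition acts :: "(gvec \<Rightarrow> gvec) \<Rightarrow> bool" where
  "acts f \<longleftrightarrow> f \<in> L \<rightarrow> L \<and> restrict f L \<in> lattice_auts"

lemma acts_mult:
  assumes "acts f" "acts g" shows "restrict f L \<otimes>\<^bsub>Aut_L\<^esub> restrict g L = restrict (f \<circ> g) L"
proof -
  have "restrict f L \<in> Bij L" "restrict g L \<in> Bij L" using assms by (auto simp: acts_def lattice_auts_def)
  then have "restrict f L \<otimes>\<^bsub>Aut_L\<^esub> restrict g L = compose L (restrict f L) (restrict g L)"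
    by (simp add: Aut_L_def BijGroup_def)
  also have "\<dots> = restrict (f \<circ> g) L" using assms(2) by (auto simp: compose_def acts_def fun_eq_iff)
  finally show ?thesis .
qed

lemma acts_comp: assumes "acts f" "acts g" shows "acts (f \<circ> g)"
proof -
  have "restrict (f \<circ> g) L \<in> carrier Aut_L"
    unfolding acts_mult[OF assms, symmetric] using assms
    by (intro monoid.m_closed group.is_monoid Aut_group) (auto simp: acts_def Aut_carrier)
  then show ?thesis using assms by (auto simp: acts_def Aut_carrier)
qed

lemma rf_L: assumes "s \<in> roots" "x \<in> L" shows "rf s x \<in> L"
proof -
  have s: "s \<in> L" using assms(1) by (simp add: roots_def)
  obtain q where q: "q \<in> gauss" "hform s x = pG * q" using L_divp[OF s assms(2)] unfolding divp_def by blast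
  have "(1 - \<i>) * (hform s x / 2) = q" using half_pG(2)[of q] unfolding q(2) by simp
  then show ?thesis unfolding rf_def using s assms(2) q(1) by (simp add: L_diff L_scale)
qed

lemma refl_i_eq: "s \<in> roots \<Longrightarrow> refl_i s = restrict (rf s) L"
  by (simp add: refl_i_def rf_def roots_def fun_eq_iff)

lemma acts_rf: assumes "s \<in> roots" shows "acts (rf s)"
proof -
  have n: "hform s s = 2" using assms by (simp add: roots_def)
  have "bij_betw (rf s) L L"
    by (rule bij_betwI[where g = "\<lambda>x. rf s (rf s (rf s x))"]) (simp_all add: rf_L[OF assms] rf_pow4[OF n])
  then have "restrict (rf s) L \<in> Bij L" by (simp add: Bij_def bij_betw_restrict_eq)
  then show ?thesis using rf_L[OF assms] isomD[OF rf_isom[OF n]] by (simp add: acts_def lattice_auts_def L_add L_scale)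
qed

lemma gens_roots: "gens \<subseteq> roots"
  unfolding root_of_DD[symmetric] roots_def using root_of_L root_of_norm by blast

lemma rgrp_generate:
  assumes "g \<in> rgrp gens" shows "acts g \<and> restrict g L \<in> generate Aut_L (refl_i ` gens)"
  using assms
proof induction
  case rgrp_id
  have "restrict id L \<in> lattice_auts" using group.is_monoid[OF Aut_group] monoid.one_closed Aut_one Aut_carrier by metis
  moreover have "id \<in> L \<rightarrow> L" by simp
  ultimately show ?case unfolding acts_def using generate.one[of Aut_L "refl_i ` gens", unfolded Aut_one] by blast
next
  case (rgrp_step g r)
  then have r: "r \<in> roots" using gens_roots by blast
  have "restrict (rf r \<circ> g) L = refl_i r \<otimes>\<^bsub>Aut_L\<^esub> restrict g L"
    using acts_mult[OF acts_rf[OF r]] rgrp_step.IH refl_i_eq[OF r] by simp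
  also have "\<dots> \<in> generate Aut_L (refl_i ` gens)"
    using rgrp_step generate.incl[of "refl_i r" "refl_i ` gens" Aut_L] by (blast intro: generate.eng)
  finally show ?case using acts_comp[OF acts_rf[OF r]] rgrp_step.IH by blast
qed

lemma generate_gens: "generate Aut_L (refl_i ` gens) = R_L"
proof -
  interpret group Aut_L by (rule Aut_group)
  have "refl_i ` gens \<subseteq> refl_i ` roots" using gens_roots by blast
  moreover have "refl_i ` roots \<subseteq> carrier Aut_L" using acts_rf refl_i_eq by (auto simp: acts_def Aut_carrier)
  ultimately have sub: "subgroup (generate Aut_L (refl_i ` gens)) Aut_L" by (intro generate_is_subgroup) auto
  have "refl_i s \<in> generate Aut_L (refl_i ` gens)" if s: "s \<in> roots" for s
  proof -
    have "s \<in> refl_roots" using s L_integral_coords integral_coords_refl_roots by (auto simp: roots_def)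
    then have "rf s \<in> rgrp gens" by (simp add: refl_roots_def)
    then show ?thesis using rgrp_generate refl_i_eq[OF s] by simp
  qed
  then have "refl_i ` roots \<subseteq> generate Aut_L (refl_i ` gens)" by blast
  then have "R_L \<subseteq> generate Aut_L (refl_i ` gens)"
    unfolding R_L_def using sub by (rule generate_subgroup_incl)
  moreover have "generate Aut_L (refl_i ` gens) \<subseteq> R_L"
    unfolding R_L_def using \<open>refl_i ` gens \<subseteq> refl_i ` roots\<close> by (rule mono_generate)
  ultimately show ?thesis by blast
qed

theorem theorem5p9:
  shows "(root_of ` DD \<subseteq> roots \<and> card (root_of ` DD) = 32) \<and>
    generate Aut_L (refl_i ` root_of ` DD) = R_L \<and>
    (\<forall>d\<in>DD. \<forall>d'\<in>DD. d \<noteq> d' \<longrightarrow>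
      (let R = refl_i (root_of d); R' = refl_i (root_of d') in
        if incident_pair d d' then
          R \<otimes>\<^bsub>Aut_L\<^esub> R' \<otimes>\<^bsub>Aut_L\<^esub> R = R' \<otimes>\<^bsub>Aut_L\<^esub> R \<otimes>\<^bsub>Aut_L\<^esub> R'
        else if d' = t_a d then
          R \<otimes>\<^bsub>Aut_L\<^esub> R' \<otimes>\<^bsub>Aut_L\<^esub> R \<otimes>\<^bsub>Aut_L\<^esub> R' = R' \<otimes>\<^bsub>Aut_L\<^esub> R \<otimes>\<^bsub>Aut_L\<^esub> R' \<otimes>\<^bsub>Aut_L\<^esub> R
        else
          R \<otimes>\<^bsub>Aut_L\<^esub> R' = R' \<otimes>\<^bsub>Aut_L\<^esub> R))"
proof (intro conjI ballI impI, goal_cases)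
  case (4 d d')
  note d = 4
  define r s where rs: "r = root_of d" "s = root_of d'"
  have r: "r \<in> roots" "s \<in> roots" unfolding rs using d(1,2) gens_roots root_of_DD by auto
  then have n: "hform r r = 2" "hform s s = 2" by (simp_all add: roots_def)
  note a = acts_rf[OF r(1)] acts_rf[OF r(2)]
  note gram = gram_DD[OF d, folded rs]
  have 3: "rf r \<circ> rf s \<circ> rf r = rf s \<circ> rf r \<circ> rf s" if "incident_pair d d'"
    using that gram pG_simps(1,2) by (intro rf_braid n) (auto split: vertex.splits)
  have 4: "rf r \<circ> rf s \<circ> rf r \<circ> rf s = rf s \<circ> rf r \<circ> rf s \<circ> rf r" if "\<not> incident_pair d d'" "d' = t_a d"
    using that gram by (intro rf_braid4 n) auto
  have 2: "rf r \<circ> rf s = rf s \<circ> rf r" if "\<not> incident_pair d d'" "d' \<noteq> t_a d"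
    using that gram by (intro rf_commute n) auto
  show ?case
    unfolding Let_def rs[symmetric] refl_i_eq[OF r(1)] refl_i_eq[OF r(2)]
    using 2 3 4 by (auto simp: acts_mult acts_comp a)
qed (use gens_roots card_roots generate_gens in \<open>simp_all add: root_of_DD\<close>)

end
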